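(* The similarity classes of self-similar half-plane packings that are not strip packings are in one-to-one correspondence with the finite, non-repeating (nonempty) sequences of positive integers, up to cyclic permutation. The correspondence sends the similarity class of $\mathcal{P}_\alpha$ to the minimal periodic part of the (infinite, eventually periodic) continued fraction expansion of $\alpha$, taken up to cyclic permutation. A packing in such a class has an orientation-reversing self-similarity if and only if the length of the corresponding sequence is odd.
   Context: A \emph{circle} in $\mathbb{R}^2$ is a Euclidean circle or a straight line, together with a choice of one of the two components of its complement, called its \emph{interior} (possibly the unbounded component; for a line, one of the two half-planes). Parallel lines are regarded as tangent (at infinity). An \emph{Apollonian circle packing} is a collection $\mathcal{P}$ of circles with pairwise disjoint interiors such that (i) $\mathcal{P}$ contains three mutually tangent circles, and (ii) any circle tangent to three mutually tangent circles of $\mathcal{P}$ (with interior chosen so that interiors are disjoint) is also in $\mathcal{P}$. Given a set $\mathcal{P}^{(0)}$ of three mutually tangent circles with disjoint interiors, let $\mathcal{P}^{(n+1)}$ consist of $\mathcal{P}^{(n)}$ together with all circles tangent to three mutually tangent circles in $\mathcal{P}^{(n)}$; the packing generated by $\mathcal{P}^{(0)}$ is $\bigcup_{n\ge0}\mathcal{P}^{(n)}$, which is an Apollonian circle packing. The curvature of a circle is the reciprocal of its radius; a line has curvature $0$. A \emph{half-plane packing} is an Apollonian circle packing containing at least one line; a \emph{strip packing} is one containing two (necessarily parallel) lines. For $\alpha>0$, $\mathcal{P}_\alpha$ is the packing generated by $\{X,Y,L\}$, where $L$ is the $x$-axis (with interior the lower half-plane), $X$ is the circle of curvature $\alpha^2$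 lying above $L$ and tangent to $L$ at the origin, and $Y$ is the circle of curvature $1$ lying above $L$, tangent to $L$ and tangent to $X$ on the right. Every half-plane packing is similar to some $\mathcal{P}_\alpha$ with $\alpha>0$. A similarity of $\mathbb{R}^2$ is a map $\Phi(x)=\mu Ax+b$ with $\mu>0$, $A$ an orthogonal $2\times2$ matrix, $b\in\mathbb{R}^2$; it is orientation-reversing if $\det A=-1$. Packings $\mathcal{P},\mathcal{P}'$ are similar if $\mathcal{P}'=\Phi\cdot\mathcal{P}:=\{\Phi(C):C\in\mathcal{P}\}$ for some similarity $\Phi$. A self-similarity of $\mathcal{P}$ is a similarity with $\Phi\cdot\mathcal{P}=\mathcal{P}$; $\mathcal{P}$ is self-similar if it has a self-similarity other than the identity. A finite sequence is non-repeating if it cannot be realized as a concatenation of multiple copies of a shorter sequence. Continued fraction expansions are the standard ones $\alpha=[a_0,a_1,a_2,\dots]$ with integers $a_0\ge 0$, $a_k>0$ for $k>0$. If $\alpha=[a_0,\dots,a_{n-1},\overline{c_0,\dots,c_{m-1}}]$ with $m$ minimal, the minimal periodic part is $(c_0,\dots,c_{m-1})$, well defined up to cyclic permutation. *)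

theory Defs
  imports "HOL-Analysis.Analysis"
begin

text \<open>
  A (generalised) circle is a pair consisting of the underlying curve and the chosen
  component of its complement, the interior.
\<close>

type_synonym circ = "(real^2) set \<times> (real^2) set"

definition is_line :: "(real^2) set \<Rightarrow> bool" where
  "is_line S \<longleftrightarrow> (\<exists>a b. a \<noteq> 0 \<and> S = {x. a \<bullet> x = b})"

definition is_circle :: "circ \<Rightarrow> bool" where
  "is_circle C \<longleftrightarrow>
     ((\<exists>c r. r > 0 \<and> fst C = sphere c r) \<or> is_line (fst C)) \<and> snd C \<in> components (- fst C)"

text \<open>
  Two lines are tangent iff they are parallel and distinct, which in the plane means that
  they do not meet.  In all other cases tangency means having exactly one common point.
\<close>

definition tangent :: "circ \<Rightarrow> circ \<Rightarrow> bool" where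
  "tangent C D \<longleftrightarrow>
     (if is_line (fst C) \<and> is_line (fst D) then fst C \<inter> fst D = {}
      else (\<exists>p. fst C \<inter> fst D = {p}))"

definition disjoint_interiors :: "circ \<Rightarrow> circ \<Rightarrow> bool" where
  "disjoint_interiors C D \<longleftrightarrow> snd C \<inter> snd D = {}"

definition mutually_tangent :: "circ \<Rightarrow> circ \<Rightarrow> circ \<Rightarrow> bool" where
  "mutually_tangent C1 C2 C3 \<longleftrightarrow> tangent C1 C2 \<and> tangent C2 C3 \<and> tangent C1 C3"

definition soddy_circles :: "circ set \<Rightarrow> circ set" where
  "soddy_circles P = {D. is_circle D \<and>
     (\<exists>C1\<in>P. \<exists>C2\<in>P. \<exists>C3\<in>P. mutually_tangent C1 C2 C3 \<and>
        (\<forall>C\<in>{C1, C2, C3}. tangent D C \<and> disjoint_interiors D C))}"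

definition apollonian_packing :: "circ set \<Rightarrow> bool" where
  "apollonian_packing P \<longleftrightarrow>
     (\<forall>C\<in>P. is_circle C) \<and>
     pairwise disjoint_interiors P \<and>
     (\<exists>C1\<in>P. \<exists>C2\<in>P. \<exists>C3\<in>P. mutually_tangent C1 C2 C3) \<and>
     soddy_circles P \<subseteq> P"

primrec generation :: "circ set \<Rightarrow> nat \<Rightarrow> circ set" where
  "generation P0 0 = P0"
| "generation P0 (Suc n) = generation P0 n \<union> soddy_circles (generation P0 n)"

definition generated_packing :: "circ set \<Rightarrow> circ set" where
  "generated_packing P0 = (\<Union>n. generation P0 n)"

definition half_plane_packing :: "circ set \<Rightarrow> bool" where
  "half_plane_packing P \<longleftrightarrow> apollonian_packing P \<and> (\<exists>C\<in>P. is_line (fst C))"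

definition strip_packing :: "circ set \<Rightarrow> bool" where
  "strip_packing P \<longleftrightarrow> apollonian_packing P \<and>
     (\<exists>C\<in>P. \<exists>D\<in>P. C \<noteq> D \<and> is_line (fst C) \<and> is_line (fst D))"

definition disc_circ :: "real^2 \<Rightarrow> real \<Rightarrow> circ" where
  "disc_circ c r = (sphere c r, ball c r)"

definition circ_L :: circ where
  "circ_L = ({x. x $ 2 = 0}, {x. x $ 2 < 0})"

definition circ_X :: "real \<Rightarrow> circ" where
  "circ_X \<alpha> = disc_circ (vector [0, 1 / \<alpha>\<^sup>2]) (1 / \<alpha>\<^sup>2)"

text \<open>
  Circles of radii r and s resting on the x-axis are tangent iff their points of contact with
  the axis are 2 * sqrt (r * s) apart.  For r = 1 / \<alpha>^2 and s = 1 this distance is 2 / \<alpha>;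
  lemma circ_XYL below checks the tangencies.
\<close>

definition circ_Y :: "real \<Rightarrow> circ" where
  "circ_Y \<alpha> = disc_circ (vector [2 / \<alpha>, 1]) 1"

lemma tangent_spheres:
  fixes c d :: "real^2"
  assumes "r > 0" "s > 0" "dist c d = r + s"
  shows "\<exists>p. sphere c r \<inter> sphere d s = {p}" and "ball c r \<inter> ball d s = {}"
proof -
  define p where "p = c + (r / (r + s)) *\<^sub>R (d - c)"
  have n: "norm (d - c) = r + s"
    using assms by (simp add: dist_norm norm_minus_commute)
  have "sphere c r \<inter> sphere d s = {p}"
  proof (intro equalityI subsetI)
    fix x assume "x \<in> sphere c r \<inter> sphere d s"
    then have x: "norm (x - c) = r" "norm (d - x) = s"
      by (auto simp: dist_norm norm_minus_commute)
    then have "norm ((x - c) + (d - x)) = norm (x - c) + norm (d - x)"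
      using n by simp
    then have eq: "r *\<^sub>R (d - x) = s *\<^sub>R (x - c)"
      using x norm_triangle_eq[of "x - c" "d - x"] by metis
    then have "(r + s) *\<^sub>R (x - c) = r *\<^sub>R (d - c)"
      by (simp add: algebra_simps)
    then have "(1 / (r + s)) *\<^sub>R ((r + s) *\<^sub>R (x - c)) = (1 / (r + s)) *\<^sub>R (r *\<^sub>R (d - c))"
      by simp
    then have "x - c = (r / (r + s)) *\<^sub>R (d - c)"
      using assms by simp
    then have "x = p"
      unfolding p_def by (metis add.commute diff_add_cancel)
    then show "x \<in> {p}" by simp
  next
    fix x assume "x \<in> {p}"
    moreover have "norm (p - c) = r"
      using assms n by (simp add: p_def)
    moreover have "d - p = (1 - r / (r + s)) *\<^sub>R (d - c)"
      by (simp add: p_def algebra_simps)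
    then have "d - p = (s / (r + s)) *\<^sub>R (d - c)"
      using assms by (simp add: field_simps)
    then have "norm (d - p) = s"
      using assms n by simp
    ultimately show "x \<in> sphere c r \<inter> sphere d s"
      by (auto simp: dist_norm norm_minus_commute)
  qed
  then show "\<exists>p. sphere c r \<inter> sphere d s = {p}" by blast
  show "ball c r \<inter> ball d s = {}"
    using assms by (intro disjoint_ballI) simp
qed

lemma vec2_eq_iff: "(x::real^2) = y \<longleftrightarrow> x $ 1 = y $ 1 \<and> x $ 2 = y $ 2"
  by (simp add: vec_eq_iff forall_2)

lemma dist_vec2: "dist (x::real^2) y = sqrt ((x $ 1 - y $ 1)\<^sup>2 + (x $ 2 - y $ 2)\<^sup>2)"
  by (simp add: dist_vec_def L2_set_def sum_2 dist_real_def)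

lemma sqrt_eq_iff_sq: "r > 0 \<Longrightarrow> sqrt y = r \<longleftrightarrow> y = r\<^sup>2"
  using real_sqrt_unique[of r y] real_sqrt_pow2_iff[of y] by auto

lemma bounded_not_line:
  fixes c :: "real^2"
  shows "\<not> is_line (sphere c r)"
proof
  assume "is_line (sphere c r)"
  then obtain a b where ab: "a \<noteq> 0" "sphere c r = {x. a \<bullet> x = b}"
    unfolding is_line_def by blast
  define v :: "real^2" where "v = vector [- (a $ 2), a $ 1]"
  have v: "a \<bullet> v = 0" "v \<noteq> 0"
    using ab(1) by (auto simp: v_def inner_vec_def sum_2 vec2_eq_iff)
  define q where "q = (b / (a \<bullet> a)) *\<^sub>R a"
  have "q + t *\<^sub>R v \<in> sphere c r" for t
    unfolding ab(2) using ab(1) v(1) by (simp add: q_def inner_add_right)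
  then have *: "norm (q + t *\<^sub>R v - c) = r" for t
    by (simp add: dist_norm norm_minus_commute)
  define t where "t = (2 * r + 1) / norm v"
  have "norm (t *\<^sub>R v) \<le> norm (q + t *\<^sub>R v - c) + norm (q + 0 *\<^sub>R v - c)"
    using norm_triangle_ineq4[of "q + t *\<^sub>R v - c" "q + 0 *\<^sub>R v - c"] by simp
  also have "\<dots> = 2 * r" using *[of t] *[of 0] by simp
  finally have "\<bar>2 * r + 1\<bar> \<le> 2 * r"
    using v(2) by (simp add: t_def)
  then show False by linarith
qed

lemma disc_circ_axis:
  assumes "r > 0"
  shows "tangent (disc_circ (vector [x, r]) r) circ_L"
    and "disjoint_interiors (disc_circ (vector [x, r]) r) circ_L"
proof -
  have "z \<in> sphere (vector [x, r]) r \<and> z $ 2 = 0 \<longleftrightarrow> z = vector [x, 0]" for z :: "real^2"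
  proof -
    have "z \<in> sphere (vector [x, r]) r \<longleftrightarrow> (x - z $ 1)\<^sup>2 + (r - z $ 2)\<^sup>2 = r\<^sup>2"
      using assms by (simp add: dist_vec2 sqrt_eq_iff_sq)
    then show ?thesis
      by (auto simp: vec2_eq_iff)
  qed
  then have "sphere (vector [x, r]) r \<inter> {z::real^2. z $ 2 = 0} = {vector [x, 0]}"
    by blast
  then show "tangent (disc_circ (vector [x, r]) r) circ_L"
    by (auto simp: tangent_def disc_circ_def circ_L_def bounded_not_line)
  have False if "z \<in> ball (vector [x, r]) r" "z $ 2 < 0" for z :: "real^2"
  proof -
    have "\<bar>(vector [x, r] - z :: real^2) $ 2\<bar> \<le> norm (vector [x, r] - z :: real^2)"
      by (rule component_le_norm_cart)
    then show False
      using that by (simp add: dist_norm)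
  qed
  then show "disjoint_interiors (disc_circ (vector [x, r]) r) circ_L"
    by (auto simp: disjoint_interiors_def disc_circ_def circ_L_def simp del: mem_ball)
qed

lemma circ_XYL:
  assumes "\<alpha> > 0"
  shows "mutually_tangent (circ_X \<alpha>) (circ_Y \<alpha>) circ_L"
    and "pairwise disjoint_interiors {circ_X \<alpha>, circ_Y \<alpha>, circ_L}"
proof -
  define c d :: "real^2" where "c = vector [0, 1 / \<alpha>\<^sup>2]" and "d = vector [2 / \<alpha>, 1]"
  have "(2 / \<alpha>)\<^sup>2 + (1 / \<alpha>\<^sup>2 - 1)\<^sup>2 = (1 / \<alpha>\<^sup>2 + 1)\<^sup>2"
    using assms by (simp add: power2_eq_square field_simps)
  then have "dist c d = 1 / \<alpha>\<^sup>2 + 1"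
    by (simp add: dist_vec2 c_def d_def power2_eq_square)
  then have XY: "\<exists>p. sphere c (1 / \<alpha>\<^sup>2) \<inter> sphere d 1 = {p}"
      "ball c (1 / \<alpha>\<^sup>2) \<inter> ball d 1 = {}"
    using tangent_spheres[of "1 / \<alpha>\<^sup>2" 1 c d] assms by auto
  have T: "tangent (circ_X \<alpha>) (circ_Y \<alpha>)" "disjoint_interiors (circ_X \<alpha>) (circ_Y \<alpha>)"
    using XY by (auto simp: tangent_def disjoint_interiors_def circ_X_def circ_Y_def disc_circ_def
        bounded_not_line c_def d_def)
  have L: "tangent (circ_X \<alpha>) circ_L" "disjoint_interiors (circ_X \<alpha>) circ_L"
      "tangent (circ_Y \<alpha>) circ_L" "disjoint_interiors (circ_Y \<alpha>) circ_L"
    using assms disc_circ_axis[of "1 / \<alpha>\<^sup>2" 0] disc_circ_axis[of 1 "2 / \<alpha>"]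
    by (simp_all add: circ_X_def circ_Y_def)
  show "mutually_tangent (circ_X \<alpha>) (circ_Y \<alpha>) circ_L"
    using T L by (simp add: mutually_tangent_def)
  show "pairwise disjoint_interiors {circ_X \<alpha>, circ_Y \<alpha>, circ_L}"
    using T L by (auto simp: pairwise_def disjoint_interiors_def)
qed

definition packing :: "real \<Rightarrow> circ set" where
  "packing \<alpha> = generated_packing {circ_X \<alpha>, circ_Y \<alpha>, circ_L}"

definition similarity_map :: "real \<Rightarrow> real^2^2 \<Rightarrow> real^2 \<Rightarrow> real^2 \<Rightarrow> real^2" where
  "similarity_map \<mu> A b = (\<lambda>x. \<mu> *\<^sub>R (A *v x) + b)"

definition is_similarity :: "(real^2 \<Rightarrow> real^2) \<Rightarrow> bool" where
  "is_similarity \<Phi> \<longleftrightarrow>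
     (\<exists>\<mu> A b. \<mu> > 0 \<and> orthogonal_matrix A \<and> \<Phi> = similarity_map \<mu> A b)"

definition orientation_reversing :: "(real^2 \<Rightarrow> real^2) \<Rightarrow> bool" where
  "orientation_reversing \<Phi> \<longleftrightarrow>
     (\<exists>\<mu> A b. \<mu> > 0 \<and> orthogonal_matrix A \<and> det A = -1 \<and> \<Phi> = similarity_map \<mu> A b)"

definition act :: "(real^2 \<Rightarrow> real^2) \<Rightarrow> circ set \<Rightarrow> circ set" where
  "act \<Phi> P = (\<lambda>C. (\<Phi> ` fst C, \<Phi> ` snd C)) ` P"

definition similarity :: "(circ set \<times> circ set) set" where
  "similarity = {(P, Q). \<exists>\<Phi>. is_similarity \<Phi> \<and> Q = act \<Phi> P}"

definition self_similarity :: "(real^2 \<Rightarrow> real^2) \<Rightarrow> circ set \<Rightarrow> bool" where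
  "self_similarity \<Phi> P \<longleftrightarrow> is_similarity \<Phi> \<and> act \<Phi> P = P"

definition self_similar :: "circ set \<Rightarrow> bool" where
  "self_similar P \<longleftrightarrow> (\<exists>\<Phi>. self_similarity \<Phi> P \<and> \<Phi> \<noteq> id)"

definition self_similar_half_plane_packings :: "circ set set" where
  "self_similar_half_plane_packings =
     {P. half_plane_packing P \<and> \<not> strip_packing P \<and> self_similar P}"

definition non_repeating :: "nat list \<Rightarrow> bool" where
  "non_repeating s \<longleftrightarrow>
     \<not> (\<exists>t k. k \<ge> 2 \<and> length t < length s \<and> s = concat (replicate k t))"

definition non_repeating_seqs :: "nat list set" where
  "non_repeating_seqs = {s. s \<noteq> [] \<and> (\<forall>c\<in>set s. c > 0) \<and> non_repeating s}"

definition cyclic_perm :: "(nat list \<times> nat list) set" where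
  "cyclic_perm = {(s, t). \<exists>n. t = rotate n s}"

primrec cf_convergent :: "nat \<Rightarrow> (nat \<Rightarrow> nat) \<Rightarrow> real" where
  "cf_convergent 0 a = real (a 0)"
| "cf_convergent (Suc n) a = real (a 0) + 1 / cf_convergent n (\<lambda>k. a (Suc k))"

definition infinite_cf :: "real \<Rightarrow> (nat \<Rightarrow> nat) \<Rightarrow> bool" where
  "infinite_cf \<alpha> a \<longleftrightarrow> (\<forall>k>0. a k > 0) \<and> (\<lambda>n. cf_convergent n a) \<longlonglongrightarrow> \<alpha>"

definition periodic_part :: "(nat \<Rightarrow> nat) \<Rightarrow> nat list \<Rightarrow> bool" where
  "periodic_part a s \<longleftrightarrow> s \<noteq> [] \<and> (\<exists>n. \<forall>k. a (n + k) = s ! (k mod length s))"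

text \<open>
  Since the minimal periodic part is well defined only up to cyclic permutation, it is a
  relation; that it holds entails that the expansion is infinite and eventually periodic.
\<close>

definition minimal_periodic_part :: "real \<Rightarrow> nat list \<Rightarrow> bool" where
  "minimal_periodic_part \<alpha> s \<longleftrightarrow>
     (\<exists>a. infinite_cf \<alpha> a \<and> periodic_part a s \<and>
          (\<forall>t. periodic_part a t \<longrightarrow> length s \<le> length t))"

end

theory Submission
  imports Defs
begin

text \<open>
  A circle is encoded by its inversive vector, for which external tangency means Lorentz product
  \<open>-1\<close> and disjointness of interiors means product at most \<open>-1\<close>. Descartes' relation for a
  quadruple of tangent circles shows that exchanging the circle farthest from a given disjoint
  circle moves the quadruple towards it, so that a packing is determined by any three of its
  mutually tangent circles; conversely, along reduced sequences of exchanges the products stay at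
  most \<open>-1\<close>, so that every tangent quadruple generates a packing.

  The circles resting on the axis are \<open>nu s t\<close> with \<open>s\<close> the square root of the curvature and
  \<open>t / s\<close> the point of contact, and their product is \<open>1 - det\<^sup>2 / 2\<close>. In the packing of
  \<open>\<alpha>\<close> they form the primitive vectors of the lattice spanned by \<open>(\<alpha>, 0)\<close> and
  \<open>(1, 2 / \<alpha>)\<close>. When \<open>\<alpha>\<close> is irrational, a similarity must preserve the only line, hence
  maps one lattice basis to another: packings are similar iff the parameters are equivalent under
  \<open>GL\<^sub>2(\<int>)\<close>, and the determinant is the orientation. By Serret's theorem, with the parity of
  the number of continued fraction steps recording the determinant, this means that the expansions
  have a common tail.
\<close>

section \<open>Inversive vectors of circles\<close>

text \<open>Lorentz products alone do not determine the circles: negating every vector preserves all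
  products and turns every circle inside out, so a sign has to be carried along. In a packing with
  exactly one line it comes from the curvatures, which cannot be negative; in a set built from
  vectors, one touching pair fixes it for all pairs, because two causal vectors with negative
  product lie in the same half of the light cone.

  The products are real numbers, so the descent cannot rely on integrality; it ends because each
  exchange lowers a nonnegative quantity by a fixed amount. The same descent is run with different
  invariants, since an entry tangent to the target is never exchanged and may be kept.

  The parameter pairs of the two initial circles have determinant 2, so all lattice determinants are
  2 n with n an integer, and products are 1 - 2 n^2. A second line is a primitive lattice vector
  with first coordinate 0, which exists exactly when the parameter is rational: excluding strip
  packings means excluding finite expansions. The parity claim needs one fact more, that the minimal
  period divides every period.\<close>

text \<open>
  The circle of signed curvature \<open>k\<close> and centre \<open>c\<close> has the vector
  \<open>(k, k c, (|k c|\<^sup>2 - 1) / k)\<close>, with \<open>k < 0\<close> when the interior is unbounded; a line has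
  \<open>k = 0\<close> and its unit normal, pointing into the interior, in the middle coordinates.
\<close>

type_synonym lvec = "real^4"

definition lor :: "lvec \<Rightarrow> lvec \<Rightarrow> real" where
  "lor u v = u $ 2 * v $ 2 + u $ 3 * v $ 3 - (u $ 1 * v $ 4 + v $ 1 * u $ 4) / 2"

lemma lor_commute: "lor u v = lor v u"
  by (simp add: lor_def)

lemma lor_add_left: "lor (u + v) w = lor u w + lor v w"
  and lor_scale_left: "lor (c *\<^sub>R u) w = c * lor u w"
  and lor_diff_left: "lor (u - v) w = lor u w - lor v w"
  by (simp_all add: lor_def field_simps)

lemma lor_add_right: "lor w (u + v) = lor w u + lor w v"
  and lor_scale_right: "lor w (c *\<^sub>R u) = c * lor w u"
  and lor_diff_right: "lor w (u - v) = lor w u - lor w v"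
  by (metis lor_commute lor_add_left lor_scale_left lor_diff_left)+

lemma lor_minus_left: "lor (- u) v = - lor u v"
  and lor_minus_right: "lor u (- v) = - lor u v"
  by (simp_all add: lor_def field_simps)

lemma lor_zero [simp]: "lor 0 v = 0" "lor v 0 = 0"
  by (simp_all add: lor_def)

lemma lor_sum_right: "lor w (\<Sum>x\<in>S. f x) = (\<Sum>x\<in>S. lor w (f x))"
  by (induction S rule: infinite_finite_induct) (simp_all add: lor_add_right)

lemmas lor_linear = lor_add_left lor_add_right lor_diff_left lor_diff_right
  lor_scale_left lor_scale_right lor_minus_left lor_minus_right lor_sum_right

section \<open>Quadruples of mutually tangent vectors and the descent\<close>

definition quad :: "lvec set \<Rightarrow> bool" where
  "quad S \<longleftrightarrow> card S = 4 \<and> (\<forall>x\<in>S. lor x x = 1) \<and> (\<forall>x\<in>S. \<forall>y\<in>S. x \<noteq> y \<longrightarrow> lor x y = -1)"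

lemma quad_finite: "quad S \<Longrightarrow> finite S"
  unfolding quad_def by (metis card.infinite zero_neq_numeral)

lemma quad_lor: "quad S \<Longrightarrow> x \<in> S \<Longrightarrow> y \<in> S \<Longrightarrow> lor x y = (if x = y then 1 else -1)"
  unfolding quad_def by auto

text \<open>On a quadruple the Gram matrix of \<open>lor\<close> is 2 I - J, with J the all-ones
  matrix.\<close>

lemma quad_lor_comb:
  assumes "quad S" "x \<in> S"
  shows "lor x (\<Sum>y\<in>S. c y *\<^sub>R y) = 2 * c x - (\<Sum>y\<in>S. c y)"
proof -
  have "lor x (\<Sum>y\<in>S. c y *\<^sub>R y) = (\<Sum>y\<in>S. c y * (if x = y then 1 else -1))"
    using assms by (auto simp: lor_linear quad_lor intro!: sum.cong)
  also have "\<dots> = (\<Sum>y\<in>S. 2 * (if x = y then c y else 0) - c y)"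
    by (intro sum.cong) auto
  also have "\<dots> = 2 * c x - (\<Sum>y\<in>S. c y)"
    using assms quad_finite[OF assms(1)]
    by (simp add: sum_subtractf sum_distrib_left[symmetric])
  finally show ?thesis .
qed

text \<open>Pairing a vanishing combination with each member shows that twice every coefficient
  equals their sum C; adding the four equations gives 2 C = 4 C, so all coefficients vanish. Hence a
  quadruple is a basis.\<close>

lemma quad_span:
  assumes "quad S"
  shows "span S = UNIV"
proof -
  have fin: "finite S" and card: "card S = 4"
    using assms quad_finite by (auto simp: quad_def)
  have "independent S"
  proof (rule independent_if_scalars_zero[OF fin])
    fix f x assume 0: "(\<Sum>x\<in>S. f x *\<^sub>R x) = 0" and x: "x \<in> S"
    have *: "2 * f y = (\<Sum>y\<in>S. f y)" if "y \<in> S" for y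
      using quad_lor_comb[OF assms that, of f] 0 by simp
    have "2 * (\<Sum>y\<in>S. f y) = (\<Sum>y\<in>S. \<Sum>y\<in>S. f y)"
      unfolding sum_distrib_left using * by (intro sum.cong) auto
    then have "(\<Sum>y\<in>S. f y) = 0"
      by (simp add: card)
    then show "f x = 0" using *[OF x] by simp
  qed
  then show ?thesis
    using card_ge_dim_independent[of S UNIV] card by (simp add: subset_antisym)
qed

lemma quad_comb:
  assumes "quad S"
  obtains c where "x = (\<Sum>y\<in>S. c y *\<^sub>R y)"
  using assms span_finite[OF quad_finite[OF assms]] quad_span[OF assms] by blast

text \<open>Since J^2 = 4 J, the Gram matrix 2 I - J squares to 4 I, and its inverse is a quarter of
  itself; this is the quadratic form of the four products. Taking for \<open>x\<close> the null
  vector that reads off curvatures would give the classical theorem of Descartes.\<close>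

lemma quad_descartes:
  assumes "quad S"
  shows "2 * (\<Sum>s\<in>S. (lor x s)\<^sup>2) - (\<Sum>s\<in>S. lor x s)\<^sup>2 = 4 * lor x x"
proof -
  obtain c where x: "x = (\<Sum>y\<in>S. c y *\<^sub>R y)" using quad_comb[OF assms] .
  define C where "C = (\<Sum>y\<in>S. c y)"
  have l: "lor x s = 2 * c s - C" if "s \<in> S" for s
    using quad_lor_comb[OF assms that, of c] by (simp add: x C_def lor_commute)
  have card: "card S = 4" using assms by (simp add: quad_def)
  have 1: "(\<Sum>s\<in>S. lor x s) = - 2 * C"
    by (simp add: l sum_subtractf sum_distrib_left[symmetric] C_def[symmetric] card)
  have "(\<Sum>s\<in>S. (lor x s)\<^sup>2) = (\<Sum>s\<in>S. 4 * (c s)\<^sup>2 - 4 * C * c s + C\<^sup>2)"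
    by (intro sum.cong) (auto simp: l power2_eq_square algebra_simps)
  then have 2: "(\<Sum>s\<in>S. (lor x s)\<^sup>2) = 4 * (\<Sum>s\<in>S. (c s)\<^sup>2)"
    by (simp add: sum.distrib sum_subtractf sum_distrib_left[symmetric] C_def[symmetric] card power2_eq_square)
  have "lor x x = (\<Sum>s\<in>S. c s * lor x s)"
    by (subst (2) x) (simp add: lor_linear)
  also have "\<dots> = (\<Sum>s\<in>S. 2 * (c s)\<^sup>2 - C * c s)"
    by (intro sum.cong) (auto simp: l power2_eq_square algebra_simps)
  finally have 3: "lor x x = 2 * (\<Sum>s\<in>S. (c s)\<^sup>2) - C * C"
    by (simp add: sum_subtractf sum_distrib_left[symmetric] C_def[symmetric])
  show ?thesis unfolding 1 2 3 by (simp add: power2_eq_square)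
qed

lemma quad_determines:
  assumes "quad S" and eq: "\<And>s. s \<in> S \<Longrightarrow> lor x s = lor y s"
  shows "x = y"
proof -
  obtain c where c: "x - y = (\<Sum>s\<in>S. c s *\<^sub>R s)" using quad_comb[OF assms(1)] .
  define C where "C = (\<Sum>s\<in>S. c s)"
  have *: "2 * c s = C" if "s \<in> S" for s
    using quad_lor_comb[OF assms(1) that, of c] eq[OF that]
    by (simp add: c[symmetric] C_def lor_linear lor_commute)
  have card: "card S = 4" using assms by (simp add: quad_def)
  have "2 * C = (\<Sum>s\<in>S. C)"
    unfolding C_def sum_distrib_left using * by (intro sum.cong) (auto simp: C_def)
  then have "C = 0" by (simp add: card)
  then have "x - y = 0" unfolding c using * by (intro sum.neutral) auto
  then show ?thesis by simp
qed

text \<open>Twice the sum of the other three minus \<open>d\<close>, by Vieta the second solution of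
  Descartes' quadratic equation; the 3 arises because \<open>\<Sum>S\<close> includes
  \<open>d\<close>.\<close>

definition reflected :: "lvec \<Rightarrow> lvec set \<Rightarrow> lvec" where
  "reflected d S = 2 *\<^sub>R (\<Sum>S) - 3 *\<^sub>R d"

definition swap :: "lvec \<Rightarrow> lvec set \<Rightarrow> lvec set" where
  "swap d S = insert (reflected d S) (S - {d})"

lemma quad_lor_sum:
  assumes "quad S" "x \<in> S"
  shows "lor x (\<Sum>S) = -2"
  using quad_lor_comb[OF assms, of "\<lambda>_. 1"] assms by (simp add: quad_def)

lemma lor_reflected:
  assumes "quad S" "d \<in> S" "x \<in> S"
  shows "lor x (reflected d S) = (if x = d then -7 else -1)"
  using quad_lor_sum[OF assms(1,3)] quad_lor[OF assms(1,3,2)]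
  by (simp add: reflected_def lor_linear)

lemma lor_reflected_self:
  assumes "quad S" "d \<in> S"
  shows "lor (reflected d S) (reflected d S) = 1"
proof -
  have "lor (\<Sum>S) (\<Sum>S) = (\<Sum>x\<in>S. lor (\<Sum>S) x)"
    by (rule lor_sum_right)
  also have "\<dots> = (\<Sum>x\<in>S. -2)"
    using quad_lor_sum[OF assms(1)] by (intro sum.cong) (auto simp: lor_commute)
  also have "\<dots> = -8" using assms by (simp add: quad_def)
  finally show ?thesis
    using quad_lor_sum[OF assms] quad_lor[OF assms(1,2,2)]
    by (simp add: reflected_def lor_linear del: lor_sum_right) (simp add: lor_commute)
qed

lemma reflected_notin:
  assumes "quad S" "d \<in> S"
  shows "reflected d S \<notin> S"
proof
  assume "reflected d S \<in> S"
  from lor_reflected[OF assms this] lor_reflected_self[OF assms] show False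
    by (auto split: if_splits)
qed

lemma quad_swap:
  assumes "quad S" "d \<in> S"
  shows "quad (swap d S)"
  unfolding quad_def
proof (intro conjI ballI impI)
  show "card (swap d S) = 4"
    using assms quad_finite[OF assms(1)] reflected_notin[OF assms]
    by (simp add: swap_def quad_def)
next
  fix x assume "x \<in> swap d S"
  then show "lor x x = 1"
    using assms lor_reflected_self[OF assms] by (auto simp: swap_def quad_def)
next
  fix x y assume "x \<in> swap d S" "y \<in> swap d S" "x \<noteq> y"
  then show "lor x y = -1"
    using lor_reflected[OF assms, of x] lor_reflected[OF assms, of y] quad_lor[OF assms(1), of x y]
    by (auto simp: swap_def lor_commute)
qed

lemma sum_swap:
  assumes "quad S" "d \<in> S"
  shows "\<Sum>(swap d S) = 3 *\<^sub>R (\<Sum>S) - 4 *\<^sub>R d"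
proof -
  have "\<Sum>(swap d S) = reflected d S + (\<Sum>S - d)"
    using quad_finite[OF assms(1)] reflected_notin[OF assms] assms(2)
    by (simp add: swap_def sum_diff1)
  also have "\<dots> = 3 *\<^sub>R (\<Sum>S) - 4 *\<^sub>R d"
    by (simp add: reflected_def vec_eq_iff)
  finally show ?thesis .
qed

lemma reflected_reflected:
  assumes "quad S" "d \<in> S"
  shows "reflected (reflected d S) (swap d S) = d"
  unfolding reflected_def[of _ "swap d S"] sum_swap[OF assms]
  by (simp add: reflected_def vec_eq_iff)

lemma swap_swap:
  assumes "quad S" "d \<in> S"
  shows "swap (reflected d S) (swap d S) = S"
  using reflected_reflected[OF assms] reflected_notin[OF assms] assms(2)
  by (auto simp: swap_def[of _ "swap d S"]) (auto simp: swap_def)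

text \<open>
  Exchanging the entry that is farthest from \<^term>\<open>u\<close> moves the quadruple towards
  \<^term>\<open>u\<close>: the sum of the values \<^term>\<open>- lor u s\<close> drops by at least 8 while staying
  nonnegative, so the process can only end by reaching \<^term>\<open>u\<close>.
\<close>

lemma quad_descent_step:
  assumes S: "quad S" and u: "lor u u = 1" and ge: "\<And>s. s \<in> S \<Longrightarrow> lor u s \<le> -1"
  obtains d where "d \<in> S" "lor u d < -1" "- lor u (\<Sum>(swap d S)) \<le> - lor u (\<Sum>S) - 8"
proof -
  define f where "f s = - lor u s" for s
  have fin: "finite S" and card: "card S = 4" using S quad_finite by (auto simp: quad_def)
  have "S \<noteq> {}" using card by auto
  then have "Max (f ` S) \<in> f ` S" using fin by (intro Max_in) auto
  then obtain d where "d \<in> S" "Max (f ` S) = f d" by blast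
  then have d: "d \<in> S" "\<And>s. s \<in> S \<Longrightarrow> f s \<le> f d"
    using fin Max_ge[of "f ` S"] by auto
  have "card (S - {d}) = 3" using fin card d by simp
  then obtain a b c where abc: "S - {d} = {a, b, c}" "a \<noteq> b" "b \<noteq> c" "a \<noteq> c"
    using card_3_iff by metis
  then have Seq: "S = {a, b, c, d}" and dn: "d \<noteq> a" "d \<noteq> b" "d \<noteq> c" using d(1) by auto
  have desc: "2 * ((f a)\<^sup>2 + (f b)\<^sup>2 + (f c)\<^sup>2 + (f d)\<^sup>2) - (f a + f b + f c + f d)\<^sup>2 = 4"
    using quad_descartes[OF S, of u] abc(2-4) dn u by (simp add: Seq f_def power2_eq_square algebra_simps)
  have ge1: "f a \<ge> 1" "f b \<ge> 1" "f c \<ge> 1" and le: "f a \<le> f d" "f b \<le> f d" "f c \<le> f d"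
    using ge d(2) by (force simp: f_def Seq)+
  define \<kappa> where "\<kappa> = f a * f b + f b * f c + f c * f a"
  have prods: "f a * f b \<ge> 1" "f b * f c \<ge> 1" "f c * f a \<ge> 1"
    using ge1 mult_mono[of 1 "f a" 1 "f b"] mult_mono[of 1 "f b" 1 "f c"] mult_mono[of 1 "f c" 1 "f a"]
    by auto
  \<comment> \<open>Descartes' relation solved as a quadratic equation for \<open>f d\<close>. The
    three products in \<open>\<kappa>\<close> are at least 1, so \<open>f d\<close> differs from the
    sum of the others by at least 4; it remains to see that the larger root is taken.\<close>
  have sq: "(f d - (f a + f b + f c))\<^sup>2 = 4 * \<kappa> + 4"
    using desc by (simp add: \<kappa>_def power2_eq_square algebra_simps)
  have "f d - (f a + f b + f c) \<ge> 4"
  proof (rule ccontr)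
    assume "\<not> ?thesis"
    moreover have "4\<^sup>2 \<le> (f d - (f a + f b + f c))\<^sup>2" unfolding sq \<kappa>_def using prods by simp
    ultimately have neg: "f d - (f a + f b + f c) \<le> -4"
      using abs_le_square_iff[of 4 "f d - (f a + f b + f c)"] by auto
    \<comment> \<open>At the smaller root, maximality of \<open>f d\<close> bounds \<open>t\<close>
      by each sum of two of the others. Multiplying two such bounds gives \<open>t\<^sup>2\<close>
      at most \<open>\<kappa>\<close> plus the square of any one of the three values, hence less
      than 4 \<open>\<kappa>\<close> + 4 when the square is at most
      \<open>f a * f b\<close>.\<close>
    define t where "t = f a + f b + f c - f d"
    have t: "t \<ge> 4" "t \<le> f b + f c" "t \<le> f a + f c" "t \<le> f a + f b"
      using neg le by (auto simp: t_def)
    have "t\<^sup>2 = 4 * \<kappa> + 4" using sq by (simp add: t_def power2_commute)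
    moreover have "t\<^sup>2 \<le> (f b + f c) * (f a + f c)"
      unfolding power2_eq_square using t ge1 by (intro mult_mono) auto
    moreover have "t\<^sup>2 \<le> (f b + f c) * (f a + f b)" "t\<^sup>2 \<le> (f a + f b) * (f a + f c)"
      unfolding power2_eq_square using t ge1 by (intro mult_mono; simp)+
    moreover have "(f a)\<^sup>2 \<le> f a * f b \<or> (f b)\<^sup>2 \<le> f a * f b"
      using ge1 by (cases "f a \<le> f b") (auto simp: power2_eq_square intro: mult_mono)
    ultimately show False
      using prods by (auto simp: \<kappa>_def power2_eq_square algebra_simps)
  qed
  then have large: "f d \<ge> f a + f b + f c + 4" by simp
  show thesis
  proof
    show "d \<in> S" by fact
    show "lor u d < -1" using large ge1 by (simp add: f_def)
    \<comment> \<open>By \<open>sum_swap\<close> the sum drops by 2 (f d - f a - f b - f c), which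
      is the origin of the 8.\<close>
    have "lor u (\<Sum>S) = - (f a + f b + f c + f d)"
      using abc(2-4) dn by (simp add: Seq f_def lor_linear)
    then show "- lor u (\<Sum>(swap d S)) \<le> - lor u (\<Sum>S) - 8"
      unfolding sum_swap[OF S d(1)] using large by (simp add: lor_linear f_def del: lor_sum_right)
  qed
qed

text \<open>The invariant \<open>Q\<close> is left open for the various uses: only entries with
  product below -1 are exchanged, so \<open>Q\<close> may demand that entries tangent to
  \<open>u\<close> stay. The induction runs over a natural bound for the sum; at bound 0 the vector
  \<open>u\<close> must be present, since otherwise the four terms would contribute at least
  4.\<close>

lemma quad_descent:
  assumes u: "lor u u = 1" and Q: "Q S" and Qquad: "\<And>S. Q S \<Longrightarrow> quad S"
    and ge: "\<And>S d. Q S \<Longrightarrow> d \<in> S \<Longrightarrow> d \<noteq> u \<Longrightarrow> lor u d \<le> -1"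
    and step: "\<And>S d. Q S \<Longrightarrow> d \<in> S \<Longrightarrow> lor u d < -1 \<Longrightarrow> Q (swap d S)"
  obtains S' where "Q S'" "u \<in> S'"
proof -
  have "\<exists>S'. Q S' \<and> u \<in> S'" if "- lor u (\<Sum>S) \<le> real n" "Q S" for n S
    using that
  proof (induction n arbitrary: S)
    case (0 S)
    show ?case
    proof (rule ccontr)
      assume "\<nexists>S'. Q S' \<and> u \<in> S'"
      then have "u \<notin> S" using 0 by blast
      then have "lor u s \<le> -1" if "s \<in> S" for s using ge 0 that by metis
      then have "(\<Sum>s\<in>S. lor u s) \<le> (\<Sum>s\<in>S. -1)" by (rule sum_mono)
      then show False using 0 Qquad[OF 0(2)] by (simp add: lor_sum_right quad_def)
    qed
  next
    case (Suc n S)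
    show ?case
    proof (cases "u \<in> S")
      case False
      then have "lor u s \<le> -1" if "s \<in> S" for s using ge Suc that by metis
      from quad_descent_step[OF Qquad[OF Suc.prems(2)] u this] obtain d
        where "d \<in> S" "lor u d < -1" "- lor u (\<Sum>(swap d S)) \<le> - lor u (\<Sum>S) - 8" by blast
      then show ?thesis using Suc.IH[of "swap d S"] step Suc.prems by auto
    qed (use Suc in blast)
  qed
  then show thesis using that Q real_nat_ceiling_ge by blast
qed

section \<open>Orbits of a quadruple under exchanges\<close>

inductive orbit :: "lvec set \<Rightarrow> lvec set \<Rightarrow> bool" for R where
  orbit_refl: "orbit R R"
| orbit_swap: "orbit R S \<Longrightarrow> d \<in> S \<Longrightarrow> orbit R (swap d S)"

text \<open>The second argument is the entry exchanged last.\<close>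

inductive reduced_walk :: "lvec set \<Rightarrow> lvec \<Rightarrow> lvec set \<Rightarrow> bool" for R where
  reduced_first: "d \<in> R \<Longrightarrow> reduced_walk R (reflected d R) (swap d R)"
| reduced_next: "reduced_walk R d S \<Longrightarrow> e \<in> S \<Longrightarrow> e \<noteq> d \<Longrightarrow>
    reduced_walk R (reflected e S) (swap e S)"

lemma orbit_quad: "orbit R S \<Longrightarrow> quad R \<Longrightarrow> quad S"
  by (induction rule: orbit.induct) (auto intro: quad_swap)

lemma orbit_trans: "orbit S T \<Longrightarrow> orbit R S \<Longrightarrow> orbit R T"
  by (induction rule: orbit.induct) (auto intro: orbit.intros)

lemma reflected_in_swap: "reflected d S \<in> swap d S"
  by (simp add: swap_def)

lemma orbit_sym:
  assumes "orbit R S" "quad R"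
  shows "orbit S R"
  using assms
proof (induction rule: orbit.induct)
  case (orbit_swap S d)
  have "quad S" using orbit_swap orbit_quad by blast
  then have "orbit (swap d S) S"
    using orbit.orbit_swap[OF orbit.orbit_refl reflected_in_swap[of d S]] swap_swap orbit_swap
    by metis
  then show ?case using orbit_swap orbit_trans by blast
qed (rule orbit.orbit_refl)

lemma reduced_walk_quad: "reduced_walk R d S \<Longrightarrow> quad R \<Longrightarrow> quad S \<and> d \<in> S"
  by (induction rule: reduced_walk.induct) (auto intro: quad_swap reflected_in_swap)

lemma reduced_walk_back:
  assumes "reduced_walk R d S" "quad R"
  shows "swap d S = R \<or> (\<exists>e. reduced_walk R e (swap d S))"
  using assms(1)
proof cases
  case (reduced_first d')
  then show ?thesis using swap_swap assms(2) by auto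
next
  case (reduced_next d' S' e)
  then have "swap d S = S'" using swap_swap reduced_walk_quad assms(2) by blast
  then show ?thesis using reduced_next by blast
qed

text \<open>Exchanging the entry that was just created undoes the previous exchange and shortens the
  walk; any other exchange prolongs it.\<close>

lemma orbit_reduced_walk:
  assumes "orbit R S" "quad R"
  shows "S = R \<or> (\<exists>d. reduced_walk R d S)"
  using assms
proof (induction rule: orbit.induct)
  case (orbit_swap S e)
  then consider "S = R" | d where "reduced_walk R d S" by blast
  then show ?case
  proof cases
    case 1
    then show ?thesis using orbit_swap reduced_first by blast
  next
    case 2
    then show ?thesis
      using orbit_swap reduced_next[OF 2] reduced_walk_back[OF 2] by (cases "e = d") blast+
  qed
qed simp

text \<open>Reducedness is essential: exchanging the last entry again would undo the domination.\<close>

lemma reduced_walk_far: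
  assumes "reduced_walk R d S" "quad R" "u \<in> R"
  shows "(u \<in> S \<and> u \<noteq> d) \<or> ((\<forall>s\<in>S. lor u s \<le> -1) \<and> 2 * lor u d \<le> lor u (\<Sum>S))"
  using assms
proof (induction rule: reduced_walk.induct)
  case (reduced_first d)
  show ?case
  proof (cases "d = u")
    case True
    \<comment> \<open>This is 3 (-2) - 4. The new entry has product -7 with \<open>u\<close>, so the
      domination starts as -14 against -10.\<close>
    have "lor u (\<Sum>(swap u R)) = -10"
      using reduced_first quad_lor_sum[of R u] quad_lor[of R u u]
      by (simp add: sum_swap lor_linear del: lor_sum_right)
    then show ?thesis
      using True reduced_first lor_reflected[of R u u] quad_lor[of R u]
      by (auto simp: swap_def[of u R])
  next
    case False
    then show ?thesis using reduced_first reflected_notin[of R d] by (auto simp: swap_def)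
  qed
next
  case (reduced_next d S e)
  then have S: "quad S" and d: "d \<in> S" using reduced_walk_quad by blast+
  from reduced_next.IH[OF reduced_next.prems] show ?case
  proof
    assume u: "u \<in> S \<and> u \<noteq> d"
    show ?thesis
    proof (cases "e = u")
      case True
      have "lor u (\<Sum>(swap u S)) = -10"
        using u S quad_lor_sum[of S u] quad_lor[of S u u]
        by (simp add: sum_swap lor_linear del: lor_sum_right)
      then show ?thesis
        using True u S lor_reflected[of S u u] quad_lor[of S u]
        by (auto simp: swap_def[of u S])
    next
      case False
      then show ?thesis using u reduced_next reflected_notin[of S e] S by (auto simp: swap_def)
    qed
  next
    assume far: "(\<forall>s\<in>S. lor u s \<le> -1) \<and> 2 * lor u d \<le> lor u (\<Sum>S)"
    have "lor u (\<Sum>S) = lor u d + lor u e + (\<Sum>s\<in>S - {d} - {e}. lor u s)"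
      using quad_finite[OF S] d reduced_next.hyps(2,3)
      by (simp add: lor_sum_right sum_diff1)
    moreover have "(\<Sum>s\<in>S - {d} - {e}. lor u s) \<le> (\<Sum>s\<in>S - {d} - {e}. -1)"
      using far by (intro sum_mono) auto
    moreover have "card (S - {d} - {e}) = 2"
      using S quad_finite[OF S] d reduced_next.hyps(2,3) by (simp add: quad_def)
    \<comment> \<open>Domination bounds the product with \<open>d\<close> by the sum of the other
      three, so the whole sum is at most twice the products with \<open>e\<close> and the remaining
      two. This inequality says precisely that the entry replacing \<open>e\<close> dominates again,
      and it makes that entry at least as far from \<open>u\<close> as \<open>e\<close>.\<close>
    ultimately have le: "lor u (\<Sum>S) \<le> 2 * lor u e"
      using far by simp
    have e: "lor u e \<le> -1" using far reduced_next.hyps(2) by blast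
    have "lor u (reflected e S) \<le> -1" "2 * lor u (reflected e S) \<le> lor u (\<Sum>(swap e S))"
      using le e by (simp_all add: sum_swap[OF S reduced_next.hyps(2)] reflected_def lor_linear del: lor_sum_right)
    then show ?thesis using far by (simp add: swap_def[of e S])
  qed
qed

section \<open>Vector sets of packings: uniqueness, existence and extension of tangent sets\<close>

text \<open>Closure is required under exchanges in quadruples instead of under circles tangent to a
  triple; this suits the descent, and \<open>tangent_to_three_mem\<close> recovers the other
  form.\<close>

definition apollonian_vectors :: "lvec set \<Rightarrow> bool" where
  "apollonian_vectors V \<longleftrightarrow>
     (\<forall>u\<in>V. lor u u = 1) \<and>
     (\<forall>u\<in>V. \<forall>v\<in>V. u \<noteq> v \<longrightarrow> lor u v \<le> -1) \<and>
     (\<exists>S. quad S \<and> S \<subseteq> V) \<and>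
     (\<forall>S d. quad S \<and> S \<subseteq> V \<and> d \<in> S \<longrightarrow> reflected d S \<in> V)"

lemma apollonian_vectorsD:
  assumes "apollonian_vectors V"
  shows "u \<in> V \<Longrightarrow> lor u u = 1"
    and "u \<in> V \<Longrightarrow> v \<in> V \<Longrightarrow> u \<noteq> v \<Longrightarrow> lor u v \<le> -1"
    and "quad S \<Longrightarrow> S \<subseteq> V \<Longrightarrow> d \<in> S \<Longrightarrow> reflected d S \<in> V"
    and "quad S \<Longrightarrow> S \<subseteq> V \<Longrightarrow> d \<in> S \<Longrightarrow> swap d S \<subseteq> V"
  using assms by (auto simp: apollonian_vectors_def swap_def)

lemma apollonian_vectors_descent:
  assumes V: "apollonian_vectors V" and u: "u \<in> V" and Q: "Q S"
    and QV: "\<And>S. Q S \<Longrightarrow> quad S \<and> S \<subseteq> V"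
    and step: "\<And>S d. Q S \<Longrightarrow> d \<in> S \<Longrightarrow> lor u d < -1 \<Longrightarrow> Q (swap d S)"
  obtains S' where "Q S'" "u \<in> S'"
proof (rule quad_descent[of u Q S])
  show "lor u u = 1" using apollonian_vectorsD(1)[OF V u] .
  show "lor u d \<le> -1" if "Q S" "d \<in> S" "d \<noteq> u" for S d
    using apollonian_vectorsD(2)[OF V u] that QV[OF that(1)] by blast
qed (use assms in blast)+

text \<open>The descent towards a member of \<open>V\<close> starts at the common quadruple and
  stays inside both sets, since both are closed under exchanges; the separation it needs is that of
  \<open>V\<close>.\<close>

lemma apollonian_vectors_subset:
  assumes V: "apollonian_vectors V" and W: "apollonian_vectors W"
    and S: "quad S" "S \<subseteq> V" "S \<subseteq> W"
  shows "V \<subseteq> W"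
proof
  fix u assume "u \<in> V"
  have step: "quad (swap d S) \<and> swap d S \<subseteq> V \<and> swap d S \<subseteq> W"
    if "quad S \<and> S \<subseteq> V \<and> S \<subseteq> W" "d \<in> S" for S d
    using that quad_swap apollonian_vectorsD(4)[OF V] apollonian_vectorsD(4)[OF W] by simp
  have "quad S \<and> S \<subseteq> V \<and> S \<subseteq> W" using S by simp
  from apollonian_vectors_descent[OF V \<open>u \<in> V\<close>, of "\<lambda>S. quad S \<and> S \<subseteq> V \<and> S \<subseteq> W", OF this _ step]
  obtain S' where "S' \<subseteq> W" "u \<in> S'" by blast
  then show "u \<in> W" by blast
qed

lemma apollonian_vectors_unique:
  assumes "apollonian_vectors V" "apollonian_vectors W" "quad S" "S \<subseteq> V" "S \<subseteq> W"
  shows "V = W"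
  using apollonian_vectors_subset[OF assms] apollonian_vectors_subset[OF assms(2,1,3,5,4)]
  by (rule subset_antisym)

text \<open>Two orbit quadruples are joined by a reduced walk, which separates their members.
  Closure is the delicate point: a quadruple drawn from the union has to be shown to be an orbit
  quadruple itself.\<close>

lemma orbit_apollonian_vectors:
  assumes R: "quad R"
  shows "apollonian_vectors (\<Union>{S. orbit R S})"
proof -
  have far: "lor u v \<le> -1" if "u \<in> S" "v \<in> T" "orbit R S" "orbit R T" "u \<noteq> v" for u v S T
  proof -
    note S = orbit_quad[OF that(3) R] and T = orbit_quad[OF that(4) R]
    have "orbit S T" using orbit_trans[OF that(4) orbit_sym[OF that(3) R]] .
    then consider "T = S" | d where "reduced_walk S d T" using orbit_reduced_walk S by blast
    then show ?thesis
    proof cases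
      case 1
      then show ?thesis using that quad_lor[OF S, of u v] by simp
    next
      case 2
      from reduced_walk_far[OF this S \<open>u \<in> S\<close>] show ?thesis
        using that quad_lor[OF T, of u v] by auto
    qed
  qed
  have tangent_step: "orbit R (swap d S) \<and> I \<subseteq> swap d S"
    if "orbit R S \<and> I \<subseteq> S" "d \<in> S" "lor u d < -1" "\<And>i. i \<in> I \<Longrightarrow> lor u i \<ge> -1" for u d S I
  proof -
    have "d \<notin> I" using that(3) that(4)[of d] by auto
    then show ?thesis using that orbit_swap[of R S d] by (auto simp: swap_def)
  qed
  \<comment> \<open>Descent towards \<open>u\<close> along the orbit; the entries in
    \<open>I\<close> are tangent to \<open>u\<close> and therefore survive every exchange.\<close>
  have reach: "\<exists>S. orbit R S \<and> insert u I \<subseteq> S"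
    if I: "orbit R S" "I \<subseteq> S" and u: "orbit R T" "u \<in> T" "\<And>i. i \<in> I \<Longrightarrow> lor u i = -1" for u I S T
  proof -
    have "lor u u = 1" using u orbit_quad[OF _ R] by (auto simp: quad_def)
    have "orbit R S \<and> I \<subseteq> S" using I by simp
    then obtain S' where "orbit R S' \<and> I \<subseteq> S'" "u \<in> S'"
    proof (rule quad_descent[of u "\<lambda>S. orbit R S \<and> I \<subseteq> S", OF \<open>lor u u = 1\<close>])
      show "quad S" if "orbit R S \<and> I \<subseteq> S" for S using that orbit_quad[OF _ R] by blast
      show "lor u d \<le> -1" if "orbit R S \<and> I \<subseteq> S" "d \<in> S" "d \<noteq> u" for S d
        using far[OF u(2) that(2) u(1)] that by blast
      show "orbit R (swap d S) \<and> I \<subseteq> swap d S"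
        if "orbit R S \<and> I \<subseteq> S" "d \<in> S" "lor u d < -1" for S d
        using tangent_step[OF that] u(3) by simp
    qed
    then show ?thesis by blast
  qed
  show ?thesis
    unfolding apollonian_vectors_def
  proof (intro conjI)
    show "\<forall>u\<in>\<Union>{S. orbit R S}. lor u u = 1" using orbit_quad[OF _ R] by (auto simp: quad_def)
    show "\<forall>u\<in>\<Union>{S. orbit R S}. \<forall>v\<in>\<Union>{S. orbit R S}. u \<noteq> v \<longrightarrow> lor u v \<le> -1"
      using far by blast
    show "\<exists>S. quad S \<and> S \<subseteq> \<Union>{S. orbit R S}" using R orbit_refl by blast
    show "\<forall>S d. quad S \<and> S \<subseteq> \<Union>{S. orbit R S} \<and> d \<in> S \<longrightarrow> reflected d S \<in> \<Union>{S. orbit R S}"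
    proof (intro allI impI, elim conjE)
      fix S d assume S: "quad S" "S \<subseteq> \<Union>{S. orbit R S}" "d \<in> S"
      \<comment> \<open>The four members may come from four different orbit quadruples; they are
        collected into a single one, one member at a time.\<close>
      have "\<exists>T. orbit R T \<and> I \<subseteq> T" if "I \<subseteq> S" for I
        using finite_subset[OF that quad_finite[OF S(1)]] that
      proof (induction I rule: finite_induct)
        case empty
        then show ?case using orbit_refl by blast
      next
        case (insert x I)
        then obtain T where T: "orbit R T" "I \<subseteq> T" by auto
        from insert.prems S(2) obtain U where U: "orbit R U" "x \<in> U" by auto
        have "lor x i = -1" if "i \<in> I" for i
          using quad_lor[OF S(1), of x i] that insert.hyps(2) insert.prems by auto
        then show ?case using reach[OF T U] by blast
      qed
      then obtain T where T: "orbit R T" "S \<subseteq> T" by blast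
      have "S = T"
        using card_subset_eq[OF quad_finite[OF orbit_quad[OF T(1) R]] T(2)] S(1) orbit_quad[OF T(1) R]
        by (simp add: quad_def)
      then show "reflected d S \<in> \<Union>{S. orbit R S}"
        using T orbit_swap[OF T(1), of d] S(3) reflected_in_swap[of d S] by blast
    qed
  qed
qed


text \<open>From a quadruple containing the earlier vectors, descend towards the next one; the
  earlier ones are tangent to it and are never exchanged.\<close>

lemma apollonian_vectors_extend:
  assumes V: "apollonian_vectors V" and I: "finite I" "I \<subseteq> V"
    and tangent: "\<And>u v. u \<in> I \<Longrightarrow> v \<in> I \<Longrightarrow> u \<noteq> v \<Longrightarrow> lor u v = -1"
  shows "\<exists>S. quad S \<and> S \<subseteq> V \<and> I \<subseteq> S"
  using I tangent
proof (induction I rule: finite_induct)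
  case empty
  then show ?case using V by (auto simp: apollonian_vectors_def)
next
  case (insert x I)
  then obtain S where S: "quad S \<and> S \<subseteq> V \<and> I \<subseteq> S" by auto
  have step: "quad (swap d S) \<and> swap d S \<subseteq> V \<and> I \<subseteq> swap d S"
    if "quad S \<and> S \<subseteq> V \<and> I \<subseteq> S" "d \<in> S" "lor x d < -1" for S d
  proof -
    have "d \<notin> I" using insert.prems(2)[of x d] insert.hyps that by auto
    then show ?thesis
      using that quad_swap apollonian_vectorsD(4)[OF V] by (auto simp: swap_def)
  qed
  have "x \<in> V" using insert by simp
  from apollonian_vectors_descent[OF V this S _ step] obtain S' where
    "quad S' \<and> S' \<subseteq> V \<and> I \<subseteq> S'" "x \<in> S'" by blast
  then show ?case by blast
qed

text \<open>With three products equal to -1, Descartes' relation is (y - 1)(y + 7) = 0 for the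
  fourth product y. The two roots are the products of \<open>e\<close> with itself and with its
  reflection, and four products determine a vector.\<close>

lemma tangent_to_three:
  assumes S: "quad S" "e \<in> S" and d: "lor d d = 1" "\<And>s. s \<in> S \<Longrightarrow> s \<noteq> e \<Longrightarrow> lor d s = -1"
  shows "d = e \<or> d = reflected e S"
proof -
  have fin: "finite S" and card: "card S = 4" using S(1) quad_finite by (auto simp: quad_def)
  have split: "(\<Sum>s\<in>S. f s) = f e + (\<Sum>s\<in>S - {e}. f s)" for f :: "lvec \<Rightarrow> real"
    using fin S(2) by (simp add: sum.remove)
  have card3: "card (S - {e}) = 3" using fin card S(2) by simp
  have "(\<Sum>s\<in>S - {e}. lor d s) = (\<Sum>s\<in>S - {e}. -1)"
    using d by (intro sum.cong) auto
  then have 1: "(\<Sum>s\<in>S. lor d s) = lor d e - 3" using card3 by (simp add: split)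
  have "(\<Sum>s\<in>S - {e}. (lor d s)\<^sup>2) = (\<Sum>s\<in>S - {e}. 1)"
    using d by (intro sum.cong) auto
  then have 2: "(\<Sum>s\<in>S. (lor d s)\<^sup>2) = (lor d e)\<^sup>2 + 3" using card3 by (simp add: split)
  have "(lor d e - 1) * (lor d e + 7) = 0"
    using quad_descartes[OF S(1), of d] unfolding 1 2
    by (simp add: d power2_eq_square algebra_simps)
  then consider "lor d e = 1" | "lor d e = -7" by auto
  then show ?thesis
  proof cases
    case 1
    have "d = e"
      using quad_determines[OF S(1), of d e] 1 d quad_lor[OF S(1,2)] by metis
    then show ?thesis ..
  next
    case 2
    have "d = reflected e S"
      using quad_determines[OF S(1), of d "reflected e S"] 2 d lor_reflected[OF S] by (metis lor_commute)
    then show ?thesis ..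
  qed
qed

text \<open>The form has signature (3,1), so it is positive definite on the complement of a timelike
  vector. Subtracting a multiple of \<open>s\<close> from \<open>z\<close> clears the first
  coordinate, where the form is a sum of two squares; the subtraction costs only a multiple of
  \<open>- lor s s\<close>.\<close>

lemma orthogonal_to_timelike:
  assumes s: "lor s s < 0" and o: "lor s z = 0" and z: "z \<noteq> 0"
  shows "lor z z > 0"
proof -
  have "s $ 1 \<noteq> 0" using s by (auto simp: lor_def not_sum_squares_lt_zero)
  define c where "c = z $ 1 / s $ 1"
  define y where "y = z - c *\<^sub>R s"
  have y1: "y $ 1 = 0" using \<open>s $ 1 \<noteq> 0\<close> by (simp add: y_def c_def)
  have yy: "lor y y = (y $ 2)\<^sup>2 + (y $ 3)\<^sup>2" by (simp add: lor_def y1 power2_eq_square)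
  have eq: "lor z z = lor y y + c\<^sup>2 * (- lor s s)"
    using o by (simp add: y_def lor_linear lor_commute power2_eq_square)
  show ?thesis
  proof (rule ccontr)
    assume "\<not> ?thesis"
    moreover have "c\<^sup>2 * (- lor s s) \<ge> 0" using s by (intro mult_nonneg_nonneg) auto
    moreover have "lor y y \<ge> 0" by (simp add: yy)
    ultimately have 0: "lor y y = 0" "c\<^sup>2 * (- lor s s) = 0" using eq by linarith+
    then have "c = 0" "y $ 2 = 0" "y $ 3 = 0" using s by (auto simp: yy sum_power2_eq_zero_iff)
    then have "z $ 1 = 0" "z $ 2 = 0" "z $ 3 = 0" using y1 by (auto simp: y_def)
    moreover from this have "z $ 4 = 0" using o \<open>s $ 1 \<noteq> 0\<close> by (simp add: lor_def)
    ultimately show False using z by (simp add: vec_eq_iff forall_4)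
  qed
qed

lemma vector_4 [simp]:
  "(vector [a, b, c, d] :: 'a::zero^4) $ 1 = a"
  "(vector [a, b, c, d] :: 'a::zero^4) $ 2 = b"
  "(vector [a, b, c, d] :: 'a::zero^4) $ 3 = c"
  "(vector [a, b, c, d] :: 'a::zero^4) $ 4 = d"
  by (simp_all add: vector_def)

text \<open>The sum \<open>s\<close> of the three vectors already has the right products with them
  but square -3. Moving orthogonally to the three, in a spacelike direction, raises the square to
  1.\<close>

lemma fourth_tangent:
  assumes u: "lor u u = 1" "lor v v = 1" "lor w w = 1"
    and t: "lor u v = -1" "lor u w = -1" "lor v w = -1"
  obtains x where "quad {u, v, w, x}"
proof -
  \<comment> \<open>Turns Lorentz orthogonality into Euclidean orthogonality, for which a vector
    orthogonal to a proper subspace is available.\<close>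
  define dual where "dual = (\<lambda>a :: lvec. vector [- a $ 4 / 2, a $ 2, a $ 3, - a $ 1 / 2] :: lvec)"
  have dual: "dual a \<bullet> b = lor a b" for a b :: lvec
    by (simp add: dual_def lor_def inner_vec_def sum_4 field_simps)
  have "dim {dual u, dual v, dual w} < DIM(lvec)"
  proof -
    have "dim {dual u, dual v, dual w} \<le> card {dual u, dual v, dual w}"
      by (intro dim_le_card') auto
    also have "\<dots> \<le> 3" 
      by (simp add: card_insert_if)
    finally show ?thesis by simp
  qed
  then obtain z where z: "z \<noteq> 0" "\<And>y. y \<in> span {dual u, dual v, dual w} \<Longrightarrow> orthogonal z y"
    using orthogonal_to_subspace_exists by blast
  have zo: "lor u z = 0" "lor v z = 0" "lor w z = 0"
    using z(2)[of "dual u"] z(2)[of "dual v"] z(2)[of "dual w"]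
    by (simp_all add: orthogonal_def inner_commute[of z] dual span_base)
  define s where "s = u + v + w"
  have s: "lor s s = -3" "lor s u = -1" "lor s v = -1" "lor s w = -1" "lor s z = 0"
    using u t zo by (simp_all add: s_def lor_linear lor_commute)
  have zz: "lor z z > 0" using orthogonal_to_timelike[of s z] s z(1) by simp
  \<comment> \<open>The factor is chosen so that the added part contributes 4 to the square of
    \<open>s\<close>, which is -3.\<close>
  define x where "x = s + (2 / sqrt (lor z z)) *\<^sub>R z"
  have "lor x u = -1" "lor x v = -1" "lor x w = -1"
    using s zo by (simp_all add: x_def lor_linear lor_commute)
  moreover have "lor x x = lor s s + 4 * (lor z z / (sqrt (lor z z))\<^sup>2)"
    using s by (simp add: x_def lor_linear lor_commute power2_eq_square)
  then have "lor x x = 1" using zz s by simp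
  ultimately have "quad {u, v, w, x}"
  proof -
    assume x: "lor x u = -1" "lor x v = -1" "lor x w = -1" "lor x x = 1"
    have "u \<noteq> v" "u \<noteq> w" "v \<noteq> w" "u \<noteq> x" "v \<noteq> x" "w \<noteq> x" using u t x by auto
    then show ?thesis using u t x by (auto simp: quad_def lor_commute)
  qed
  then show thesis by (rule that)
qed

lemma extend_triple:
  assumes V: "apollonian_vectors V" and abc: "a \<in> V" "b \<in> V" "c \<in> V"
    and t: "lor a b = -1" "lor a c = -1" "lor b c = -1"
  obtains e where "quad {a, b, c, e}" "{a, b, c, e} \<subseteq> V" "e \<notin> {a, b, c}"
proof -
  note u = apollonian_vectorsD(1)[OF V abc(1)] apollonian_vectorsD(1)[OF V abc(2)] apollonian_vectorsD(1)[OF V abc(3)]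
  have tri: "lor x y = -1" if "x \<in> {a, b, c}" "y \<in> {a, b, c}" "x \<noteq> y" for x y
    using that t by (auto simp: lor_commute)
  have "finite {a, b, c}" "{a, b, c} \<subseteq> V" using abc by auto
  then have "\<exists>S. quad S \<and> S \<subseteq> V \<and> {a, b, c} \<subseteq> S"
    by (rule apollonian_vectors_extend[OF V _ _ tri])
  then obtain S where S: "quad S" "S \<subseteq> V" "{a, b, c} \<subseteq> S" by (elim exE conjE)
  have "a \<noteq> b" "b \<noteq> c" "a \<noteq> c" using t u by auto
  then have "card {a, b, c} = 3" by simp
  then have "card (S - {a, b, c}) = 1"
    using S(1) card_Diff_subset[OF _ S(3)] by (simp add: quad_def)
  then obtain e where e: "S - {a, b, c} = {e}" using card_1_singletonE by blast
  have "S = {a, b, c} \<union> (S - {a, b, c})" using S(3) by blast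
  then have "S = {a, b, c, e}" unfolding e by auto
  moreover have "e \<notin> {a, b, c}" using e by blast
  ultimately show thesis using that S by blast
qed

lemma tangent_to_three_mem:
  assumes V: "apollonian_vectors V" and abc: "a \<in> V" "b \<in> V" "c \<in> V"
    and t: "lor a b = -1" "lor a c = -1" "lor b c = -1"
    and d: "lor d d = 1" "lor d a = -1" "lor d b = -1" "lor d c = -1"
  shows "d \<in> V"
proof -
  obtain e where e: "quad {a, b, c, e}" "{a, b, c, e} \<subseteq> V" "e \<notin> {a, b, c}"
    using extend_triple[OF V abc t] .
  have "lor d s = -1" if "s \<in> {a, b, c, e}" "s \<noteq> e" for s using that d by auto
  then have "d = e \<or> d = reflected e {a, b, c, e}"
    by (intro tangent_to_three[OF e(1) _ d(1)]) auto
  then show ?thesis using e(2) apollonian_vectorsD(3)[OF V e(1,2), of e] by auto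
qed

lemma apollonian_vectors_unique_triple:
  assumes V: "apollonian_vectors V" and W: "apollonian_vectors W"
    and abc: "a \<in> V" "b \<in> V" "c \<in> V" "a \<in> W" "b \<in> W" "c \<in> W"
    and t: "lor a b = -1" "lor a c = -1" "lor b c = -1"
  shows "V = W"
proof -
  obtain e where e: "quad {a, b, c, e}" "{a, b, c, e} \<subseteq> V" "e \<notin> {a, b, c}"
    using extend_triple[OF V abc(1-3) t] .
  have "e \<in> W"
    using tangent_to_three_mem[OF W abc(4-6) t, of e] quad_lor[OF e(1), of e] e(3) by auto
  then show ?thesis using apollonian_vectors_unique[OF V W e(1,2)] abc by simp
qed

section \<open>Circles from vectors\<close>

text \<open>The curvature times the power of the point; for a line, -2 times the signed distance
  from it. It is linear in \<open>u\<close>, which turns statements about two circles into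
  statements about the sum of their vectors.\<close>

definition height :: "lvec \<Rightarrow> real^2 \<Rightarrow> real" where
  "height u x = u $ 1 * ((x $ 1)\<^sup>2 + (x $ 2)\<^sup>2) - 2 * (u $ 2 * x $ 1 + u $ 3 * x $ 2) + u $ 4"

definition circ_of :: "lvec \<Rightarrow> circ" where
  "circ_of u = ({x. height u x = 0}, {x. height u x < 0})"

text \<open>Together with \<open>normal2\<close> this is half the gradient of \<open>height\<close>,
  at a boundary point of a unit vector the unit normal pointing out of the interior.\<close>

definition normal1 :: "lvec \<Rightarrow> real^2 \<Rightarrow> real" where
  "normal1 u x = u $ 1 * x $ 1 - u $ 2"

definition normal2 :: "lvec \<Rightarrow> real^2 \<Rightarrow> real" where
  "normal2 u x = u $ 1 * x $ 2 - u $ 3"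

lemma height_shift:
  "height u (vector [x $ 1 + a, x $ 2 + b]) =
     height u x + 2 * (normal1 u x * a + normal2 u x * b) + u $ 1 * (a\<^sup>2 + b\<^sup>2)"
  by (simp add: height_def normal1_def normal2_def power2_eq_square algebra_simps)

text \<open>At a common point the Lorentz product is the cosine of the angle between the outward
  normals.\<close>

lemma lor_normals:
  assumes "height u x = 0" "height v x = 0"
  shows "normal1 u x * normal1 v x + normal2 u x * normal2 v x = lor u v"
proof -
  have "2 * (normal1 u x * normal1 v x + normal2 u x * normal2 v x)
      = 2 * lor u v + u $ 1 * height v x + v $ 1 * height u x"
    by (simp add: lor_def height_def normal1_def normal2_def power2_eq_square algebra_simps)
  then show ?thesis using assms by simp
qed

lemma normal_norm:
  "(normal1 u x)\<^sup>2 + (normal2 u x)\<^sup>2 = lor u u + u $ 1 * height u x"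
  by (simp add: lor_def height_def normal1_def normal2_def power2_eq_square algebra_simps)

text \<open>If the sum \<open>(a, b)\<close> of the two outward normals is not zero, a short move
  against it has a component into each interior, so it ends in both.\<close>

lemma disjoint_normals:
  assumes "lor u u = 1" "lor v v = 1" "height u x = 0" "height v x = 0"
    and disj: "disjoint_interiors (circ_of u) (circ_of v)"
  shows "normal1 u x + normal1 v x = 0" "normal2 u x + normal2 v x = 0"
proof -
  define a b where "a = normal1 u x + normal1 v x" and "b = normal2 u x + normal2 v x"
  define N where "N = a\<^sup>2 + b\<^sup>2"
  have nu: "(normal1 u x)\<^sup>2 + (normal2 u x)\<^sup>2 = 1" "(normal1 v x)\<^sup>2 + (normal2 v x)\<^sup>2 = 1"
    using normal_norm[of u x] normal_norm[of v x] assms by auto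
  have 2: "2 * (normal1 u x * a + normal2 u x * b) = N" "2 * (normal1 v x * a + normal2 v x * b) = N"
    using nu by (simp_all add: N_def a_def b_def power2_eq_square algebra_simps)
  have "N = 0"
  proof (rule ccontr)
    assume "N \<noteq> 0"
    then have "N > 0" unfolding N_def by (metis not_sum_power2_lt_zero linorder_neqE_linordered_idom)
    \<comment> \<open>Short enough that for both circles the quadratic term of the height stays
      below the linear gain \<open>t * N\<close>.\<close>
    define t where "t = 1 / (\<bar>u $ 1\<bar> + \<bar>v $ 1\<bar> + 1)"
    have t: "t > 0" "u $ 1 * t < 1" "v $ 1 * t < 1" by (auto simp: t_def field_simps add_pos_nonneg)
    define y :: "real^2" where "y = vector [x $ 1 + (- t * a), x $ 2 + (- t * b)]"
    have "height w y = t * N * (w $ 1 * t - 1)"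
      if "height w x = 0" "2 * (normal1 w x * a + normal2 w x * b) = N" for w
    proof -
      have "height w y = - t * (2 * (normal1 w x * a + normal2 w x * b)) + w $ 1 * t\<^sup>2 * (a\<^sup>2 + b\<^sup>2)"
        unfolding y_def height_shift that(1) by (simp add: power2_eq_square algebra_simps)
      then show ?thesis unfolding that(2) N_def by (simp add: power2_eq_square algebra_simps)
    qed
    moreover have "t * N * (w $ 1 * t - 1) < 0" if "w $ 1 * t < 1" for w :: lvec
      using that t(1) \<open>N > 0\<close> by (simp add: mult_pos_neg)
    ultimately have "height u y < 0" "height v y < 0" using assms 2 t by simp_all
    then show False using disj by (auto simp: disjoint_interiors_def circ_of_def)
  qed
  then show "normal1 u x + normal1 v x = 0" "normal2 u x + normal2 v x = 0"
    by (simp_all add: N_def a_def b_def sum_power2_eq_zero_iff)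
qed

text \<open>
  A product at most \<open>-1\<close> also occurs for two interiors that together cover the plane; the sign
  of \<open>u + v\<close> tells the two situations apart.
\<close>

definition future :: "lvec \<Rightarrow> bool" where
  "future w \<longleftrightarrow> w $ 1 \<ge> 0 \<and> w $ 4 \<ge> 0"

text \<open>Causal vectors in opposite halves of the light cone have nonnegative product:
  Cauchy-Schwarz bounds the middle coordinates by the geometric mean of \<open>a\<close> and
  \<open>b\<close>, and this is at most their arithmetic mean.\<close>

lemma causal_future:
  assumes "lor w w \<le> 0" "lor w' w' \<le> 0" "future w'" "lor w w' < 0"
  shows "future w"
proof (rule ccontr)
  assume "\<not> future w"
  have ww: "(w $ 2)\<^sup>2 + (w $ 3)\<^sup>2 \<le> w $ 1 * w $ 4" and ww': "(w' $ 2)\<^sup>2 + (w' $ 3)\<^sup>2 \<le> w' $ 1 * w' $ 4"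
    using assms by (simp_all add: lor_def power2_eq_square)
  have "w $ 1 * w $ 4 \<ge> 0" using ww by (smt (verit) sum_power2_ge_zero)
  then have neg: "w $ 1 \<le> 0" "w $ 4 \<le> 0"
    using \<open>\<not> future w\<close> by (auto simp: future_def zero_le_mult_iff)
  have pos: "w' $ 1 \<ge> 0" "w' $ 4 \<ge> 0" using assms by (auto simp: future_def)
  define p where "p = w $ 2 * w' $ 2 + w $ 3 * w' $ 3"
  define a b where "a = - (w $ 1) * w' $ 4" and "b = w' $ 1 * (- (w $ 4))"
  have ab: "a \<ge> 0" "b \<ge> 0" using neg pos by (auto simp: a_def b_def mult_nonpos_nonneg mult_nonneg_nonpos)
  have "p\<^sup>2 \<le> ((w $ 2)\<^sup>2 + (w $ 3)\<^sup>2) * ((w' $ 2)\<^sup>2 + (w' $ 3)\<^sup>2)"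
  proof -
    have "((w $ 2)\<^sup>2 + (w $ 3)\<^sup>2) * ((w' $ 2)\<^sup>2 + (w' $ 3)\<^sup>2) - p\<^sup>2 = (w $ 2 * w' $ 3 - w $ 3 * w' $ 2)\<^sup>2"
      by (simp add: p_def power2_eq_square algebra_simps)
    then show ?thesis by (smt (verit) zero_le_power2)
  qed
  also have "\<dots> \<le> (w $ 1 * w $ 4) * (w' $ 1 * w' $ 4)"
    using ww ww' order_trans[OF sum_power2_ge_zero ww] by (intro mult_mono) auto
  also have "\<dots> = a * b" by (simp add: a_def b_def)
  also have "\<dots> \<le> ((a + b) / 2)\<^sup>2"
  proof -
    have "((a + b) / 2)\<^sup>2 - a * b = ((a - b) / 2)\<^sup>2" by (simp add: power2_eq_square field_simps)
    then show ?thesis by (smt (verit) zero_le_power2)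
  qed
  finally have "\<bar>p\<bar> \<le> \<bar>(a + b) / 2\<bar>" unfolding abs_le_square_iff .
  moreover have "lor w w' = p + (a + b) / 2" by (simp add: lor_def p_def a_def b_def field_simps)
  moreover have "\<bar>(a + b) / 2\<bar> = (a + b) / 2" using ab by simp
  ultimately show False using assms(4) by (smt (verit))
qed

text \<open>Applied to \<open>w = u + v\<close>, this prevents a point from lying in both interiors,
  since heights add. For positive curvature, curvature times height is a squared norm minus
  \<open>lor w w\<close>.\<close>

lemma future_height_nonneg:
  assumes "lor w w \<le> 0" "future w"
  shows "height w x \<ge> 0"
proof (cases "w $ 1 = 0")
  case True
  then have "(w $ 2)\<^sup>2 + (w $ 3)\<^sup>2 \<le> 0" using assms by (simp add: lor_def power2_eq_square)
  then have "w $ 2 = 0" "w $ 3 = 0" by (simp_all add: sum_power2_le_zero_iff)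
  then show ?thesis using True assms by (simp add: height_def future_def)
next
  case False
  then have "w $ 1 > 0" using assms by (simp add: future_def)
  moreover have "w $ 1 * height w x \<ge> 0"
    using normal_norm[of w x] assms(1) by (smt (verit) sum_power2_ge_zero)
  ultimately show ?thesis by (simp add: zero_le_mult_iff)
qed

lemma lor_sum_self: "lor u u = 1 \<Longrightarrow> lor v v = 1 \<Longrightarrow> lor (u + v) (u + v) = 2 + 2 * lor u v"
  by (simp add: lor_linear lor_commute)

lemma height_add: "height (u + v) x = height u x + height v x"
  by (simp add: height_def algebra_simps)

lemma future_disjoint:
  assumes "lor u u = 1" "lor v v = 1" "lor u v \<le> -1" "future (u + v)"
  shows "disjoint_interiors (circ_of u) (circ_of v)"
proof -
  have "height u x + height v x \<ge> 0" for x
    using future_height_nonneg[of "u + v" x] assms lor_sum_self[of u v] by (simp add: height_add)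
  then have "\<not> (height u x < 0 \<and> height v x < 0)" for x
    by (smt (verit))
  then show ?thesis by (auto simp: disjoint_interiors_def circ_of_def)
qed

lemma sum_sq_unit: "lor u u = 1 \<Longrightarrow> (u $ 2)\<^sup>2 + (u $ 3)\<^sup>2 = 1 + u $ 1 * u $ 4"
  by (simp add: lor_def power2_eq_square algebra_simps)

lemma mult_height: "lor u u = 1 \<Longrightarrow> u $ 1 * height u x = (normal1 u x)\<^sup>2 + (normal2 u x)\<^sup>2 - 1"
  using normal_norm[of u x] by simp

definition center_of :: "lvec \<Rightarrow> real^2" where
  "center_of w = vector [w $ 2 / w $ 1, w $ 3 / w $ 1]"

text \<open>The point is the mean of the two centres weighted by the curvatures. For positive
  curvatures it lies inside both circles when the product exceeds -1, and at product -1 it is the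
  point of tangency.\<close>

lemma height_center:
  assumes u: "lor u u = 1" and v: "lor v v = 1" and s: "u $ 1 + v $ 1 \<noteq> 0"
  shows "(u $ 1 + v $ 1)\<^sup>2 * (u $ 1 * height u (center_of (u + v)))
    = - 2 * (u $ 1 * v $ 1) * (1 + lor u v)"
proof -
  define x where "x = center_of (u + v)"
  have n: "(u $ 1 + v $ 1) * normal1 u x = u $ 1 * v $ 2 - v $ 1 * u $ 2"
    "(u $ 1 + v $ 1) * normal2 u x = u $ 1 * v $ 3 - v $ 1 * u $ 3"
    using s by (simp_all add: x_def center_of_def normal1_def normal2_def field_simps)
  have "(u $ 1 + v $ 1)\<^sup>2 * (u $ 1 * height u x)
      = ((u $ 1 + v $ 1) * normal1 u x)\<^sup>2 + ((u $ 1 + v $ 1) * normal2 u x)\<^sup>2 - (u $ 1 + v $ 1)\<^sup>2"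
    unfolding mult_height[OF u] power_mult_distrib by (simp add: right_diff_distrib distrib_left)
  also have "\<dots> = (u $ 1)\<^sup>2 * ((v $ 2)\<^sup>2 + (v $ 3)\<^sup>2) + (v $ 1)\<^sup>2 * ((u $ 2)\<^sup>2 + (u $ 3)\<^sup>2)
      - 2 * (u $ 1 * v $ 1) * (u $ 2 * v $ 2 + u $ 3 * v $ 3) - (u $ 1 + v $ 1)\<^sup>2"
    unfolding n by (simp add: power2_eq_square algebra_simps)
  also have "\<dots> = - 2 * (u $ 1 * v $ 1) * (1 + lor u v)"
    unfolding sum_sq_unit[OF u] sum_sq_unit[OF v] by (simp add: lor_def power2_eq_square field_simps)
  finally show ?thesis by (simp add: x_def)
qed

text \<open>By contraposition: when the product exceeds -1, a common interior point is exhibited,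
  separately for two lines, for a line and a disc, and for two discs.\<close>

lemma nonneg_disjoint_lor:
  assumes u: "lor u u = 1" "u $ 1 \<ge> 0" and v: "lor v v = 1" "v $ 1 \<ge> 0"
    and disj: "disjoint_interiors (circ_of u) (circ_of v)"
  shows "lor u v \<le> -1"
proof (rule ccontr)
  assume "\<not> ?thesis"
  then have gt: "1 + lor u v > 0" by simp
  have no: "\<not> (height u x < 0 \<and> height v x < 0)" for x
    using disj by (auto simp: disjoint_interiors_def circ_of_def)
  have mixed: "\<exists>x. height a x < 0 \<and> height b x < 0"
    if a: "lor a a = 1" "a $ 1 = 0" and b: "lor b b = 1" "b $ 1 > 0" and ab: "1 + lor a b > 0" for a b
  proof -
    \<comment> \<open>From the centre of the disc the point moves the fraction \<open>t\<close> of
      the radius into the half-plane. It stays in the disc for \<open>t\<close> below 1 and is in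
      the half-plane for \<open>t\<close> above \<open>- lor a b\<close>; the midpoint of these
      bounds is taken, or 0 if it is negative.\<close>
    define t where "t = max 0 ((1 - lor a b) / 2)"
    have t: "t \<ge> 0" "t < 1" "t > - lor a b" using ab by (auto simp: t_def max_def field_simps)
    define x :: "real^2" where "x = vector [(b $ 2 + t * a $ 2) / b $ 1, (b $ 3 + t * a $ 3) / b $ 1]"
    have n: "normal1 b x = t * a $ 2" "normal2 b x = t * a $ 3"
      using b by (simp_all add: x_def normal1_def normal2_def)
    have "b $ 1 * height b x = t\<^sup>2 * ((a $ 2)\<^sup>2 + (a $ 3)\<^sup>2) - 1"
      unfolding mult_height[OF b(1)] n by (simp add: power_mult_distrib algebra_simps)
    also have "\<dots> = t\<^sup>2 - 1" using sum_sq_unit[OF a(1)] a(2) by simp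
    also have "\<dots> < 0" using t by (simp add: power_less_one_iff)
    finally have "height b x < 0" using b(2) by (simp add: mult_less_0_iff)
    have "b $ 1 * height a x = - 2 * (a $ 2 * (b $ 2 + t * a $ 2) + a $ 3 * (b $ 3 + t * a $ 3)) + b $ 1 * a $ 4"
      using b(2) a(2) by (simp add: x_def height_def field_simps)
    also have "\<dots> = - 2 * (lor a b + t * ((a $ 2)\<^sup>2 + (a $ 3)\<^sup>2))"
      using a(2) by (simp add: lor_def power2_eq_square algebra_simps)
    also have "\<dots> < 0" using sum_sq_unit[OF a(1)] a(2) t by simp
    finally have "height a x < 0" using b(2) by (simp add: mult_less_0_iff)
    with \<open>height b x < 0\<close> show ?thesis by blast
  qed
  consider "u $ 1 = 0" "v $ 1 = 0" | "u $ 1 = 0" "v $ 1 > 0" | "u $ 1 > 0" "v $ 1 = 0" | "u $ 1 > 0" "v $ 1 > 0"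
    using u v by linarith
  then show False
  proof cases
    case 1
    \<comment> \<open>Moving along the sum of the two inward normals goes deeper into both
      half-planes; \<open>t\<close> is large enough to beat both offsets.\<close>
    define t where "t = (\<bar>u $ 4\<bar> + \<bar>v $ 4\<bar> + 1) / (1 + lor u v)"
    define x :: "real^2" where "x = vector [t * (u $ 2 + v $ 2), t * (u $ 3 + v $ 3)]"
    have "height u x = - 2 * t * ((u $ 2)\<^sup>2 + (u $ 3)\<^sup>2 + lor u v) + u $ 4"
         "height v x = - 2 * t * ((v $ 2)\<^sup>2 + (v $ 3)\<^sup>2 + lor u v) + v $ 4"
      using 1 by (simp_all add: height_def x_def lor_def power2_eq_square algebra_simps)
    then have "height u x = - 2 * (t * (1 + lor u v)) + u $ 4" "height v x = - 2 * (t * (1 + lor u v)) + v $ 4"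
      using 1 sum_sq_unit[OF u(1)] sum_sq_unit[OF v(1)] by (simp_all add: algebra_simps)
    moreover have "t * (1 + lor u v) = \<bar>u $ 4\<bar> + \<bar>v $ 4\<bar> + 1" using gt by (simp add: t_def)
    ultimately show False using no[of x] by auto
  next
    case 2
    then show False using mixed[of u v] u v gt no by blast
  next
    case 3
    then show False using mixed[of v u] u v gt no by (auto simp: lor_commute)
  next
    case 4
    have neg: "height a (center_of (a + b)) < 0"
      if "lor a a = 1" "lor b b = 1" "a $ 1 > 0" "b $ 1 > 0" "1 + lor a b > 0" for a b
    proof -
      have "(a $ 1 + b $ 1)\<^sup>2 * (a $ 1 * height a (center_of (a + b))) < 0"
        using height_center[of a b] that by simp
      then show ?thesis using that(3) by (simp add: mult_less_0_iff)
    qed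
    have "height u (center_of (u + v)) < 0" using neg[of u v] u v 4 gt by simp
    moreover have "height v (center_of (u + v)) < 0"
      using neg[of v u] u v 4 gt by (simp add: lor_commute add.commute)
    ultimately show False using no by blast
  qed
qed

lemma two_points:
  assumes "lor u u = 1"
  obtains p q where "height u p = 0" "height u q = 0" "p \<noteq> q"
proof (cases "u $ 1 = 0")
  case True
  define p q :: "real^2" where "p = vector [u $ 4 / 2 * u $ 2, u $ 4 / 2 * u $ 3]"
    and "q = vector [p $ 1 - u $ 3, p $ 2 + u $ 2]"
  have s: "(u $ 2)\<^sup>2 + (u $ 3)\<^sup>2 = 1" using sum_sq_unit[OF assms] True by simp
  have "height u p = - u $ 4 * ((u $ 2)\<^sup>2 + (u $ 3)\<^sup>2) + u $ 4"
    using True by (simp add: p_def height_def power2_eq_square algebra_simps)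
  then have "height u p = 0" using s by simp
  moreover have "height u q = height u p"
    using True by (simp add: q_def height_def algebra_simps)
  moreover have "p \<noteq> q" using s by (auto simp: q_def vec2_eq_iff)
  ultimately show thesis using that by simp
next
  case False
  define f :: "real \<Rightarrow> real^2" where "f e = vector [(u $ 2 + e) / u $ 1, u $ 3 / u $ 1]" for e
  have "height u (f e) = 0" if "e\<^sup>2 = 1" for e
    using mult_height[OF assms, of "f e"] that False by (simp add: f_def normal1_def normal2_def)
  moreover have "f 1 \<noteq> f (- 1)" using False by (simp add: f_def vec2_eq_iff)
  ultimately show thesis using that[of "f 1" "f (- 1)"] by simp
qed

lemma height_minus: "height (- u) x = - height u x"
  by (simp add: height_def)

text \<open>The circles of \<open>u\<close> and \<open>- v\<close> have the same boundary and
  disjoint interiors, so the outward normals of \<open>u\<close> and \<open>v\<close> agree along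
  it. Agreement at two distinct points forces equal curvatures.\<close>

lemma circ_of_inj:
  assumes u: "lor u u = 1" and v: "lor v v = 1" and eq: "circ_of u = circ_of v"
  shows "u = v"
proof -
  have z: "height u x = 0 \<longleftrightarrow> height v x = 0" and n: "height u x < 0 \<longleftrightarrow> height v x < 0" for x
    using eq by (auto simp: circ_of_def)
  have v': "lor (- v) (- v) = 1" using v by (simp add: lor_linear)
  have "disjoint_interiors (circ_of u) (circ_of (- v))"
    using n by (auto simp: disjoint_interiors_def circ_of_def height_minus)
  then have eqn: "(u $ 1 - v $ 1) * x $ 1 = u $ 2 - v $ 2" "(u $ 1 - v $ 1) * x $ 2 = u $ 3 - v $ 3"
    if "height u x = 0" for x
    using disjoint_normals[OF u v' that] z[of x] that
    by (simp_all add: height_minus normal1_def normal2_def algebra_simps)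
  obtain p q where pq: "height u p = 0" "height u q = 0" "p \<noteq> q" using two_points[OF u] .
  have 1: "u $ 1 = v $ 1"
  proof (rule ccontr)
    assume "u $ 1 \<noteq> v $ 1"
    then have "p = q" using eqn[OF pq(1)] eqn[OF pq(2)] by (simp add: vec2_eq_iff) (metis mult_left_cancel right_minus_eq)
    then show False using pq by simp
  qed
  moreover have "u $ 2 = v $ 2" "u $ 3 = v $ 3" using eqn[OF pq(1)] 1 by simp_all
  moreover from this have "u $ 4 = v $ 4" using pq(1) z[of p] 1 by (simp add: height_def)
  ultimately show ?thesis by (simp add: vec_eq_iff forall_4)
qed

lemma height_disc:
  assumes "lor u u = 1" "u $ 1 \<noteq> 0"
  shows "height u x = u $ 1 * ((dist (vector [u $ 2 / u $ 1, u $ 3 / u $ 1]) x)\<^sup>2 - (1 / u $ 1)\<^sup>2)"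
proof -
  have "u $ 1 * height u x = u $ 1 * (u $ 1 * ((dist (vector [u $ 2 / u $ 1, u $ 3 / u $ 1]) x)\<^sup>2 - (1 / u $ 1)\<^sup>2))"
    unfolding mult_height[OF assms(1)] dist_vec2 real_sqrt_pow2[OF sum_power2_ge_zero] using assms(2)
    by (simp add: normal1_def normal2_def power2_eq_square field_simps)
  then show ?thesis using assms(2) by simp
qed

lemma dist_sq_compare:
  assumes "r > 0"
  shows "(dist c x)\<^sup>2 < r\<^sup>2 \<longleftrightarrow> x \<in> ball c r" "(dist c x)\<^sup>2 = r\<^sup>2 \<longleftrightarrow> x \<in> sphere c r"
    "r\<^sup>2 < (dist c x)\<^sup>2 \<longleftrightarrow> x \<in> - cball c r"
proof -
  have "(dist c x)\<^sup>2 \<le> r\<^sup>2 \<longleftrightarrow> dist c x \<le> r" "r\<^sup>2 \<le> (dist c x)\<^sup>2 \<longleftrightarrow> r \<le> dist c x"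
    using assms by (simp_all add: power_mono_iff)
  then show "(dist c x)\<^sup>2 < r\<^sup>2 \<longleftrightarrow> x \<in> ball c r" "(dist c x)\<^sup>2 = r\<^sup>2 \<longleftrightarrow> x \<in> sphere c r"
    "r\<^sup>2 < (dist c x)\<^sup>2 \<longleftrightarrow> x \<in> - cball c r"
    by auto
qed

lemma circ_of_line:
  assumes "lor u u = 1" "u $ 1 = 0"
  shows "is_line (fst (circ_of u))"
proof -
  have "(vector [2 * u $ 2, 2 * u $ 3] :: real^2) \<noteq> 0"
    using sum_sq_unit[OF assms(1)] assms(2) by (auto simp: vec2_eq_iff)
  moreover have "fst (circ_of u) = {x. vector [2 * u $ 2, 2 * u $ 3] \<bullet> x = u $ 4}"
    using assms(2) by (auto simp: circ_of_def height_def inner_vec_def sum_2 algebra_simps)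
  ultimately show ?thesis unfolding is_line_def by blast
qed

lemma circ_of_sphere:
  assumes "lor u u = 1" "u $ 1 \<noteq> 0"
  shows "fst (circ_of u) = sphere (vector [u $ 2 / u $ 1, u $ 3 / u $ 1]) (1 / \<bar>u $ 1\<bar>)"
  using assms(2) dist_sq_compare(2)[of "1 / \<bar>u $ 1\<bar>"]
  by (auto simp: circ_of_def height_disc[OF assms] power_divide simp del: mem_sphere)

lemma is_line_circ_of: "lor u u = 1 \<Longrightarrow> is_line (fst (circ_of u)) \<longleftrightarrow> u $ 1 = 0"
  using circ_of_line circ_of_sphere bounded_not_line by metis

section \<open>Tangency with disjoint interiors, expressed by vectors\<close>

text \<open>At product -1 the sum is a null vector; its time direction separates external from
  internal tangency, and its vanishing would mean the two sides of one curve.\<close>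

definition touching :: "lvec \<Rightarrow> lvec \<Rightarrow> bool" where
  "touching u v \<longleftrightarrow> lor u v = -1 \<and> future (u + v) \<and> u + v \<noteq> 0"

lemma lor_null: "lor w w = 0 \<Longrightarrow> w $ 1 * w $ 4 = (w $ 2)\<^sup>2 + (w $ 3)\<^sup>2"
  by (simp add: lor_def power2_eq_square)

lemma normal_add: "normal1 (u + v) x = normal1 u x + normal1 v x"
  "normal2 (u + v) x = normal2 u x + normal2 v x"
  by (simp_all add: normal1_def normal2_def algebra_simps)

text \<open>At a common point disjointness makes the normals opposite, so the product is -1, and
  only the sign of the summed curvature is left to decide. Two lines have no common point to start
  from and are treated apart.\<close>

lemma tangent_imp_touching:
  assumes u: "lor u u = 1" and v: "lor v v = 1"
    and tan: "tangent (circ_of u) (circ_of v)" and disj: "disjoint_interiors (circ_of u) (circ_of v)"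
  shows "touching u v"
proof (cases "u $ 1 = 0 \<and> v $ 1 = 0")
  case True
  then have uu: "(u $ 2)\<^sup>2 + (u $ 3)\<^sup>2 = 1" and vv: "(v $ 2)\<^sup>2 + (v $ 3)\<^sup>2 = 1"
    using sum_sq_unit[OF u] sum_sq_unit[OF v] by auto
  have "lor u v \<le> -1" using nonneg_disjoint_lor[OF u _ v _ disj] True by simp
  then have "lor (u + v) (u + v) \<le> 0" by (simp add: lor_sum_self[OF u v])
  then have "(u $ 2 + v $ 2)\<^sup>2 + (u $ 3 + v $ 3)\<^sup>2 \<le> 0" using True by (simp add: lor_def power2_eq_square)
  then have "u $ 2 + v $ 2 = 0" "u $ 3 + v $ 3 = 0" by (simp_all add: sum_power2_le_zero_iff)
  then have opp: "v $ 2 = - u $ 2" "v $ 3 = - u $ 3" by linarith+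
  have "lor u v = - ((u $ 2)\<^sup>2 + (u $ 3)\<^sup>2)" using True opp by (simp add: lor_def power2_eq_square)
  then have lor: "lor u v = -1" using uu by simp
  \<comment> \<open>The point halfway between the parallel lines: both heights there equal half of
    \<open>u $ 4 + v $ 4\<close>, so neither overlap nor coincidence leaves any sign but
    positive.\<close>
  define x :: "real^2" where "x = vector [(u $ 4 - v $ 4) / 4 * u $ 2, (u $ 4 - v $ 4) / 4 * u $ 3]"
  have "height u x = - ((u $ 4 - v $ 4) / 2) * ((u $ 2)\<^sup>2 + (u $ 3)\<^sup>2) + u $ 4"
    "height v x = (u $ 4 - v $ 4) / 2 * ((u $ 2)\<^sup>2 + (u $ 3)\<^sup>2) + v $ 4"
    using True opp by (simp_all add: x_def height_def power2_eq_square algebra_simps add_divide_distrib diff_divide_distrib)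
  then have hx: "height u x = (u $ 4 + v $ 4) / 2" "height v x = (u $ 4 + v $ 4) / 2"
    using uu by (simp_all add: field_simps)
  have "\<not> (height u x < 0 \<and> height v x < 0)"
    using disj by (auto simp: disjoint_interiors_def circ_of_def)
  moreover have "\<not> (height u x = 0 \<and> height v x = 0)"
    using tan circ_of_line u v True by (auto simp: tangent_def circ_of_def)
  ultimately have "u $ 4 + v $ 4 > 0" using hx by auto
  then show ?thesis using lor True by (auto simp: touching_def future_def vec_eq_iff forall_4)
next
  case False
  then obtain p where p: "fst (circ_of u) \<inter> fst (circ_of v) = {p}"
    using tan is_line_circ_of u v by (auto simp: tangent_def)
  then have hp: "height u p = 0" "height v p = 0" by (auto simp: circ_of_def)
  define w where "w = u + v"
  note opp = disjoint_normals[OF u v hp disj]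
  have lor: "lor u v = -1"
  proof -
    have "normal1 v p = - normal1 u p" "normal2 v p = - normal2 u p" using opp by linarith+
    then have "lor u v = - ((normal1 u p)\<^sup>2 + (normal2 u p)\<^sup>2)"
      using lor_normals[OF hp] by (simp add: power2_eq_square)
    then show ?thesis using normal_norm[of u p] u hp by simp
  qed
  have wn: "w $ 1 * p $ 1 = w $ 2" "w $ 1 * p $ 2 = w $ 3"
    using opp by (simp_all add: w_def normal_add[symmetric]) (simp_all add: normal1_def normal2_def)
  have wh: "height w p = 0" using hp by (simp add: w_def height_add)
  have "w $ 1 \<noteq> 0"
  proof
    assume "w $ 1 = 0"
    then have "w = 0" using wn wh by (simp add: vec_eq_iff forall_4 height_def)
    then have "v = - u" by (simp add: w_def eq_neg_iff_add_eq_0 add.commute)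
    then have "fst (circ_of v) = fst (circ_of u)" by (auto simp: circ_of_def height_minus)
    then have *: "x = p" if "height u x = 0" for x using p that by (auto simp: circ_of_def)
    obtain q r where "height u q = 0" "height u r = 0" "q \<noteq> r" using two_points[OF u] .
    then show False using *[of q] *[of r] by simp
  qed
  have "\<not> w $ 1 < 0"
  proof
    assume neg: "w $ 1 < 0"
    define a b where "a = normal1 u p" and "b = normal2 u p"
    have ab: "a\<^sup>2 + b\<^sup>2 = 1" using normal_norm[of u p] u hp by (simp add: a_def b_def)
    define \<rho> where "\<rho> = 1 / (\<bar>v $ 1 - u $ 1\<bar> + 1)"
    \<comment> \<open>A point at distance \<open>\<rho>\<close> from \<open>p\<close>, with
      component \<open>s\<close> along the outward normal of \<open>u\<close>, has heights 2 s + u1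
      rho^2 and -2 s + v1 rho^2. This \<open>s\<close> makes them equal, with common value half of
      \<open>w $ 1 * \<rho>\<^sup>2\<close>, and \<open>\<rho>\<close> is small enough that such a
      point exists.\<close>
    define s where "s = (v $ 1 - u $ 1) * \<rho>\<^sup>2 / 4"
    have \<rho>: "\<rho> > 0" by (simp add: \<rho>_def add_nonneg_pos)
    have "\<bar>v $ 1 - u $ 1\<bar> * \<rho> \<le> 1" by (simp add: \<rho>_def field_simps add_nonneg_pos)
    then have "\<bar>v $ 1 - u $ 1\<bar> * \<rho> * \<rho> \<le> \<rho>" using \<rho> mult_right_mono[of _ 1 \<rho>] by simp
    then have "\<bar>s\<bar> \<le> \<rho>" using \<rho> by (simp add: s_def abs_mult power2_eq_square mult.assoc)
    then have "s\<^sup>2 \<le> \<rho>\<^sup>2" using \<rho> by (metis abs_le_square_iff abs_of_pos)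
    define t where "t = sqrt (\<rho>\<^sup>2 - s\<^sup>2)"
    have t: "s\<^sup>2 + t\<^sup>2 = \<rho>\<^sup>2" using \<open>s\<^sup>2 \<le> \<rho>\<^sup>2\<close> by (simp add: t_def)
    define y :: "real^2" where "y = vector [p $ 1 + (s * a - t * b), p $ 2 + (s * b + t * a)]"
    have "a * (s * a - t * b) + b * (s * b + t * a) = s * (a\<^sup>2 + b\<^sup>2)"
      "(s * a - t * b)\<^sup>2 + (s * b + t * a)\<^sup>2 = (s\<^sup>2 + t\<^sup>2) * (a\<^sup>2 + b\<^sup>2)"
      by (simp_all add: power2_eq_square algebra_simps)
    then have nn: "a * (s * a - t * b) + b * (s * b + t * a) = s"
      "(s * a - t * b)\<^sup>2 + (s * b + t * a)\<^sup>2 = \<rho>\<^sup>2" using ab t by simp_all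
    have n: "normal1 v p = - a" "normal2 v p = - b" using opp by (simp_all add: a_def b_def)
    have "height u y = 2 * s + u $ 1 * \<rho>\<^sup>2"
      unfolding y_def height_shift hp nn(2) a_def[symmetric] b_def[symmetric] nn(1) by simp
    then have "height u y = w $ 1 * \<rho>\<^sup>2 / 2" by (simp add: s_def w_def field_simps)
    moreover have "height v y = - 2 * (a * (s * a - t * b) + b * (s * b + t * a)) + v $ 1 * \<rho>\<^sup>2"
      unfolding y_def height_shift hp nn(2) n by (simp add: algebra_simps)
    then have "height v y = w $ 1 * \<rho>\<^sup>2 / 2" unfolding nn(1) by (simp add: s_def w_def field_simps)
    moreover have "w $ 1 * \<rho>\<^sup>2 / 2 < 0" using neg \<rho> by (simp add: mult_neg_pos)
    ultimately have "height u y < 0 \<and> height v y < 0" by linarith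
    then show False using disj by (auto simp: disjoint_interiors_def circ_of_def)
  qed
  then have "w $ 1 > 0" using \<open>w $ 1 \<noteq> 0\<close> by simp
  moreover have "w $ 1 * w $ 4 = (w $ 2)\<^sup>2 + (w $ 3)\<^sup>2"
    using lor_sum_self[OF u v] lor by (intro lor_null) (simp add: w_def)
  then have "w $ 1 * w $ 4 \<ge> 0" by simp
  then have "w $ 4 \<ge> 0" using \<open>w $ 1 > 0\<close> by (simp add: zero_le_mult_iff)
  moreover have "u + v \<noteq> 0" using \<open>w $ 1 \<noteq> 0\<close> by (metis w_def zero_index)
  ultimately show ?thesis using lor by (auto simp: touching_def future_def w_def)
qed

lemma touching_imp_disjoint:
  "lor u u = 1 \<Longrightarrow> lor v v = 1 \<Longrightarrow> touching u v \<Longrightarrow> disjoint_interiors (circ_of u) (circ_of v)"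
  using future_disjoint by (simp add: touching_def)

text \<open>A common point is a zero of the height of the null vector \<open>w\<close>, which for
  nonzero curvature vanishes only at \<open>center_of w\<close>; conversely that point lies on both
  curves by \<open>height_center\<close>.\<close>

lemma touching_imp_tangent:
  assumes u: "lor u u = 1" and v: "lor v v = 1" and t: "touching u v"
  shows "tangent (circ_of u) (circ_of v)"
proof -
  define w where "w = u + v"
  have lor: "lor u v = -1" and fut: "w $ 1 \<ge> 0" "w $ 4 \<ge> 0" and "w \<noteq> 0"
    using t by (auto simp: touching_def future_def w_def)
  have null: "w $ 1 * w $ 4 = (w $ 2)\<^sup>2 + (w $ 3)\<^sup>2"
    using lor_sum_self[OF u v] lor by (intro lor_null) (simp add: w_def)
  \<comment> \<open>A nonzero future null vector of curvature 0 has constant positive height, so the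
    two curves never meet. This is tangency at infinity and occurs only for two lines.\<close>
  have w0: "height w x = w $ 4 \<and> w $ 4 > 0" if "w $ 1 = 0" for x
  proof -
    have "w $ 2 = 0" "w $ 3 = 0" using null that by (simp_all add: sum_power2_eq_zero_iff)
    then show ?thesis using that \<open>w \<noteq> 0\<close> fut by (auto simp: vec_eq_iff forall_4 height_def)
  qed
  have hw: "height w x = height u x + height v x" for x by (simp add: w_def height_add)
  show ?thesis
  proof (cases "u $ 1 = 0 \<and> v $ 1 = 0")
    case True
    then have "\<not> (height u x = 0 \<and> height v x = 0)" for x
      using w0[of x] hw[of x] by (auto simp: w_def)
    then have "fst (circ_of u) \<inter> fst (circ_of v) = {}" by (auto simp: circ_of_def)
    then show ?thesis using True is_line_circ_of u v by (simp add: tangent_def)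
  next
    case False
    have "w $ 1 \<noteq> 0"
    proof
      assume w1: "w $ 1 = 0"
      then have "w $ 2 = 0" "w $ 3 = 0" using null by (simp_all add: sum_power2_eq_zero_iff)
      then have eq: "v $ 1 = - u $ 1" "v $ 2 = - u $ 2" "v $ 3 = - u $ 3" using w1 by (simp_all add: w_def)
      have "u $ 1 * w $ 4 = 0"
        using sum_sq_unit[OF u] sum_sq_unit[OF v] by (simp add: eq w_def algebra_simps)
      then show False using False eq w0[OF w1] by auto
    qed
    define p where "p = center_of w"
    have only: "x = p" if "height u x = 0" "height v x = 0" for x
    proof -
      have "(normal1 w x)\<^sup>2 + (normal2 w x)\<^sup>2 = 0"
        using normal_norm[of w x] hw[of x] that lor_sum_self[OF u v] lor by (simp add: w_def)
      then have "normal1 w x = 0" "normal2 w x = 0" by (simp_all add: sum_power2_eq_zero_iff)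
      then show ?thesis using \<open>w $ 1 \<noteq> 0\<close> by (simp add: p_def center_of_def vec2_eq_iff normal1_def normal2_def field_simps)
    qed
    have wp: "w $ 1 * height w p = 0"
      using normal_norm[of w p] lor_sum_self[OF u v] lor \<open>w $ 1 \<noteq> 0\<close>
      by (simp add: w_def[symmetric]) (simp add: p_def center_of_def normal1_def normal2_def)
    have "u $ 1 * height u p = 0" "v $ 1 * height v p = 0"
      using height_center[OF u v] height_center[OF v u] lor \<open>w $ 1 \<noteq> 0\<close>
      by (simp_all add: p_def w_def lor_commute[of v] add.commute[of v] add.commute[of "v $ 1"])
    moreover have "height u p + height v p = 0" using wp \<open>w $ 1 \<noteq> 0\<close> hw[of p] by simp
    ultimately have "height u p = 0 \<and> height v p = 0" using False by auto
    then have "fst (circ_of u) \<inter> fst (circ_of v) = {p}" using only by (auto simp: circ_of_def)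
    then show ?thesis using False is_line_circ_of u v by (simp add: tangent_def)
  qed
qed

section \<open>Interiors as components, and every circle as the circle of a vector\<close>

lemma components_Un_open:
  assumes "open A" "open B" "connected A" "connected B" "A \<noteq> {}" "B \<noteq> {}" "A \<inter> B = {}"
  shows "components (A \<union> B) = {A, B}"
proof -
  have comp: "C \<in> components (C \<union> D)"
    if "open C" "open D" "connected C" "C \<noteq> {}" "C \<inter> D = {}" for C D :: "'a set"
    unfolding in_components_maximal
  proof (intro conjI allI impI)
    fix E assume E: "E \<noteq> {} \<and> C \<subseteq> E \<and> E \<subseteq> C \<union> D \<and> connected E"
    then have "C \<inter> E = {} \<or> D \<inter> E = {}"
      using connectedD[of E C D] that by blast
    then show "E = C" using E that(4) by blast
  qed (use that in auto)
  have AB: "A \<in> components (A \<union> B)" "B \<in> components (A \<union> B)"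
    using comp[of A B] comp[of B A] assms by (auto simp: Un_commute Int_commute)
  moreover have "C = A \<or> C = B" if C: "C \<in> components (A \<union> B)" for C
  proof -
    have "C \<noteq> {}" "C \<subseteq> A \<union> B" using C in_components_nonempty in_components_subset by blast+
    then have "C \<inter> A \<noteq> {} \<or> C \<inter> B \<noteq> {}" by blast
    then show ?thesis using components_nonoverlap[OF C AB(1)] components_nonoverlap[OF C AB(2)] by auto
  qed
  ultimately show ?thesis by blast
qed

lemma continuous_height: "continuous_on UNIV (height u)"
  unfolding height_def by (intro continuous_intros)

lemma open_interior: "open {x. height u x < 0}"
  using open_Collect_less[OF continuous_height continuous_on_const] .

lemma interior_nonempty_connected:
  assumes u: "lor u u = 1"
  shows "{x. height u x < 0} \<noteq> {} \<and> connected {x. height u x < 0}"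
proof (cases "u $ 1 = 0")
  case True
  have "{x. height u x < 0} = {x. vector [2 * u $ 2, 2 * u $ 3] \<bullet> x > u $ 4}"
    using True by (auto simp: height_def inner_vec_def sum_2 algebra_simps)
  then have "connected {x. height u x < 0}"
    using convex_halfspace_gt convex_connected by metis
  moreover
  have s: "(u $ 2)\<^sup>2 + (u $ 3)\<^sup>2 = 1" using sum_sq_unit[OF u] True by simp
  define p :: "real^2" where "p = vector [(u $ 4 / 2 + 1) * u $ 2, (u $ 4 / 2 + 1) * u $ 3]"
  have "height u p = - 2 * (u $ 4 / 2 + 1) * ((u $ 2)\<^sup>2 + (u $ 3)\<^sup>2) + u $ 4"
    using True by (simp add: p_def height_def power2_eq_square algebra_simps)
  then have "height u p < 0" using s by simp
  ultimately show ?thesis by blast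
next
  case False
  define c :: "real^2" where "c = vector [u $ 2 / u $ 1, u $ 3 / u $ 1]"
  define r where "r = 1 / \<bar>u $ 1\<bar>"
  have r: "r > 0" "r\<^sup>2 = (1 / u $ 1)\<^sup>2" using False by (simp_all add: r_def power_divide)
  have h: "height u x = u $ 1 * ((dist c x)\<^sup>2 - r\<^sup>2)" for x
    unfolding c_def r(2) by (rule height_disc[OF u False])
  show ?thesis
  proof (cases "u $ 1 > 0")
    case True
    then have "{x. height u x < 0} = ball c r"
      using dist_sq_compare(1)[OF r(1)] by (auto simp: h mult_less_0_iff simp del: mem_ball)
    then show ?thesis using r(1) by simp
  next
    case neg: False
    then have "{x. height u x < 0} = - cball c r"
      using dist_sq_compare(3)[OF r(1)] False by (auto simp: h mult_less_0_iff simp del: mem_cball)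
    moreover have "connected (- cball c r)"
      by (intro connected_complement_bounded_convex) auto
    moreover have "- cball c r \<noteq> {}" using not_bounded_UNIV[where 'a="real^2"] bounded_cball
      by (metis Compl_empty_eq double_complement)
    ultimately show ?thesis by simp
  qed
qed

lemma components_circ_of:
  assumes u: "lor u u = 1"
  shows "components (- fst (circ_of u)) = {snd (circ_of u), snd (circ_of (- u))}"
proof -
  have "lor (- u) (- u) = 1" using u by (simp add: lor_linear)
  moreover have "- fst (circ_of u) = snd (circ_of u) \<union> snd (circ_of (- u))"
    "snd (circ_of u) \<inter> snd (circ_of (- u)) = {}"
    by (auto simp: circ_of_def height_minus)
  ultimately show ?thesis
    using components_Un_open[of "snd (circ_of u)" "snd (circ_of (- u))"] open_interior[of u]
      open_interior[of "- u"] interior_nonempty_connected[OF u] interior_nonempty_connected[of "- u"]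
    by (simp add: circ_of_def)
qed

lemma is_circle_circ_of:
  assumes u: "lor u u = 1"
  shows "is_circle (circ_of u)"
proof -
  have "(\<exists>c r. r > 0 \<and> fst (circ_of u) = sphere c r) \<or> is_line (fst (circ_of u))"
    using circ_of_line[OF u] circ_of_sphere[OF u] by (metis abs_zero zero_less_abs_iff zero_less_divide_1_iff)
  then show ?thesis unfolding is_circle_def components_circ_of[OF u] by blast
qed

text \<open>The curve determines the vector up to sign, and the chosen component of the complement
  decides the sign.\<close>

lemma is_circle_obtain:
  assumes "is_circle C"
  obtains u where "lor u u = 1" "C = circ_of u"
proof -
  have "\<exists>u. lor u u = 1 \<and> fst C = fst (circ_of u)"
    using assms unfolding is_circle_def
  proof (elim conjE disjE exE)
    fix c r assume r: "(0::real) < r" "fst C = sphere c r"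
    define u :: lvec where "u = vector [1 / r, c $ 1 / r, c $ 2 / r, ((c $ 1)\<^sup>2 + (c $ 2)\<^sup>2 - r\<^sup>2) / r]"
    have u: "lor u u = 1" using r by (simp add: u_def lor_def power2_eq_square field_simps)
    moreover have "u $ 1 \<noteq> 0" "1 / \<bar>u $ 1\<bar> = r" "vector [u $ 2 / u $ 1, u $ 3 / u $ 1] = c"
      using r by (simp_all add: u_def vec2_eq_iff)
    ultimately show ?thesis using circ_of_sphere[OF u] r by metis
  next
    assume "is_line (fst C)"
    then obtain a b where ab: "a \<noteq> 0" "fst C = {x. a \<bullet> x = b}" unfolding is_line_def by blast
    define N where "N = sqrt ((a $ 1)\<^sup>2 + (a $ 2)\<^sup>2)"
    have "(a $ 1)\<^sup>2 + (a $ 2)\<^sup>2 > 0" using ab(1) by (simp add: vec2_eq_iff sum_power2_gt_zero_iff)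
    then have N: "N > 0" "N * N = (a $ 1)\<^sup>2 + (a $ 2)\<^sup>2" by (simp_all add: N_def)
    define u :: lvec where "u = vector [0, a $ 1 / N, a $ 2 / N, 2 * b / N]"
    have "lor u u = ((a $ 1)\<^sup>2 + (a $ 2)\<^sup>2) / (N * N)"
      by (simp add: u_def lor_def power2_eq_square add_divide_distrib)
    then have "lor u u = 1" using N by (metis divide_self_if less_irrefl mult_eq_0_iff)
    moreover have "height u x = - 2 / N * (a \<bullet> x - b)" for x
      using N(1) by (simp add: u_def height_def inner_vec_def sum_2 field_simps)
    then have "fst (circ_of u) = {x. a \<bullet> x = b}" using N(1) by (simp add: circ_of_def)
    ultimately show ?thesis using ab(2) by metis
  qed
  then obtain u where u: "lor u u = 1" "fst C = fst (circ_of u)" by blast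
  then have "snd C = snd (circ_of u) \<or> snd C = snd (circ_of (- u))"
    using assms components_circ_of[OF u(1)] by (simp add: is_circle_def)
  moreover have "fst (circ_of (- u)) = fst (circ_of u)" by (simp add: circ_of_def height_minus)
  ultimately have "C = circ_of u \<or> C = circ_of (- u)" using u(2) by (metis prod.expand)
  moreover have "lor (- u) (- u) = 1" using u by (simp add: lor_linear)
  ultimately show thesis using that u(1) by blast
qed

section \<open>Packings as sets of vectors\<close>

text \<open>The sums of opposite pairs have product -4, so the future direction of
  \<open>b + c\<close> passes to \<open>d + a\<close>.\<close>

lemma touching_fourth:
  assumes u: "lor a a = 1" "lor b b = 1" "lor c c = 1" "lor d d = 1"
    and l: "lor d a = -1" "lor d b = -1" "lor d c = -1" "lor a b = -1" "lor a c = -1"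
    and t: "touching b c"
  shows "touching d a"
proof -
  have bc: "lor b c = -1" "future (b + c)" using t by (auto simp: touching_def)
  have neg: "lor (d + a) (b + c) = -4" using l by (simp add: lor_linear)
  have "future (d + a)"
    using causal_future[of "d + a" "b + c"] lor_sum_self[of d a] lor_sum_self[of b c] u l bc neg
    by simp
  moreover have "d + a \<noteq> 0" using neg by auto
  ultimately show ?thesis using l by (simp add: touching_def)
qed

lemma not_tangent_self:
  assumes u: "lor u u = 1"
  shows "\<not> tangent (circ_of u) (circ_of u)"
proof -
  obtain p q where "height u p = 0" "height u q = 0" "p \<noteq> q" using two_points[OF u] .
  then have "p \<in> fst (circ_of u)" "q \<in> fst (circ_of u)" "p \<noteq> q" by (auto simp: circ_of_def)
  then have "fst (circ_of u) \<noteq> {}" "\<nexists>p. fst (circ_of u) = {p}" by auto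
  then show ?thesis by (auto simp: tangent_def)
qed

definition vectors_of :: "circ set \<Rightarrow> lvec set" where
  "vectors_of P = {u. lor u u = 1 \<and> circ_of u \<in> P}"

lemma circ_of_vectors_of:
  assumes "\<forall>C\<in>P. is_circle C"
  shows "circ_of ` vectors_of P = P"
  using assms by (force simp: vectors_of_def elim: is_circle_obtain)

text \<open>The complement of a disc contains points of every half-plane far from its boundary line.
  Hence a packing with a line has no circle of negative curvature.\<close>

lemma exterior_meets_half_plane:
  assumes "u $ 1 < 0" "lor l l = 1" "l $ 1 = 0"
  shows "\<not> disjoint_interiors (circ_of u) (circ_of l)"
proof -
  define b where "b = 2 * (u $ 2 * l $ 2 + u $ 3 * l $ 3)"
  define t where "t = \<bar>l $ 4\<bar> + 1 + (\<bar>b\<bar> + \<bar>u $ 4\<bar> + 1) / (- u $ 1)"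
  have ll: "(l $ 2)\<^sup>2 + (l $ 3)\<^sup>2 = 1" using sum_sq_unit[OF assms(2)] assms(3) by simp
  define x :: "real^2" where "x = vector [t * l $ 2, t * l $ 3]"
  have "(\<bar>b\<bar> + \<bar>u $ 4\<bar> + 1) / (- u $ 1) \<ge> 0" using assms(1) by (intro divide_nonneg_nonneg) auto
  then have t: "t \<ge> 1" "t \<ge> \<bar>l $ 4\<bar> + 1" unfolding t_def by linarith+
  have "t \<ge> (\<bar>b\<bar> + \<bar>u $ 4\<bar> + 1) / (- u $ 1)" by (simp add: t_def)
  then have "- u $ 1 * t \<ge> \<bar>b\<bar> + \<bar>u $ 4\<bar> + 1" using assms(1) by (simp add: field_simps)
  then have "- u $ 1 * t * t \<ge> (\<bar>b\<bar> + \<bar>u $ 4\<bar> + 1) * t" using t by (intro mult_right_mono) auto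
  moreover have "- b * t \<le> \<bar>b\<bar> * t" "\<bar>u $ 4\<bar> * 1 \<le> \<bar>u $ 4\<bar> * t"
    using t by (intro mult_right_mono mult_left_mono; simp)+
  moreover have "height u x = u $ 1 * t * t * ((l $ 2)\<^sup>2 + (l $ 3)\<^sup>2) - b * t + u $ 4"
    by (simp add: height_def x_def b_def power2_eq_square algebra_simps)
  ultimately have "height u x < 0" using t by (simp add: ll algebra_simps)
  moreover have "height l x = - 2 * t * ((l $ 2)\<^sup>2 + (l $ 3)\<^sup>2) + l $ 4"
    using assms(3) by (simp add: height_def x_def power2_eq_square algebra_simps)
  then have "height l x < 0" using t by (simp add: ll)
  ultimately show ?thesis by (auto simp: disjoint_interiors_def circ_of_def)
qed

lemma half_plane_packing_line:
  assumes P: "half_plane_packing P" "\<not> strip_packing P"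
  obtains l where "l \<in> vectors_of P" "l $ 1 = 0" "\<And>u. u \<in> vectors_of P \<Longrightarrow> u \<noteq> l \<Longrightarrow> u $ 1 > 0"
proof -
  obtain C where C: "C \<in> P" "is_line (fst C)" using P by (auto simp: half_plane_packing_def)
  have ap: "apollonian_packing P" using P by (auto simp: half_plane_packing_def)
  then have "is_circle C" using C by (auto simp: apollonian_packing_def)
  then obtain l where l: "lor l l = 1" "C = circ_of l" by (rule is_circle_obtain)
  have l1: "l $ 1 = 0" using is_line_circ_of[OF l(1)] C l by simp
  have "u $ 1 > 0" if u: "u \<in> vectors_of P" "u \<noteq> l" for u
  proof -
    have uu: "lor u u = 1" "circ_of u \<in> P" using u by (auto simp: vectors_of_def)
    have ne: "circ_of u \<noteq> C" using circ_of_inj[OF uu(1) l(1)] u l by auto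
    have "u $ 1 \<noteq> 0"
      using is_line_circ_of[OF uu(1)] P(2) ap C uu(2) ne by (auto simp: strip_packing_def)
    moreover have "disjoint_interiors (circ_of u) (circ_of l)"
      using ap C(1) uu(2) ne l(2) by (auto simp: apollonian_packing_def pairwise_def)
    then have "\<not> u $ 1 < 0" using exterior_meets_half_plane l l1 by blast
    ultimately show ?thesis by simp
  qed
  then show thesis using that l l1 C by (auto simp: vectors_of_def)
qed

text \<open>With a single line and no negative curvature, two distinct vectors have a sum of
  positive curvature. Hence product -1 already gives \<open>touching\<close>, and geometric closure
  becomes closure under exchanges.\<close>

lemma half_plane_packing_vectors:
  assumes P: "half_plane_packing P" "\<not> strip_packing P"
  shows "apollonian_vectors (vectors_of P)"
    and "\<And>u v. u \<in> vectors_of P \<Longrightarrow> v \<in> vectors_of P \<Longrightarrow> lor u v = -1 \<Longrightarrow> touching u v"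
proof -
  obtain l where l: "l \<in> vectors_of P" "l $ 1 = 0" "\<And>u. u \<in> vectors_of P \<Longrightarrow> u \<noteq> l \<Longrightarrow> u $ 1 > 0"
    by (rule half_plane_packing_line[OF P]) blast
  have ap: "apollonian_packing P" using P by (auto simp: half_plane_packing_def)
  have unit: "lor u u = 1" if "u \<in> vectors_of P" for u using that by (simp add: vectors_of_def)
  have nonneg: "u $ 1 \<ge> 0" if "u \<in> vectors_of P" for u using l(2,3) that by (cases "u = l") (auto intro: less_imp_le)
  have disj: "disjoint_interiors (circ_of u) (circ_of v)"
    if "u \<in> vectors_of P" "v \<in> vectors_of P" "u \<noteq> v" for u v
    using ap that circ_of_inj[of u v] by (auto simp: apollonian_packing_def pairwise_def vectors_of_def)
  have far: "lor u v \<le> -1" if "u \<in> vectors_of P" "v \<in> vectors_of P" "u \<noteq> v" for u v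
    using nonneg_disjoint_lor disj[OF that] nonneg that unit by blast
  show touch: "touching u v" if uv: "u \<in> vectors_of P" "v \<in> vectors_of P" "lor u v = -1" for u v
  proof -
    have "u \<noteq> v" using uv unit by auto
    then have pos: "(u + v) $ 1 > 0"
      using l(2,3) uv nonneg by (cases "u = l"; cases "v = l") (auto intro: add_pos_nonneg add_nonneg_pos)
    have "lor (u + v) (u + v) = 0" using lor_sum_self[of u v] uv unit by simp
    then have "(u + v) $ 1 * (u + v) $ 4 = ((u + v) $ 2)\<^sup>2 + ((u + v) $ 3)\<^sup>2" by (rule lor_null)
    then have "(u + v) $ 1 * (u + v) $ 4 \<ge> 0" by simp
    then have "(u + v) $ 4 \<ge> 0" using pos by (simp add: zero_le_mult_iff)
    moreover have "u + v \<noteq> 0" using pos by (metis less_irrefl zero_index)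
    ultimately show ?thesis using pos uv(3) by (simp add: touching_def future_def)
  qed
  have closed: "d \<in> vectors_of P"
    if abc: "a \<in> vectors_of P" "b \<in> vectors_of P" "c \<in> vectors_of P"
      and t: "lor a b = -1" "lor a c = -1" "lor b c = -1"
      and d: "lor d d = 1" "lor d a = -1" "lor d b = -1" "lor d c = -1" for a b c d
  proof -
    note u = unit[OF abc(1)] unit[OF abc(2)] unit[OF abc(3)]
    have T: "touching a b" "touching b c" "touching a c" using touch abc t by auto
    \<comment> \<open>The sign of the curvature of \<open>d\<close> is unknown here; for each
      tangency it is settled by the touching pair formed by the other two circles.\<close>
    have "touching d a" "touching d b" "touching d c"
      using touching_fourth[OF u d(1)] touching_fourth[of b a c d] touching_fourth[of c a b d] u d t T
      by (simp_all add: lor_commute)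
    then have "circ_of d \<in> soddy_circles P"
      using T abc touching_imp_tangent touching_imp_disjoint u d(1) is_circle_circ_of[OF d(1)]
      unfolding soddy_circles_def mutually_tangent_def
      by (intro CollectI conjI bexI[of _ "circ_of a"] bexI[of _ "circ_of b"] bexI[of _ "circ_of c"])
        (auto simp: vectors_of_def)
    then show ?thesis using ap d by (auto simp: apollonian_packing_def vectors_of_def)
  qed
  obtain C1 C2 C3 where C: "C1 \<in> P" "C2 \<in> P" "C3 \<in> P" "mutually_tangent C1 C2 C3"
    using ap by (auto simp: apollonian_packing_def)
  have surj: "\<exists>u\<in>vectors_of P. C = circ_of u" if "C \<in> P" for C
    using circ_of_vectors_of[of P] ap that by (auto simp: apollonian_packing_def)
  obtain a b c where abc: "a \<in> vectors_of P" "b \<in> vectors_of P" "c \<in> vectors_of P"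
    "C1 = circ_of a" "C2 = circ_of b" "C3 = circ_of c"
    using surj C by meson
  have lor_tangent: "lor u v = -1"
    if "u \<in> vectors_of P" "v \<in> vectors_of P" "tangent (circ_of u) (circ_of v)" for u v
  proof -
    have "u \<noteq> v" using not_tangent_self unit that by blast
    then show ?thesis using tangent_imp_touching[of u v] unit disj that by (auto simp: touching_def)
  qed
  have t: "lor a b = -1" "lor a c = -1" "lor b c = -1"
    using lor_tangent C(4) abc by (auto simp: mutually_tangent_def)
  obtain x where x: "quad {a, b, c, x}"
    using fourth_tangent[of a b c] unit abc t by blast
  have "x \<notin> {a, b, c}" using x by (auto simp: quad_def card_insert_if split: if_splits)
  then have "x \<in> vectors_of P"
    using closed[OF abc(1-3) t, of x] quad_lor[OF x, of x] by auto
  then have ex: "\<exists>S. quad S \<and> S \<subseteq> vectors_of P" using x abc by blast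
  have refl: "reflected d S \<in> vectors_of P" if S: "quad S" "S \<subseteq> vectors_of P" "d \<in> S" for S d
  proof -
    have "card (S - {d}) = 3" using S quad_finite[OF S(1)] by (simp add: quad_def)
    then obtain a b c where S': "S - {d} = {a, b, c}" "a \<noteq> b" "b \<noteq> c" "a \<noteq> c" using card_3_iff by metis
    then have m: "a \<in> S" "b \<in> S" "c \<in> S" "a \<noteq> d" "b \<noteq> d" "c \<noteq> d" by blast+
    show ?thesis
    proof (rule closed[of a b c])
      show "lor (reflected d S) (reflected d S) = 1" using lor_reflected_self[OF S(1,3)] .
    qed (use m S S'(2-4) quad_lor[OF S(1)] lor_reflected[OF S(1,3)] in \<open>auto simp: lor_commute\<close>)
  qed
  show "apollonian_vectors (vectors_of P)"
    unfolding apollonian_vectors_def using unit far ex refl by blast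
qed

lemma soddy_circlesI:
  assumes "is_circle D" "C1 \<in> P" "C2 \<in> P" "C3 \<in> P" "mutually_tangent C1 C2 C3"
    and "\<forall>C\<in>{C1, C2, C3}. tangent D C \<and> disjoint_interiors D C"
  shows "D \<in> soddy_circles P"
  unfolding soddy_circles_def using assms(1)
  by (intro CollectI conjI bexI[OF _ assms(2)] bexI[OF _ assms(3)] bexI[OF _ assms(4)] assms(5,6))

lemma soddy_circlesE:
  assumes "D \<in> soddy_circles P"
  obtains C1 C2 C3 where "is_circle D" "C1 \<in> P" "C2 \<in> P" "C3 \<in> P" "mutually_tangent C1 C2 C3"
    "\<forall>C\<in>{C1, C2, C3}. tangent D C \<and> disjoint_interiors D C"
  using assms unfolding soddy_circles_def by blast

text \<open>\<open>apollonian_vectors\<close> is invariant under negating all vectors, which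
  exchanges interiors and exteriors; a touching pair rules out the wrong choice.\<close>

locale apollonian =
  fixes V :: "lvec set"
  assumes vectors: "apollonian_vectors V"
    and touching_pair: "\<exists>e\<in>V. \<exists>f\<in>V. touching e f"
begin

lemmas unit = apollonian_vectorsD(1)[OF vectors]
  and far = apollonian_vectorsD(2)[OF vectors]

lemma third_element:
  obtains c where "c \<in> V" "c \<noteq> u" "c \<noteq> v"
proof -
  obtain S where S: "quad S" "S \<subseteq> V" using vectors by (auto simp: apollonian_vectors_def)
  have "\<not> S \<subseteq> {u, v}"
  proof
    assume "S \<subseteq> {u, v}"
    then have "card S \<le> card {u, v}" by (intro card_mono) auto
    also have "\<dots> \<le> 2" by (simp add: card_insert_if)
    finally show False using S(1) by (simp add: quad_def)
  qed
  then show thesis using that S(2) by blast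
qed

text \<open>Unless the pairs coincide, at most one of the four products between them is 1 and the
  others are at most -1. So the sums have negative product and the future direction is inherited
  from \<open>e + f\<close>.\<close>

lemma future_add:
  assumes uv: "u \<in> V" "v \<in> V" "u \<noteq> v"
  shows "future (u + v)"
proof -
  obtain e f where ef: "e \<in> V" "f \<in> V" "touching e f" using touching_pair by blast
  then have t: "lor e f = -1" "future (e + f)" by (auto simp: touching_def)
  then have "e \<noteq> f" using unit ef by auto
  show ?thesis
  proof (cases "{u, v} = {e, f}")
    case True
    then show ?thesis using t by (auto simp: doubleton_eq_iff add.commute)
  next
    case False
    have le1: "lor x y \<le> 1" if "x \<in> V" "y \<in> V" for x y
      using unit[OF that(1)] far[OF that] by (cases "x = y") auto
    have le2: "lor x y \<le> -1" if "x \<in> V" "y \<in> V" "x \<noteq> y" for x y using far that .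
    have "lor (u + v) (e + f) = lor u e + lor u f + lor v e + lor v f" by (simp add: lor_linear)
    also have "\<dots> < 0"
      using False uv \<open>e \<noteq> f\<close> le1[OF uv(1) ef(1)] le1[OF uv(1) ef(2)] le1[OF uv(2) ef(1)] le1[OF uv(2) ef(2)]
        le2[OF uv(1) ef(1)] le2[OF uv(1) ef(2)] le2[OF uv(2) ef(1)] le2[OF uv(2) ef(2)]
      by (cases "u = e"; cases "u = f"; cases "v = e"; cases "v = f") auto
    finally show ?thesis
      using causal_future[of "u + v" "e + f"] lor_sum_self[of u v] lor_sum_self[of e f]
        unit uv ef t far[OF uv] by simp
  qed
qed

lemma touching_iff:
  assumes uv: "u \<in> V" "v \<in> V"
  shows "touching u v \<longleftrightarrow> lor u v = -1"
proof
  assume l: "lor u v = -1"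
  then have "u \<noteq> v" using unit uv by auto
  moreover have "u + v \<noteq> 0"
  proof
    assume "u + v = 0"
    then have v: "v = - u" by (simp add: eq_neg_iff_add_eq_0 add.commute)
    obtain c where c: "c \<in> V" "c \<noteq> u" "c \<noteq> v" by (rule third_element)
    then have "lor c u \<le> -1" "lor c v \<le> -1" using far uv by blast+
    then show False by (simp add: v lor_linear)
  qed
  ultimately show "touching u v" using l future_add[OF uv] by (simp add: touching_def)
qed (simp add: touching_def)

lemma disjoint: "u \<in> V \<Longrightarrow> v \<in> V \<Longrightarrow> u \<noteq> v \<Longrightarrow> disjoint_interiors (circ_of u) (circ_of v)"
  using future_disjoint future_add far unit by blast

lemma tangent_iff:
  assumes uv: "u \<in> V" "v \<in> V"
  shows "tangent (circ_of u) (circ_of v) \<longleftrightarrow> lor u v = -1"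
proof (cases "u = v")
  case True
  then show ?thesis using not_tangent_self unit uv by auto
next
  case False
  note u = unit[OF uv(1)] unit[OF uv(2)]
  show ?thesis
    using tangent_imp_touching[OF u _ disjoint[OF uv False]] touching_imp_tangent[OF u]
      touching_iff[OF uv] by blast
qed

lemma soddy_circles_subset:
  assumes P: "P \<subseteq> circ_of ` V"
  shows "soddy_circles P \<subseteq> circ_of ` V"
proof
  fix D assume "D \<in> soddy_circles P"
  then obtain C1 C2 C3 where D1: "is_circle D"
    and C: "C1 \<in> P" "C2 \<in> P" "C3 \<in> P" "mutually_tangent C1 C2 C3"
    and D2: "\<forall>C\<in>{C1, C2, C3}. tangent D C \<and> disjoint_interiors D C"
    by (rule soddy_circlesE)
  have surj: "\<exists>a\<in>V. C = circ_of a" if "C \<in> P" for C using that P by blast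
  obtain a b c where abc: "a \<in> V" "b \<in> V" "c \<in> V" "C1 = circ_of a" "C2 = circ_of b" "C3 = circ_of c"
    using surj[OF C(1)] surj[OF C(2)] surj[OF C(3)] by auto
  obtain d where d: "lor d d = 1" "D = circ_of d" using D1 by (rule is_circle_obtain)
  have t: "lor a b = -1" "lor b c = -1" "lor a c = -1"
    using C(4) tangent_iff[OF abc(1,2)] tangent_iff[OF abc(2,3)] tangent_iff[OF abc(1,3)]
    by (simp_all add: mutually_tangent_def abc(4-6))
  have td: "lor d a = -1" "lor d b = -1" "lor d c = -1"
    using D2 d(2) tangent_imp_touching[OF d(1) unit[OF abc(1)]]
      tangent_imp_touching[OF d(1) unit[OF abc(2)]] tangent_imp_touching[OF d(1) unit[OF abc(3)]]
    by (simp_all add: touching_def abc(4-6))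
  have "d \<in> V"
    using tangent_to_three_mem[OF vectors abc(1-3) t(1,3,2) d(1) td] .
  then show "D \<in> circ_of ` V" using d(2) by blast
qed

lemma apollonian_packing_image: "apollonian_packing (circ_of ` V)"
  unfolding apollonian_packing_def
proof (intro conjI)
  show "\<forall>C\<in>circ_of ` V. is_circle C" using is_circle_circ_of unit by blast
  show "pairwise disjoint_interiors (circ_of ` V)" using disjoint by (auto simp: pairwise_def)
  show "soddy_circles (circ_of ` V) \<subseteq> circ_of ` V" using soddy_circles_subset[OF order_refl] .
  obtain S where S: "quad S" "S \<subseteq> V" using vectors by (auto simp: apollonian_vectors_def)
  then have "3 \<le> card S" by (simp add: quad_def)
  then obtain T where T: "T \<subseteq> S" "card T = 3" by (rule obtain_subset_with_card_n)
  then obtain a b c where "T = {a, b, c}" "a \<noteq> b" "b \<noteq> c" "a \<noteq> c" using card_3_iff by metis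
  with T have m: "a \<in> S" "b \<in> S" "c \<in> S" "a \<noteq> b" "b \<noteq> c" "a \<noteq> c" by simp_all
  have "tangent (circ_of x) (circ_of y)" if "x \<in> S" "y \<in> S" "x \<noteq> y" for x y
    using tangent_iff[of x y] quad_lor[OF S(1) that(1,2)] that S(2) by auto
  then have "mutually_tangent (circ_of a) (circ_of b) (circ_of c)"
    using m by (simp add: mutually_tangent_def)
  moreover have "circ_of a \<in> circ_of ` V" "circ_of b \<in> circ_of ` V" "circ_of c \<in> circ_of ` V"
    using m S(2) by auto
  ultimately show "\<exists>C1\<in>circ_of ` V. \<exists>C2\<in>circ_of ` V. \<exists>C3\<in>circ_of ` V. mutually_tangent C1 C2 C3"
    by meson
qed

end

lemma generation_mono: "m \<le> n \<Longrightarrow> generation P m \<subseteq> generation P n"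
  by (induction n) (auto simp: le_Suc_eq)

lemma soddy_circles_generated: "soddy_circles (generated_packing P) \<subseteq> generated_packing P"
proof
  fix D assume "D \<in> soddy_circles (generated_packing P)"
  then obtain C1 C2 C3 where C: "C1 \<in> generated_packing P" "C2 \<in> generated_packing P" "C3 \<in> generated_packing P"
    "mutually_tangent C1 C2 C3"
    and D: "is_circle D" "\<forall>C\<in>{C1, C2, C3}. tangent D C \<and> disjoint_interiors D C"
    by (rule soddy_circlesE)
  from C(1-3) obtain i j k where ijk: "C1 \<in> generation P i" "C2 \<in> generation P j" "C3 \<in> generation P k"
    by (auto simp: generated_packing_def)
  have "C1 \<in> generation P (i + j + k)" by (rule subsetD[OF generation_mono ijk(1)]) simp
  moreover have "C2 \<in> generation P (i + j + k)" by (rule subsetD[OF generation_mono ijk(2)]) simp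
  moreover have "C3 \<in> generation P (i + j + k)" by (rule subsetD[OF generation_mono ijk(3)]) simp
  ultimately have "D \<in> soddy_circles (generation P (i + j + k))"
    using soddy_circlesI[OF D(1) _ _ _ C(4) D(2)] by blast
  then have "D \<in> generation P (Suc (i + j + k))" by simp
  then show "D \<in> generated_packing P" unfolding generated_packing_def by blast
qed

context apollonian
begin

text \<open>For the harder inclusion, a member of a quadruple whose other three members are
  generated is a Soddy circle of these. So the descent towards any vector of \<open>V\<close>,
  started at a quadruple containing \<open>I\<close>, never leaves the generated circles.\<close>

lemma generated_eq:
  assumes I: "card I = 3" "I \<subseteq> V" and t: "\<And>u v. u \<in> I \<Longrightarrow> v \<in> I \<Longrightarrow> u \<noteq> v \<Longrightarrow> lor u v = -1"
  shows "generated_packing (circ_of ` I) = circ_of ` V"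
proof
  have "generation (circ_of ` I) n \<subseteq> circ_of ` V" for n
  proof (induction n)
    case 0
    then show ?case using I(2) by (simp add: image_mono)
  next
    case (Suc n)
    then show ?case using soddy_circles_subset[OF Suc] by simp
  qed
  then show "generated_packing (circ_of ` I) \<subseteq> circ_of ` V"
    unfolding generated_packing_def by (rule UN_least)
next
  define G where "G = {u. circ_of u \<in> generated_packing (circ_of ` I)}"
  have step: "d \<in> G"
    if abc: "quad S" "S \<subseteq> V" "d \<in> S" "S - {d} \<subseteq> G" for d S
  proof -
    have "card (S - {d}) = 3" using abc quad_finite[OF abc(1)] by (simp add: quad_def)
    then obtain a b c where S': "S - {d} = {a, b, c}" "a \<noteq> b" "b \<noteq> c" "a \<noteq> c" using card_3_iff by metis
    then have m: "a \<in> S" "b \<in> S" "c \<in> S" "a \<noteq> d" "b \<noteq> d" "c \<noteq> d" by blast+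
    have tt: "tangent (circ_of x) (circ_of y)" "disjoint_interiors (circ_of x) (circ_of y)"
      if "x \<in> S" "y \<in> S" "x \<noteq> y" for x y
      using tangent_iff[of x y] quad_lor[OF abc(1), of x y] disjoint[of x y] that abc(2) by auto
    have "circ_of d \<in> soddy_circles (generated_packing (circ_of ` I))"
    proof (rule soddy_circlesI[of _ "circ_of a" _ "circ_of b" "circ_of c"])
      show "is_circle (circ_of d)" using is_circle_circ_of unit abc(2,3) by blast
      show "mutually_tangent (circ_of a) (circ_of b) (circ_of c)"
        using tt m S'(2-4) by (simp add: mutually_tangent_def)
      show "\<forall>C\<in>{circ_of a, circ_of b, circ_of c}. tangent (circ_of d) C \<and> disjoint_interiors (circ_of d) C"
        using tt[OF abc(3)] m by simp
    qed (use abc(4) S' in \<open>auto simp: G_def\<close>)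
    then show ?thesis using soddy_circles_generated by (auto simp: G_def)
  qed
  have "finite I" using I(1) card_ge_0_finite[of I] by simp
  then have "\<exists>S. quad S \<and> S \<subseteq> V \<and> I \<subseteq> S"
    using I(2) t by (rule apollonian_vectors_extend[OF vectors])
  then obtain S where S: "quad S" "S \<subseteq> V" "I \<subseteq> S" by (elim exE conjE)
  have "card (S - I) = 1"
    using S(1) I(1) card_Diff_subset[OF \<open>finite I\<close> S(3)] by (simp add: quad_def)
  then obtain e where e: "S - I = {e}" using card_1_singletonE by blast
  have "generation (circ_of ` I) 0 \<subseteq> generated_packing (circ_of ` I)"
    unfolding generated_packing_def by (rule UN_upper) simp
  then have "circ_of u \<in> generated_packing (circ_of ` I)" if "u \<in> I" for u
    using that by (simp add: image_subset_iff)
  then have "I \<subseteq> G" unfolding G_def by (intro subsetI CollectI)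
  have eS: "e \<in> S" "S - {e} \<subseteq> I" using e by auto
  have "e \<in> G" using step[OF S(1,2) eS(1) subset_trans[OF eS(2) \<open>I \<subseteq> G\<close>]] .
  moreover have "S \<subseteq> insert e I" using e by blast
  ultimately have "S \<subseteq> G" using \<open>I \<subseteq> G\<close> by blast
  define Q where "Q S \<longleftrightarrow> quad S \<and> S \<subseteq> V \<and> S \<subseteq> G" for S
  have "Q S" using S \<open>S \<subseteq> G\<close> by (simp add: Q_def)
  have QV: "quad S \<and> S \<subseteq> V" if "Q S" for S using that by (simp add: Q_def)
  have swap: "Q (swap d S)" if "Q S" "d \<in> S" "lor u d < -1" for u d S
  proof -
    have q: "quad (swap d S)" using that quad_swap by (simp add: Q_def)
    have sV: "swap d S \<subseteq> V" using apollonian_vectorsD(4)[OF vectors, of S d] that by (simp add: Q_def)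
    have "swap d S - {reflected d S} \<subseteq> S" by (auto simp: swap_def)
    then have sub: "swap d S - {reflected d S} \<subseteq> G" using that by (auto simp: Q_def)
    then have "reflected d S \<in> G" using step[OF q sV reflected_in_swap] by simp
    then have "swap d S \<subseteq> G" using sub by blast
    then show ?thesis using q sV by (simp add: Q_def)
  qed
  have "V \<subseteq> G"
  proof
    fix u assume u: "u \<in> V"
    obtain S' where "Q S'" "u \<in> S'"
      by (rule apollonian_vectors_descent[OF vectors u \<open>Q S\<close> QV swap])
    then show "u \<in> G" using subsetD[of S' G u] by (simp add: Q_def)
  qed
  then have "circ_of u \<in> generated_packing (circ_of ` I)" if "u \<in> V" for u
    using subsetD[OF \<open>V \<subseteq> G\<close> that] by (simp add: G_def)
  then show "circ_of ` V \<subseteq> generated_packing (circ_of ` I)" by (rule image_subsetI)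
qed

end

section \<open>Circles resting on the axis\<close>

text \<open>The axis with the lower half-plane as interior, hence the downward normal.\<close>

definition base_line :: lvec where
  "base_line = vector [0, 0, -1, 0]"

text \<open>
  The circle of curvature \<^term>\<open>s\<^sup>2\<close> resting on the axis at \<^term>\<open>t / s\<close>; for \<^term>\<open>s = 0\<close>
  it is a horizontal line. The parametrisation is quadratic, and tangency of two such circles
  becomes a condition on a determinant.
\<close>

definition nu :: "real \<Rightarrow> real \<Rightarrow> lvec" where
  "nu s t = vector [s\<^sup>2, s * t, 1, t\<^sup>2]"

lemma lor_nu: "lor (nu s t) (nu s' t') = 1 - (s * t' - s' * t)\<^sup>2 / 2"
  by (simp add: lor_def nu_def power2_eq_square field_simps)

lemma lor_nu_self [simp]: "lor (nu s t) (nu s t) = 1"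
  by (simp add: lor_nu)

lemma lor_base_line [simp]: "lor base_line base_line = 1" "lor (nu s t) base_line = -1"
  "lor base_line (nu s t) = -1"
  by (simp_all add: lor_def nu_def base_line_def)

lemma nu_minus: "nu (- s) (- t) = nu s t"
  by (simp add: nu_def)

lemma nu_neq_base_line: "nu s t \<noteq> base_line"
  using lor_base_line(2)[of s t] lor_base_line(1) by force

lemma nu_eq_iff: "nu s t = nu s' t' \<longleftrightarrow> (s = s' \<and> t = t') \<or> (s = - s' \<and> t = - t')"
proof
  assume eq: "nu s t = nu s' t'"
  have "s\<^sup>2 = s'\<^sup>2" "s * t = s' * t'" "t\<^sup>2 = t'\<^sup>2"
    using arg_cong[OF eq, of "\<lambda>u. u $ 1"] arg_cong[OF eq, of "\<lambda>u. u $ 2"] arg_cong[OF eq, of "\<lambda>u. u $ 4"]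
    by (simp_all add: nu_def)
  then show "(s = s' \<and> t = t') \<or> (s = - s' \<and> t = - t')"
    by (auto simp: power2_eq_iff)
qed (auto simp: nu_def)

lemma tangent_base_line_nu:
  assumes "lor u u = 1" "lor u base_line = -1" "u $ 1 > 0"
  obtains s t where "s > 0" "u = nu s t"
proof -
  have 3: "u $ 3 = 1" using assms(2) by (simp add: lor_def base_line_def)
  then have 2: "u $ 2 * u $ 2 = u $ 1 * u $ 4" using assms(1) by (simp add: lor_def)
  define s where "s = sqrt (u $ 1)"
  have s: "s > 0" "s * s = u $ 1" using assms(3) by (simp_all add: s_def)
  have "(u $ 2 / s)\<^sup>2 = u $ 4" using 2 s assms(3) by (simp add: power2_eq_square)
  then have "u = nu s (u $ 2 / s)" using s 3 by (simp add: nu_def vec_eq_iff forall_4 power2_eq_square)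
  then show thesis using that s(1) by blast
qed

lemma circ_L_eq: "circ_L = circ_of base_line"
  by (simp add: circ_L_def circ_of_def height_def base_line_def)

lemma disc_circ_nu:
  assumes "s \<noteq> 0"
  shows "disc_circ (vector [t / s, 1 / s\<^sup>2]) (1 / s\<^sup>2) = circ_of (nu s t)"
proof -
  define c :: "real^2" where "c = vector [t / s, 1 / s\<^sup>2]"
  have s2: "s\<^sup>2 > 0" and r: "1 / s\<^sup>2 > 0" using assms by simp_all
  have n1: "nu s t $ 1 = s\<^sup>2" by (simp add: nu_def)
  have "vector [nu s t $ 2 / nu s t $ 1, nu s t $ 3 / nu s t $ 1] = c"
    using assms by (simp add: c_def nu_def vec2_eq_iff power2_eq_square)
  then have h: "height (nu s t) x = s\<^sup>2 * ((dist c x)\<^sup>2 - (1 / s\<^sup>2)\<^sup>2)" for x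
    using height_disc[OF lor_nu_self[of s t], of x] n1 s2 by simp
  have "height (nu s t) x < 0 \<longleftrightarrow> (dist c x)\<^sup>2 < (1 / s\<^sup>2)\<^sup>2" "height (nu s t) x = 0 \<longleftrightarrow> (dist c x)\<^sup>2 = (1 / s\<^sup>2)\<^sup>2" for x
    unfolding h using s2 by (simp_all add: mult_less_0_iff)
  then show ?thesis
    unfolding disc_circ_def circ_of_def dist_sq_compare(1,2)[OF r] c_def[symmetric] by auto
qed

lemma circ_X_eq: "\<alpha> > 0 \<Longrightarrow> circ_X \<alpha> = circ_of (nu \<alpha> 0)"
  using disc_circ_nu[of \<alpha> 0] by (simp add: circ_X_def)

lemma circ_Y_eq: "circ_Y \<alpha> = circ_of (nu 1 (2 / \<alpha>))"
  using disc_circ_nu[of 1 "2 / \<alpha>"] by (simp add: circ_Y_def)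

lemma card_4_distinct:
  assumes "card {a, b, c, d} = 4"
  shows "a \<noteq> b" "a \<noteq> c" "a \<noteq> d" "b \<noteq> c" "b \<noteq> d" "c \<noteq> d"
  using assms by (auto simp: card_insert_if split: if_splits)

lemma quadI:
  assumes "lor a a = 1" "lor b b = 1" "lor c c = 1" "lor d d = 1"
    "lor a b = -1" "lor a c = -1" "lor a d = -1" "lor b c = -1" "lor b d = -1" "lor c d = -1"
  shows "quad {a, b, c, d}"
proof -
  have "a \<noteq> b" "a \<noteq> c" "a \<noteq> d" "b \<noteq> c" "b \<noteq> d" "c \<noteq> d" using assms by auto
  then show ?thesis using assms by (simp add: quad_def lor_commute)
qed

text \<open>As for Ford circles and Farey mediants, a circle that rests on the axis between two
  tangent ones has the sum of their parameters.\<close>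

definition base_quad :: "real \<Rightarrow> real \<Rightarrow> real \<Rightarrow> real \<Rightarrow> lvec set" where
  "base_quad s t s' t' = {base_line, nu s t, nu s' t', nu (s + s') (t + t')}"

lemma quad_base_quad:
  assumes "(s * t' - s' * t)\<^sup>2 = 4"
  shows "quad (base_quad s t s' t')"
proof -
  have "(s * (t + t') - (s + s') * t)\<^sup>2 = 4" "(s' * (t + t') - (s + s') * t')\<^sup>2 = 4"
    using assms by (simp_all add: power2_eq_square algebra_simps)
  then show ?thesis unfolding base_quad_def using assms by (intro quadI) (simp_all add: lor_nu)
qed

text \<open>The parallelogram law for the quadratic map \<open>nu\<close>: the vectors at the sum
  and the difference of the parameters add up to twice the other two. In the constant third
  coordinate the line supplies the correction.\<close>

lemma swap_base_quad:
  assumes "(s * t' - s' * t)\<^sup>2 = 4"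
  shows "swap (nu (s + s') (t + t')) (base_quad s t s' t') = base_quad s t (- s') (- t')"
proof -
  have q: "quad (base_quad s t s' t')" by (rule quad_base_quad[OF assms])
  then have "card (base_quad s t s' t') = 4" by (simp add: quad_def)
  note d = card_4_distinct[OF this[unfolded base_quad_def]]
  have "reflected (nu (s + s') (t + t')) (base_quad s t s' t') = nu (s - s') (t - t')"
    unfolding reflected_def base_quad_def using d
    by (simp add: vec_eq_iff forall_4) (simp add: nu_def base_line_def power2_eq_square algebra_simps)
  moreover have "base_quad s t s' t' - {nu (s + s') (t + t')} = {base_line, nu s t, nu s' t'}"
    unfolding base_quad_def using d by auto
  ultimately show ?thesis unfolding swap_def by (simp add: base_quad_def nu_minus insert_commute)
qed

locale based_apollonian =
  fixes V :: "lvec set" and s t s' t' :: real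
  assumes vectors: "apollonian_vectors V"
    and base: "base_line \<in> V" "nu s t \<in> V" "nu s' t' \<in> V"
    and det: "s * t' - s' * t = 2"
begin

definition lat :: "int \<Rightarrow> int \<Rightarrow> lvec" where
  "lat p q = nu (of_int p * s + of_int q * s') (of_int p * t + of_int q * t')"

lemma lat_det:
  "(of_int p * s + of_int q * s') * (of_int p' * t + of_int q' * t')
   - (of_int p' * s + of_int q' * s') * (of_int p * t + of_int q * t') = 2 * of_int (p * q' - q * p')"
proof -
  have "(of_int p * s + of_int q * s') * (of_int p' * t + of_int q' * t')
   - (of_int p' * s + of_int q' * s') * (of_int p * t + of_int q * t')
   = (s * t' - s' * t) * (of_int p * of_int q' - of_int q * of_int p')"
    by (simp add: algebra_simps)
  then show ?thesis using det by simp
qed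

text \<open>The determinant of two lattice vectors is 2 times that of their coefficients, so
  tangency means that the coefficients form a unimodular matrix.\<close>

lemma lor_lat: "lor (lat p q) (lat p' q') = 1 - 2 * (of_int (p * q' - q * p'))\<^sup>2"
  unfolding lat_def lor_nu lat_det power_mult_distrib by simp

lemma lor_lat_tangent: "\<bar>p * q' - q * p'\<bar> = 1 \<Longrightarrow> lor (lat p q) (lat p' q') = -1"
proof -
  assume "\<bar>p * q' - q * p'\<bar> = 1"
  then have "(p * q' - q * p')\<^sup>2 = 1" by (metis power2_abs power_one)
  then have "(real_of_int (p * q' - q * p'))\<^sup>2 = 1" by (metis of_int_1 of_int_power)
  then show ?thesis unfolding lor_lat by simp
qed

lemma lat_minus: "lat (- p) (- q) = lat p q"
  using nu_minus[of "of_int p * s + of_int q * s'" "of_int p * t + of_int q * t'"]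
  by (simp add: lat_def algebra_simps)

lemma lat_add_mem:
  assumes "\<bar>p * q' - q * p'\<bar> = 1" "lat p q \<in> V" "lat p' q' \<in> V"
  shows "lat (p + p') (q + q') \<in> V"
proof (rule tangent_to_three_mem[OF vectors base(1) assms(2,3)])
  show "lor (lat (p + p') (q + q')) (lat p q) = -1"
    using assms(1) by (intro lor_lat_tangent) (simp add: algebra_simps abs_minus_commute)
  show "lor (lat (p + p') (q + q')) (lat p' q') = -1"
    using assms(1) by (intro lor_lat_tangent) (simp add: algebra_simps)
qed (use lor_lat_tangent[OF assms(1)] in \<open>simp_all add: lat_def\<close>)

lemma lat_diff_mem:
  assumes "\<bar>p * q' - q * p'\<bar> = 1" "lat p q \<in> V" "lat p' q' \<in> V"
  shows "lat (p - p') (q - q') \<in> V"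
  using lat_add_mem[of p "- q'" q "- p'"] assms by (simp add: lat_minus abs_minus_commute)

lemma lat_shear_mem:
  assumes "\<bar>p * q' - q * p'\<bar> = 1" "lat p q \<in> V" "lat p' q' \<in> V"
  shows "lat (p + n * p') (q + n * q') \<in> V"
proof (induction n rule: int_induct[where k = 0])
  case base
  then show ?case using assms by simp
next
  case (step1 n)
  have "\<bar>(p + n * p') * q' - (q + n * q') * p'\<bar> = 1" using assms(1) by (simp add: algebra_simps)
  from lat_add_mem[OF this step1(2) assms(3)] show ?case by (simp add: algebra_simps)
next
  case (step2 n)
  have "\<bar>(p + n * p') * q' - (q + n * q') * p'\<bar> = 1" using assms(1) by (simp add: algebra_simps)
  from lat_diff_mem[OF this step2(2) assms(3)] show ?case by (simp add: algebra_simps)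
qed

text \<open>Euclid's algorithm on the first coordinates: replacing \<open>p\<close> by
  \<open>p mod p'\<close> is a shear of the basis, and by \<open>lat_shear_mem\<close> shears do not
  leave \<open>V\<close>. The process ends at a basis obtained from the two given circles by one
  more shear and signs.\<close>

lemma lat_mem:
  assumes "\<bar>p * q' - q * p'\<bar> = 1"
  shows "lat p q \<in> V \<and> lat p' q' \<in> V"
  using assms
proof (induction "nat \<bar>p'\<bar>" arbitrary: p q p' q' rule: less_induct)
  case less
  have e: "lat 1 0 \<in> V" "lat 0 1 \<in> V" using base by (simp_all add: lat_def)
  show ?case
  proof (cases "p' = 0")
    case True
    then have "\<bar>p * q'\<bar> = 1" using less.prems by simp
    then have pq: "\<bar>p\<bar> = 1" "\<bar>q'\<bar> = 1" by (auto simp: abs_mult zmult_eq_1_iff)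
    have shear: "lat 1 n \<in> V" for n using lat_shear_mem[of 1 1 0 0 n] e by simp
    have "lat 0 q' \<in> V" using pq(2) e(2) lat_minus[of 0 1] by (cases "q' \<ge> 0") auto
    moreover have "lat p q \<in> V"
      using pq(1) shear[of q] shear[of "- q"] lat_minus[of 1 "- q"] by (cases "p \<ge> 0") auto
    ultimately show ?thesis using True by simp
  next
    case False
    define k where "k = p div p'"
    have p: "p = p mod p' + k * p'" by (simp add: k_def)
    have d: "\<bar>p' * (q - k * q') - q' * (p mod p')\<bar> = 1"
      using less.prems by (subst (asm) p) (simp add: algebra_simps abs_minus_commute)
    have "nat \<bar>p mod p'\<bar> < nat \<bar>p'\<bar>" using False abs_mod_less[of p' p] by simp
    from less.hyps[OF this d] have m: "lat p' q' \<in> V" "lat (p mod p') (q - k * q') \<in> V" by simp_all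
    have "\<bar>p mod p' * q' - (q - k * q') * p'\<bar> = 1" using d by (simp add: algebra_simps abs_minus_commute)
    from lat_shear_mem[OF this m(2,1), of k] have "lat p q \<in> V" using p by (simp add: algebra_simps)
    then show ?thesis using m by simp
  qed
qed

definition lat_quad :: "int \<Rightarrow> int \<Rightarrow> int \<Rightarrow> int \<Rightarrow> lvec set" where
  "lat_quad p q p' q' = {base_line, lat p q, lat p' q', lat (p + p') (q + q')}"

definition Lat :: "lvec set \<Rightarrow> bool" where
  "Lat S \<longleftrightarrow> (\<exists>p q p' q'. \<bar>p * q' - q * p'\<bar> = 1 \<and> S = lat_quad p q p' q')"

lemma Lat_base: "Lat (lat_quad 1 0 0 1)"
  unfolding Lat_def by (intro exI[of _ 1] exI[of _ 0] exI[of _ 0] exI[of _ 1]) simp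

lemma lat_quad_base_quad: "lat_quad p q p' q' = base_quad (of_int p * s + of_int q * s')
   (of_int p * t + of_int q * t') (of_int p' * s + of_int q' * s') (of_int p' * t + of_int q' * t')"
  by (simp add: lat_quad_def base_quad_def lat_def algebra_simps)

lemma lat_det_square:
  assumes "\<bar>p * q' - q * p'\<bar> = 1"
  shows "((of_int p * s + of_int q * s') * (of_int p' * t + of_int q' * t')
   - (of_int p' * s + of_int q' * s') * (of_int p * t + of_int q * t'))\<^sup>2 = 4"
proof -
  have "(p * q' - q * p')\<^sup>2 = 1" using assms by (metis power2_abs power_one)
  then have "(real_of_int (p * q' - q * p'))\<^sup>2 = 1" by (metis of_int_1 of_int_power)
  then show ?thesis unfolding lat_det power_mult_distrib by simp
qed

lemma Lat_quad: "Lat S \<Longrightarrow> quad S"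
  using quad_base_quad[OF lat_det_square] by (auto simp: Lat_def lat_quad_base_quad)

lemma Lat_subset: "Lat S \<Longrightarrow> S \<subseteq> V"
proof -
  assume "Lat S"
  then obtain p q p' q' where d: "\<bar>p * q' - q * p'\<bar> = 1" "S = lat_quad p q p' q'" by (auto simp: Lat_def)
  have "\<bar>p * (q + q') - q * (p + p')\<bar> = 1" using d(1) by (simp add: algebra_simps)
  then have "lat (p + p') (q + q') \<in> V" using lat_mem by blast
  then show ?thesis using lat_mem[OF d(1)] d(2) base(1) by (simp add: lat_quad_def)
qed

lemma Lat_swap_last:
  assumes "\<bar>p * q' - q * p'\<bar> = 1"
  shows "Lat (swap (lat (p + p') (q + q')) (lat_quad p q p' q'))"
proof -
  have "swap (lat (p + p') (q + q')) (lat_quad p q p' q') = lat_quad p q (- p') (- q')"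
    using swap_base_quad[OF lat_det_square[OF assms]]
    by (simp add: lat_quad_base_quad lat_def algebra_simps)
  moreover have "\<bar>p * (- q') - q * (- p')\<bar> = 1" using assms by (simp add: abs_minus_commute)
  ultimately show ?thesis unfolding Lat_def by blast
qed

text \<open>Since \<open>lat\<close> ignores signs, the three circles of a lattice quadruple are
  three lattice vectors with sum zero. They play symmetric roles, so it is enough to treat the
  exchange of the last one.\<close>

lemma lat_quad_rotate: "lat_quad p' q' (- p - p') (- q - q') = lat_quad p q p' q'"
  "lat_quad p q (- p - p') (- q - q') = lat_quad p q p' q'"
proof -
  have n: "lat (- p - p') (- q - q') = lat (p + p') (q + q')"
    using lat_minus[of "p + p'" "q + q'"] by (simp add: algebra_simps)
  show "lat_quad p' q' (- p - p') (- q - q') = lat_quad p q p' q'"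
    "lat_quad p q (- p - p') (- q - q') = lat_quad p q p' q'"
    using lat_minus[of p q] lat_minus[of p' q'] by (auto simp: lat_quad_def n)
qed

lemma Lat_swap:
  assumes "Lat S" "d \<in> S" "d \<noteq> base_line"
  shows "Lat (swap d S)"
proof -
  obtain p q p' q' where d: "\<bar>p * q' - q * p'\<bar> = 1" "S = lat_quad p q p' q'"
    using assms(1) by (auto simp: Lat_def)
  consider "d = lat (p + p') (q + q')" | "d = lat p q" | "d = lat p' q'"
    using assms(2,3) d(2) by (auto simp: lat_quad_def)
  then show ?thesis
  proof cases
    case 1
    then show ?thesis using Lat_swap_last[OF d(1)] d(2) by simp
  next
    case 2
    have "\<bar>p' * (- q - q') - q' * (- p - p')\<bar> = 1" using d(1) by (simp add: algebra_simps)
    from Lat_swap_last[OF this] show ?thesis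
      unfolding 2 d(2) lat_quad_rotate(1) using lat_minus[of p q] by simp
  next
    case 3
    have "\<bar>p * (- q - q') - q * (- p - p')\<bar> = 1"
      using d(1) by (simp add: algebra_simps abs_minus_commute)
    from Lat_swap_last[OF this] show ?thesis
      unfolding 3 d(2) lat_quad_rotate(2) using lat_minus[of p' q'] by simp
  qed
qed

text \<open>The target is tangent to the line, so the descent never exchanges the line, and it is
  this exchange alone that would leave the lattice quadruples.\<close>

lemma Lat_reach:
  assumes u: "u \<in> V" "lor u base_line = -1"
  obtains S where "Lat S" "u \<in> S"
proof -
  have QV: "quad S \<and> S \<subseteq> V" if "Lat S" for S using Lat_quad[OF that] Lat_subset[OF that] by simp
  have step: "Lat (swap d S)" if "Lat S" "d \<in> S" "lor u d < -1" for S d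
  proof -
    have "d \<noteq> base_line" using that(3) u(2) by auto
    then show ?thesis using Lat_swap[OF that(1,2)] by simp
  qed
  show thesis by (rule apollonian_vectors_descent[OF vectors u(1) Lat_base QV step that])
qed

text \<open>First a lattice quadruple with \<open>u\<close> is reached; then the descent towards
  \<open>v\<close> keeps both the line and \<open>u\<close>. Product -1 turns into determinant 1 or
  -1 by \<open>lor_lat\<close>.\<close>

lemma tangent_base_line_lat:
  assumes u: "u \<in> V" "lor u base_line = -1" and v: "v \<in> V" "lor v base_line = -1" and uv: "lor u v = -1"
  obtains p q p' q' where "\<bar>p * q' - q * p'\<bar> = 1" "u = lat p q" "v = lat p' q'"
proof -
  obtain S where S: "Lat S" "u \<in> S" using Lat_reach[OF u] .
  define Q where "Q S \<longleftrightarrow> Lat S \<and> u \<in> S" for S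
  have "Q S" using S by (simp add: Q_def)
  have QV': "quad S \<and> S \<subseteq> V" if "Q S" for S
    using Lat_quad Lat_subset that by (simp add: Q_def)
  have step': "Q (swap d S)" if "Q S" "d \<in> S" "lor v d < -1" for S d
  proof -
    have "d \<noteq> u" using that(3) uv by (auto simp: lor_commute)
    moreover have "d \<noteq> base_line" using that(3) v(2) by auto
    ultimately show ?thesis using Lat_swap that by (simp add: Q_def swap_def)
  qed
  obtain T where T: "Q T" "v \<in> T"
    by (rule apollonian_vectors_descent[OF vectors v(1) \<open>Q S\<close> QV' step'])
  then obtain p q p' q' where d: "\<bar>p * q' - q * p'\<bar> = 1" "T = lat_quad p q p' q'"
    by (auto simp: Q_def Lat_def)
  have lat: "\<exists>a b. w = lat a b" if "w \<in> T" "lor w base_line = -1" for w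
    using that d(2) by (auto simp: lat_quad_def)
  obtain a b where ab: "u = lat a b" using lat[of u] T u(2) by (auto simp: Q_def)
  obtain a' b' where ab': "v = lat a' b'" using lat[of v] T v(2) by auto
  have "(real_of_int (a * b' - b * a'))\<^sup>2 = 1" using uv unfolding ab ab' lor_lat by simp
  then have "real_of_int ((a * b' - b * a')\<^sup>2) = 1" by simp
  then have "(a * b' - b * a')\<^sup>2 = 1" unfolding of_int_eq_1_iff .
  then have "\<bar>a * b' - b * a'\<bar> = 1" by (auto simp: power2_eq_1_iff)
  then show thesis using that ab ab' by blast
qed

lemma single_tangent_base_line_lat:
  assumes u: "u \<in> V" "lor u base_line = -1"
  obtains p q p' q' where "\<bar>p * q' - q * p'\<bar> = 1" "u = lat p q"
proof -
  obtain S where S: "Lat S" "u \<in> S" using Lat_reach[OF u] .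
  have "\<exists>v\<in>S. v \<noteq> u \<and> v \<noteq> base_line"
  proof (rule ccontr)
    assume "\<not> ?thesis"
    then have "card S \<le> card {u, base_line}" by (intro card_mono) auto
    also have "\<dots> \<le> 2" by (simp add: card_insert_if)
    finally show False using Lat_quad[OF S(1)] by (simp add: quad_def)
  qed
  then obtain v where v: "v \<in> S" "v \<noteq> u" "v \<noteq> base_line" by blast
  have "base_line \<in> S" using S(1) by (auto simp: Lat_def lat_quad_def)
  note l = quad_lor[OF Lat_quad[OF S(1)]]
  have "lor v base_line = -1" "lor u v = -1"
    using l[OF v(1) \<open>base_line \<in> S\<close>] l[OF S(2) v(1)] v by auto
  moreover have "v \<in> V" using Lat_subset[OF S(1)] v(1) by blast
  ultimately obtain p q p' q' where "\<bar>p * q' - q * p'\<bar> = 1" "u = lat p q" "v = lat p' q'"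
    using tangent_base_line_lat[OF u] by metis
  then show thesis using that by simp
qed

end

section \<open>Similarities\<close>

text \<open>Computed from curvature \<open>k / \<mu>\<close> and centre
  \<open>\<mu> A c + b\<close>; multiplying the centre by the curvature makes the rule linear in the
  vector, and in this form it covers lines as well.\<close>

definition sim_vec :: "real \<Rightarrow> real^2^2 \<Rightarrow> real^2 \<Rightarrow> lvec \<Rightarrow> lvec" where
  "sim_vec \<mu> A b u =
    (let k = u $ 1 / \<mu>; p = A $ 1 $ 1 * u $ 2 + A $ 1 $ 2 * u $ 3; q = A $ 2 $ 1 * u $ 2 + A $ 2 $ 2 * u $ 3 in
     vector [k, p + k * b $ 1, q + k * b $ 2,
       \<mu> * u $ 4 + 2 * (p * b $ 1 + q * b $ 2) + k * ((b $ 1)\<^sup>2 + (b $ 2)\<^sup>2)])"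

lemma orthogonal_matrix_2:
  fixes A :: "real^2^2"
  assumes "orthogonal_matrix A"
  shows "(A $ 1 $ 1)\<^sup>2 + (A $ 2 $ 1)\<^sup>2 = 1" "(A $ 1 $ 2)\<^sup>2 + (A $ 2 $ 2)\<^sup>2 = 1"
    "A $ 1 $ 1 * A $ 1 $ 2 + A $ 2 $ 1 * A $ 2 $ 2 = 0"
proof -
  have *: "transpose A ** A = mat 1" using assms by (simp add: orthogonal_matrix)
  have "(transpose A ** A) $ 1 $ 1 = 1" "(transpose A ** A) $ 2 $ 2 = 1" "(transpose A ** A) $ 1 $ 2 = 0"
    unfolding * by (simp_all add: mat_def)
  then show "(A $ 1 $ 1)\<^sup>2 + (A $ 2 $ 1)\<^sup>2 = 1" "(A $ 1 $ 2)\<^sup>2 + (A $ 2 $ 2)\<^sup>2 = 1"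
    "A $ 1 $ 1 * A $ 1 $ 2 + A $ 2 $ 1 * A $ 2 $ 2 = 0"
    by (simp_all add: matrix_matrix_mult_def transpose_def sum_2 power2_eq_square)
qed

lemma orthogonal_matrix_2I:
  fixes A :: "real^2^2"
  assumes "(A $ 1 $ 1)\<^sup>2 + (A $ 2 $ 1)\<^sup>2 = 1" "(A $ 1 $ 2)\<^sup>2 + (A $ 2 $ 2)\<^sup>2 = 1"
    "A $ 1 $ 1 * A $ 1 $ 2 + A $ 2 $ 1 * A $ 2 $ 2 = 0"
  shows "orthogonal_matrix A"
  unfolding orthogonal_matrix using assms
  by (simp add: matrix_matrix_mult_def transpose_def sum_2 power2_eq_square vec_eq_iff forall_2 mat_def mult.commute)

lemma lor_sim_vec:
  assumes A: "orthogonal_matrix A" and \<mu>: "\<mu> > 0"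
  shows "lor (sim_vec \<mu> A b u) (sim_vec \<mu> A b v) = lor u v"
proof -
  note o = orthogonal_matrix_2[OF A]
  define p q where "p w = A $ 1 $ 1 * w $ 2 + A $ 1 $ 2 * w $ 3" and "q w = A $ 2 $ 1 * w $ 2 + A $ 2 $ 2 * w $ 3" for w :: lvec
  have "p u * p v + q u * q v = ((A $ 1 $ 1)\<^sup>2 + (A $ 2 $ 1)\<^sup>2) * (u $ 2 * v $ 2)
     + ((A $ 1 $ 2)\<^sup>2 + (A $ 2 $ 2)\<^sup>2) * (u $ 3 * v $ 3)
     + (A $ 1 $ 1 * A $ 1 $ 2 + A $ 2 $ 1 * A $ 2 $ 2) * (u $ 2 * v $ 3 + u $ 3 * v $ 2)"
    by (simp add: p_def q_def power2_eq_square algebra_simps)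
  then have pq: "p u * p v + q u * q v = u $ 2 * v $ 2 + u $ 3 * v $ 3" unfolding o by simp
  have c: "sim_vec \<mu> A b w $ 1 = w $ 1 / \<mu>" "sim_vec \<mu> A b w $ 2 = p w + w $ 1 / \<mu> * b $ 1"
    "sim_vec \<mu> A b w $ 3 = q w + w $ 1 / \<mu> * b $ 2"
    "sim_vec \<mu> A b w $ 4 = \<mu> * w $ 4 + 2 * (p w * b $ 1 + q w * b $ 2) + w $ 1 / \<mu> * ((b $ 1)\<^sup>2 + (b $ 2)\<^sup>2)" for w
    by (simp_all add: sim_vec_def Let_def p_def q_def)
  have "lor (sim_vec \<mu> A b u) (sim_vec \<mu> A b v)
      = p u * p v + q u * q v - (u $ 1 / \<mu> * (\<mu> * v $ 4) + v $ 1 / \<mu> * (\<mu> * u $ 4)) / 2"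
    by (simp add: lor_def c power2_eq_square algebra_simps add_divide_distrib)
  then show ?thesis using \<mu> unfolding pq by (simp add: lor_def)
qed

lemma height_sim_vec:
  assumes A: "orthogonal_matrix A" and \<mu>: "\<mu> > 0"
  shows "height (sim_vec \<mu> A b u) (similarity_map \<mu> A b x) = \<mu> * height u x"
proof -
  note o = orthogonal_matrix_2[OF A]
  define p q where "p = A $ 1 $ 1 * u $ 2 + A $ 1 $ 2 * u $ 3" and "q = A $ 2 $ 1 * u $ 2 + A $ 2 $ 2 * u $ 3"
  define y z where "y = A $ 1 $ 1 * x $ 1 + A $ 1 $ 2 * x $ 2" and "z = A $ 2 $ 1 * x $ 1 + A $ 2 $ 2 * x $ 2"
  have "p * y + q * z = ((A $ 1 $ 1)\<^sup>2 + (A $ 2 $ 1)\<^sup>2) * (u $ 2 * x $ 1)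
     + ((A $ 1 $ 2)\<^sup>2 + (A $ 2 $ 2)\<^sup>2) * (u $ 3 * x $ 2)
     + (A $ 1 $ 1 * A $ 1 $ 2 + A $ 2 $ 1 * A $ 2 $ 2) * (u $ 2 * x $ 2 + u $ 3 * x $ 1)"
    by (simp add: p_def q_def y_def z_def power2_eq_square algebra_simps)
  then have 1: "p * y + q * z = u $ 2 * x $ 1 + u $ 3 * x $ 2" unfolding o by simp
  have "y\<^sup>2 + z\<^sup>2 = ((A $ 1 $ 1)\<^sup>2 + (A $ 2 $ 1)\<^sup>2) * (x $ 1)\<^sup>2
     + ((A $ 1 $ 2)\<^sup>2 + (A $ 2 $ 2)\<^sup>2) * (x $ 2)\<^sup>2
     + (A $ 1 $ 1 * A $ 1 $ 2 + A $ 2 $ 1 * A $ 2 $ 2) * (2 * (x $ 1 * x $ 2))"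
    by (simp add: y_def z_def power2_eq_square algebra_simps)
  then have 2: "y\<^sup>2 + z\<^sup>2 = (x $ 1)\<^sup>2 + (x $ 2)\<^sup>2" unfolding o by simp
  have s: "similarity_map \<mu> A b x $ 1 = \<mu> * y + b $ 1" "similarity_map \<mu> A b x $ 2 = \<mu> * z + b $ 2"
    by (simp_all add: similarity_map_def matrix_vector_mult_def sum_2 y_def z_def)
  define k where "k = u $ 1 / \<mu>"
  have c: "sim_vec \<mu> A b u $ 1 = k" "sim_vec \<mu> A b u $ 2 = p + k * b $ 1" "sim_vec \<mu> A b u $ 3 = q + k * b $ 2"
    "sim_vec \<mu> A b u $ 4 = \<mu> * u $ 4 + 2 * (p * b $ 1 + q * b $ 2) + k * ((b $ 1)\<^sup>2 + (b $ 2)\<^sup>2)"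
    by (simp_all add: sim_vec_def Let_def p_def q_def k_def)
  have "height (sim_vec \<mu> A b u) (similarity_map \<mu> A b x)
     = k * \<mu> * \<mu> * (y\<^sup>2 + z\<^sup>2) - 2 * \<mu> * (p * y + q * z) + \<mu> * u $ 4"
    unfolding height_def c s by (simp add: power2_eq_square algebra_simps)
  also have "\<dots> = \<mu> * height u x" unfolding 1 2 using \<mu> by (simp add: k_def height_def algebra_simps)
  finally show ?thesis .
qed

text \<open>The determinant is kept as an argument so that orientation can be followed through
  composition, inversion and conjugation.\<close>

definition sim :: "real \<Rightarrow> (real^2 \<Rightarrow> real^2) \<Rightarrow> bool" where
  "sim \<epsilon> \<Phi> \<longleftrightarrow> (\<exists>\<mu> A b. \<mu> > 0 \<and> orthogonal_matrix A \<and> det A = \<epsilon> \<and> \<Phi> = similarity_map \<mu> A b)"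

lemma is_similarity_iff: "is_similarity \<Phi> \<longleftrightarrow> (\<exists>\<epsilon>. sim \<epsilon> \<Phi>)"
  by (auto simp: is_similarity_def sim_def)

lemma orientation_reversing_iff: "orientation_reversing \<Phi> \<longleftrightarrow> sim (-1) \<Phi>"
  by (simp add: orientation_reversing_def sim_def)

lemma sim_id: "sim 1 id"
proof -
  have "id = similarity_map 1 (mat 1) 0" by (simp add: similarity_map_def fun_eq_iff)
  then show ?thesis unfolding sim_def using orthogonal_matrix_id det_I zero_less_one by blast
qed

lemma similarity_map_comp:
  "similarity_map \<mu> A b \<circ> similarity_map \<mu>' A' b' = similarity_map (\<mu> * \<mu>') (A ** A') (\<mu> *\<^sub>R (A *v b') + b)"
  by (simp add: similarity_map_def fun_eq_iff matrix_vector_right_distrib matrix_vector_mult_scaleR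
      matrix_vector_mul_assoc[symmetric] scaleR_add_right)

lemma sim_comp: "sim \<epsilon> \<Phi> \<Longrightarrow> sim \<epsilon>' \<Psi> \<Longrightarrow> sim (\<epsilon> * \<epsilon>') (\<Phi> \<circ> \<Psi>)"
  unfolding sim_def using similarity_map_comp orthogonal_matrix_mul det_mul mult_pos_pos by metis

lemma similarity_map_inverse:
  assumes "orthogonal_matrix A" "\<mu> > 0"
  shows "similarity_map (1 / \<mu>) (transpose A) (- (1 / \<mu>) *\<^sub>R (transpose A *v b)) \<circ> similarity_map \<mu> A b = id"
    and "similarity_map \<mu> A b \<circ> similarity_map (1 / \<mu>) (transpose A) (- (1 / \<mu>) *\<^sub>R (transpose A *v b)) = id"
proof -
  have "transpose A ** A = mat 1" "A ** transpose A = mat 1"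
    using assms(1) by (simp_all add: orthogonal_matrix_def)
  then show "similarity_map (1 / \<mu>) (transpose A) (- (1 / \<mu>) *\<^sub>R (transpose A *v b)) \<circ> similarity_map \<mu> A b = id"
    "similarity_map \<mu> A b \<circ> similarity_map (1 / \<mu>) (transpose A) (- (1 / \<mu>) *\<^sub>R (transpose A *v b)) = id"
    using assms(2) unfolding similarity_map_comp
    by (simp_all add: similarity_map_def fun_eq_iff matrix_vector_mult_scaleR matrix_vector_mul_assoc
        linear_neg[OF matrix_vector_mul_linear] del: transpose_matrix_vector)
qed

lemma sim_inverse:
  assumes "sim \<epsilon> \<Phi>"
  obtains \<Psi> where "sim \<epsilon> \<Psi>" "\<Psi> \<circ> \<Phi> = id" "\<Phi> \<circ> \<Psi> = id"
proof -
  obtain \<mu> A b where m: "\<mu> > 0" "orthogonal_matrix A" "det A = \<epsilon>" "\<Phi> = similarity_map \<mu> A b"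
    using assms unfolding sim_def by blast
  have "orthogonal_matrix (transpose A)" "det (transpose A) = \<epsilon>" "1 / \<mu> > 0"
    using m by (simp_all add: orthogonal_matrix_transpose det_transpose)
  then have "sim \<epsilon> (similarity_map (1 / \<mu>) (transpose A) (- (1 / \<mu>) *\<^sub>R (transpose A *v b)))"
    unfolding sim_def by blast
  then show thesis using that similarity_map_inverse[OF m(2,1)] m(4) by blast
qed

lemma sim_values: "sim \<epsilon> \<Phi> \<Longrightarrow> \<epsilon> = 1 \<or> \<epsilon> = -1"
  unfolding sim_def using det_orthogonal_matrix by blast

lemma act_comp: "act (\<Phi> \<circ> \<Psi>) P = act \<Phi> (act \<Psi> P)"
  by (simp add: act_def image_comp comp_def)

lemma act_id: "act id P = P"
  by (simp add: act_def)

lemma circ_of_sim_vec: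
  fixes b :: "real^2"
  assumes A: "orthogonal_matrix A" and \<mu>: "\<mu> > 0"
  defines "\<Phi> \<equiv> similarity_map \<mu> A b"
  shows "(\<Phi> ` fst (circ_of u), \<Phi> ` snd (circ_of u)) = circ_of (sim_vec \<mu> A b u)"
proof -
  define \<Psi> where "\<Psi> = similarity_map (1 / \<mu>) (transpose A) (- (1 / \<mu>) *\<^sub>R (transpose A *v b))"
  have inv: "\<Phi> (\<Psi> y) = y" for y
    using similarity_map_inverse(2)[OF A \<mu>, of b] unfolding \<Phi>_def \<Psi>_def by (metis comp_apply id_apply)
  have h: "height (sim_vec \<mu> A b u) (\<Phi> x) = \<mu> * height u x" for x
    unfolding \<Phi>_def by (rule height_sim_vec[OF A \<mu>])
  have eq: "\<Phi> ` {x. R (height u x)} = {y. R' (height (sim_vec \<mu> A b u) y)}"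
    if "\<And>h. R' (\<mu> * h) \<longleftrightarrow> R h" for R R' :: "real \<Rightarrow> bool"
  proof
    show "\<Phi> ` {x. R (height u x)} \<subseteq> {y. R' (height (sim_vec \<mu> A b u) y)}" using that h by auto
    show "{y. R' (height (sim_vec \<mu> A b u) y)} \<subseteq> \<Phi> ` {x. R (height u x)}"
    proof
      fix y assume "y \<in> {y. R' (height (sim_vec \<mu> A b u) y)}"
      then have "R (height u (\<Psi> y))" using that h[of "\<Psi> y"] inv[of y] by simp
      then show "y \<in> \<Phi> ` {x. R (height u x)}" using inv[of y] by (intro image_eqI[of _ _ "\<Psi> y"]) auto
    qed
  qed
  show ?thesis
    using eq[of "\<lambda>h. h = 0" "\<lambda>h. h = 0"] eq[of "\<lambda>h. h < 0" "\<lambda>h. h < 0"] \<mu>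
    by (simp add: circ_of_def mult_less_0_iff)
qed

lemma act_circ_of:
  assumes "orthogonal_matrix A" "\<mu> > 0"
  shows "act (similarity_map \<mu> A b) (circ_of ` V) = circ_of ` (sim_vec \<mu> A b ` V)"
  unfolding act_def image_image using circ_of_sim_vec[OF assms] by (intro image_cong) auto

lemma sim_vec_linear:
  "sim_vec \<mu> A b (u + v) = sim_vec \<mu> A b u + sim_vec \<mu> A b v"
  "sim_vec \<mu> A b (c *\<^sub>R u) = c *\<^sub>R sim_vec \<mu> A b u"
  by (simp_all add: sim_vec_def Let_def vec_eq_iff forall_4 algebra_simps add_divide_distrib)

lemma linear_sim_vec: "linear (sim_vec \<mu> A b)"
  by (intro linearI sim_vec_linear)

text \<open>All conditions concern products and linear combinations. Injectivity on \<open>V\<close>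
  also comes from the products: vectors with equal images would have product 1, which distinct
  members never have.\<close>

lemma isometry_apollonian_vectors:
  assumes g: "linear g" and iso: "\<And>u v. lor (g u) (g v) = lor u v" and V: "apollonian_vectors V"
  shows "apollonian_vectors (g ` V)"
proof -
  have inj: "u = v" if "u \<in> V" "v \<in> V" "g u = g v" for u v
  proof (rule ccontr)
    assume "u \<noteq> v"
    then have "lor u v \<le> -1" using apollonian_vectorsD(2)[OF V that(1,2)] by simp
    moreover have "lor u v = lor (g v) (g v)" using iso[of u v] that(3) by simp
    ultimately show False using iso[of v v] apollonian_vectorsD(1)[OF V that(2)] by simp
  qed
  have quad_image: "quad (g ` S)" if "quad S" "S \<subseteq> V" for S
  proof -
    have "inj_on g S" using inj that(2) by (auto simp: inj_on_def)
    then have "card (g ` S) = 4" using that(1) by (simp add: card_image quad_def)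
    then show ?thesis using that(1) by (auto simp: quad_def iso)
  qed
  obtain S where S: "quad S" "S \<subseteq> V" using V by (auto simp: apollonian_vectors_def)
  have refl: "reflected d T \<in> g ` V" if T: "quad T" "T \<subseteq> g ` V" "d \<in> T" for d T
  proof -
    obtain S where S: "S \<subseteq> V" "T = g ` S" using T(2) by (meson subset_image_iff)
    have inj_S: "inj_on g S" using inj S(1) by (auto simp: inj_on_def)
    have "quad S"
      using T(1) unfolding quad_def S(2) by (auto simp: card_image[OF inj_S] iso inj_on_eq_iff[OF inj_S])
    obtain e where e: "e \<in> S" "d = g e" using T(3) S(2) by blast
    have "\<Sum>T = g (\<Sum>S)" unfolding S(2) sum.reindex[OF inj_S] using linear_sum[OF g, of "\<lambda>x. x" S] by simp
    then have "reflected d T = g (reflected e S)"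
      unfolding reflected_def e(2) by (simp add: linear_diff[OF g] linear_scale[OF g])
    then show ?thesis using apollonian_vectorsD(3)[OF V \<open>quad S\<close> S(1) e(1)] by simp
  qed
  show ?thesis
    unfolding apollonian_vectors_def
  proof (intro conjI)
    show "\<forall>u\<in>g ` V. lor u u = 1" using apollonian_vectorsD(1)[OF V] by (auto simp: iso)
    show "\<forall>u\<in>g ` V. \<forall>v\<in>g ` V. u \<noteq> v \<longrightarrow> lor u v \<le> -1" using apollonian_vectorsD(2)[OF V] by (auto simp: iso)
    show "\<exists>S. quad S \<and> S \<subseteq> g ` V" using quad_image[OF S] S(2) by blast
    show "\<forall>S d. quad S \<and> S \<subseteq> g ` V \<and> d \<in> S \<longrightarrow> reflected d S \<in> g ` V" using refl by simp
  qed
qed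

section \<open>Unimodular equivalence and complete quotients\<close>

text \<open>The step to the next complete quotient. At an integer it divides by zero and returns 0;
  irrational arguments never get there.\<close>

definition gauss :: "real \<Rightarrow> real" where
  "gauss x = 1 / frac x"

text \<open>The product starts at the first iterate and omits \<open>x\<close>: one step of the
  expansion is a matrix whose multiplier is the new quotient, so this is the multiplier of
  \<open>n\<close> steps.\<close>

definition quotients_prod :: "nat \<Rightarrow> real \<Rightarrow> real" where
  "quotients_prod n x = (\<Prod>i<n. (gauss ^^ Suc i) x)"

text \<open>
  The multiplier \<open>l\<close> is kept because the similarity belonging to the matrix has ratio
  \<open>1 / l\<^sup>2\<close>; in particular \<open>l = 1\<close> detects the identity.
\<close>

definition unimodular :: "int \<Rightarrow> real \<Rightarrow> real \<Rightarrow> real \<Rightarrow> bool" where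
  "unimodular \<epsilon> l a b \<longleftrightarrow> (\<exists>p q r t :: int. p * t - q * r = \<epsilon> \<and>
     of_int p * b + of_int q = l * a \<and> of_int r * b + of_int t = l)"

text \<open>Going \<open>m\<close> steps from \<open>a\<close> and back along the \<open>n\<close>
  steps from \<open>b\<close> composes matrices of determinant -1; sign and multiplier recorded here
  are those of the composite.\<close>

definition merging :: "int \<Rightarrow> real \<Rightarrow> real \<Rightarrow> real \<Rightarrow> bool" where
  "merging \<epsilon> l a b \<longleftrightarrow> (\<exists>m n. (gauss ^^ m) a = (gauss ^^ n) b \<and> \<epsilon> = (-1) ^ (m + n) \<and>
     l * quotients_prod n b = quotients_prod m a)"

lemma gauss_irrational:
  assumes "x \<notin> \<rat>"
  shows "gauss x \<notin> \<rat>" "gauss x > 1" "x = of_int \<lfloor>x\<rfloor> + 1 / gauss x" "gauss x \<noteq> 0"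
proof -
  have f: "0 < frac x" "frac x < 1"
    using assms frac_gt_0_iff[of x] Ints_subset_Rats by (auto simp: frac_lt_1)
  have "frac x \<notin> \<rat>" using assms by (metis Rats_add Rats_of_int frac_def diff_add_cancel)
  then show "gauss x \<notin> \<rat>" unfolding gauss_def by (metis Rats_divide Rats_1 divide_divide_eq_right mult_1 div_by_1)
  show "gauss x > 1" using f by (simp add: gauss_def)
  then show "gauss x \<noteq> 0" by simp
  show "x = of_int \<lfloor>x\<rfloor> + 1 / gauss x" by (simp add: gauss_def frac_def)
qed

lemma iterate_irrational: "x \<notin> \<rat> \<Longrightarrow> (gauss ^^ n) x \<notin> \<rat>"
  by (induction n) (simp_all add: gauss_irrational(1))

lemma iterate_gt_1: "x \<notin> \<rat> \<Longrightarrow> (gauss ^^ Suc n) x > 1"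
  using gauss_irrational(2)[OF iterate_irrational] by simp

lemma quotients_prod_0 [simp]: "quotients_prod 0 x = 1"
  by (simp add: quotients_prod_def)

lemma quotients_prod_Suc: "quotients_prod (Suc n) x = quotients_prod n x * gauss ((gauss ^^ n) x)"
  by (simp add: quotients_prod_def)

lemma quotients_prod_add:
  "quotients_prod (m + n) x = quotients_prod m x * quotients_prod n ((gauss ^^ m) x)"
proof (induction n)
  case (Suc n)
  have "(gauss ^^ (m + n)) x = (gauss ^^ n) ((gauss ^^ m) x)"
    by (metis add.commute comp_apply funpow_add)
  then show ?case using Suc by (simp add: quotients_prod_Suc)
qed simp

lemma quotients_prod_pos: "x \<notin> \<rat> \<Longrightarrow> quotients_prod n x > 0"
  unfolding quotients_prod_def by (intro prod_pos) (use less_trans[OF zero_less_one iterate_gt_1] in blast)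

lemma unimodular_refl: "unimodular 1 1 x x"
  unfolding unimodular_def by (rule exI[of _ 1], rule exI[of _ 0], rule exI[of _ 0], rule exI[of _ 1]) simp

lemma unimodular_trans:
  assumes "unimodular \<epsilon> l a b" "unimodular \<epsilon>' l' b c"
  shows "unimodular (\<epsilon> * \<epsilon>') (l * l') a c"
proof -
  obtain p q r t :: int where 1: "p * t - q * r = \<epsilon>" "of_int p * b + of_int q = l * a" "of_int r * b + of_int t = l"
    using assms by (auto simp: unimodular_def)
  obtain p' q' r' t' :: int where 2: "p' * t' - q' * r' = \<epsilon>'" "of_int p' * c + of_int q' = l' * b" "of_int r' * c + of_int t' = l'"
    using assms by (auto simp: unimodular_def)
  have "(p * p' + q * r') * (r * q' + t * t') - (p * q' + q * t') * (r * p' + t * r') = \<epsilon> * \<epsilon>'"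
    unfolding 1(1)[symmetric] 2(1)[symmetric] by (simp add: algebra_simps)
  moreover have "of_int (p * p' + q * r') * c + of_int (p * q' + q * t')
      = of_int p * (of_int p' * c + of_int q') + of_int q * (of_int r' * c + of_int t')"
    by (simp add: algebra_simps)
  then have "of_int (p * p' + q * r') * c + of_int (p * q' + q * t') = l' * (of_int p * b + of_int q)"
    unfolding 2 by (simp add: algebra_simps)
  moreover have "of_int (r * p' + t * r') * c + of_int (r * q' + t * t')
      = of_int r * (of_int p' * c + of_int q') + of_int t * (of_int r' * c + of_int t')"
    by (simp add: algebra_simps)
  then have "of_int (r * p' + t * r') * c + of_int (r * q' + t * t') = l' * (of_int r * b + of_int t)"
    unfolding 2 by (simp add: algebra_simps)
  ultimately show ?thesis unfolding unimodular_def 1 by (metis mult.assoc mult.commute)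
qed

text \<open>The inverse matrix is \<open>\<epsilon>\<close> times the adjugate, and the multipliers
  of a matrix and its inverse are reciprocal.\<close>

lemma unimodular_sym:
  assumes "unimodular \<epsilon> l a b" "\<epsilon> = 1 \<or> \<epsilon> = -1" "l \<noteq> 0"
  shows "unimodular \<epsilon> (1 / l) b a"
proof -
  obtain p q r t :: int where 1: "p * t - q * r = \<epsilon>" "of_int p * b + of_int q = l * a" "of_int r * b + of_int t = l"
    using assms by (auto simp: unimodular_def)
  have ee: "\<epsilon> * \<epsilon> = 1" "real_of_int \<epsilon> * of_int \<epsilon> = 1" using assms(2) by auto
  have e: "real_of_int \<epsilon> = of_int p * of_int t - of_int q * of_int r" using 1(1) by (metis of_int_diff of_int_mult)
  have "\<epsilon> * t * (\<epsilon> * p) - (- \<epsilon> * q) * (- \<epsilon> * r) = (\<epsilon> * \<epsilon>) * (p * t - q * r)"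
    by (simp add: algebra_simps)
  then have "\<epsilon> * t * (\<epsilon> * p) - (- \<epsilon> * q) * (- \<epsilon> * r) = \<epsilon>" using ee 1(1) by simp
  moreover have "l * (of_int t * a - of_int q) = of_int t * (l * a) - of_int q * l" by (simp add: algebra_simps)
  then have "l * (of_int t * a - of_int q) = of_int \<epsilon> * b"
    unfolding 1(2)[symmetric] unfolding 1(3)[symmetric] e by (simp add: algebra_simps)
  then have "of_int \<epsilon> * (l * (of_int t * a - of_int q)) = b" using ee by (simp add: mult.assoc[symmetric])
  then have "of_int (\<epsilon> * t) * a + of_int (- \<epsilon> * q) = 1 / l * b" using assms(3) by (simp add: field_simps)
  moreover have "l * (- of_int r * a + of_int p) = - of_int r * (l * a) + of_int p * l" by (simp add: algebra_simps)
  then have "l * (- of_int r * a + of_int p) = of_int \<epsilon>"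
    unfolding 1(2)[symmetric] unfolding 1(3)[symmetric] e by (simp add: algebra_simps)
  then have "of_int \<epsilon> * (l * (- of_int r * a + of_int p)) = 1" using ee by simp
  then have "of_int (- \<epsilon> * r) * a + of_int (\<epsilon> * p) = 1 / l" using assms(3) by (simp add: field_simps)
  ultimately show ?thesis unfolding unimodular_def by blast
qed

lemma unimodular_gauss:
  assumes "x \<notin> \<rat>"
  shows "unimodular (-1) (gauss x) x (gauss x)"
proof -
  have "of_int \<lfloor>x\<rfloor> * gauss x + 1 = gauss x * x"
    using gauss_irrational(3,4)[OF assms] by (metis add.commute distrib_left mult.commute nonzero_mult_div_cancel_left times_divide_eq_right mult_1_right)
  then show ?thesis unfolding unimodular_def
    by (intro exI[of _ "\<lfloor>x\<rfloor>"] exI[of _ 1] exI[of _ 0]) simp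
qed

lemma unimodular_iterate:
  assumes "x \<notin> \<rat>"
  shows "unimodular ((-1) ^ n) (quotients_prod n x) x ((gauss ^^ n) x)"
proof (induction n)
  case (Suc n)
  from unimodular_trans[OF Suc unimodular_gauss[OF iterate_irrational[OF assms]]]
  show ?case by (simp add: quotients_prod_Suc mult.commute)
qed (simp add: unimodular_refl)

lemma merging_imp_unimodular:
  assumes "merging \<epsilon> l a b" "a \<notin> \<rat>" "b \<notin> \<rat>"
  shows "unimodular \<epsilon> l a b"
proof -
  obtain m n where mn: "(gauss ^^ m) a = (gauss ^^ n) b" "\<epsilon> = (-1) ^ (m + n)" "l * quotients_prod n b = quotients_prod m a"
    using assms by (auto simp: merging_def)
  have pos: "quotients_prod n b \<noteq> 0" using quotients_prod_pos[OF assms(3), of n] by simp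
  have "(-1) ^ n = (1 :: int) \<or> (-1) ^ n = (-1 :: int)" by (cases "even n") auto
  from unimodular_trans[OF unimodular_iterate[OF assms(2), of m, unfolded mn(1)]
      unimodular_sym[OF unimodular_iterate[OF assms(3), of n] this pos]]
  have "unimodular ((-1) ^ m * (-1) ^ n) (quotients_prod m a * (1 / quotients_prod n b)) a b" .
  moreover have "quotients_prod m a * (1 / quotients_prod n b) = l" using mn(3)[symmetric] pos by simp
  ultimately show ?thesis using mn(2) by (simp add: power_add)
qed

lemma merging_refl: "merging 1 1 x x"
  unfolding merging_def by (intro exI[of _ 0]) simp

lemma merging_sym:
  assumes "merging \<epsilon> l a b" "l \<noteq> 0"
  shows "merging \<epsilon> (1 / l) b a"
proof -
  obtain m n where mn: "(gauss ^^ m) a = (gauss ^^ n) b" "\<epsilon> = (-1) ^ (m + n)" "l * quotients_prod n b = quotients_prod m a"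
    using assms by (auto simp: merging_def)
  then have "1 / l * quotients_prod m a = quotients_prod n b" using assms(2) by (simp add: field_simps)
  then show ?thesis unfolding merging_def using mn(1,2)
    by (intro exI[of _ n] exI[of _ m]) (simp add: add.commute)
qed

text \<open>The orbit that joins the orbit of \<open>b\<close> earlier is followed up to the later
  meeting point. The extra steps add \<open>n' - n\<close> to the exponent of the sign and extend
  the product accordingly.\<close>

lemma merging_trans_le:
  assumes ab: "(gauss ^^ m) a = (gauss ^^ n) b" "l * quotients_prod n b = quotients_prod m a"
    and bc: "(gauss ^^ n') b = (gauss ^^ k) c" "l' * quotients_prod k c = quotients_prod n' b"
    and le: "n \<le> n'"
  shows "merging ((-1) ^ (m + n) * (-1) ^ (n' + k)) (l * l') a c"
proof -
  obtain j where j: "n' = n + j" using le le_Suc_ex by blast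
  have it: "(gauss ^^ (i + j)) x = (gauss ^^ j) ((gauss ^^ i) x)" for i x
    by (metis add.commute comp_apply funpow_add)
  have "(gauss ^^ (m + j)) a = (gauss ^^ k) c" using ab(1) bc(1) by (simp add: it j)
  moreover have "(-1 :: int) ^ (m + n) * (-1) ^ (n' + k) = (-1) ^ (m + j + k) * ((-1) ^ n * (-1) ^ n)"
    by (simp add: j power_add mult_ac)
  then have "(-1 :: int) ^ (m + n) * (-1) ^ (n' + k) = (-1) ^ (m + j + k)"
    by (simp flip: power_add mult_2)
  moreover have "l * l' * quotients_prod k c = quotients_prod (m + j) a"
    using ab(2) bc(2) by (simp add: j quotients_prod_add ab(1) mult.assoc)
  ultimately show ?thesis unfolding merging_def by blast
qed

lemma merging_trans:
  assumes "merging \<epsilon> l a b" "merging \<epsilon>' l' b c" and l: "l \<noteq> 0" "l' \<noteq> 0"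
  shows "merging (\<epsilon> * \<epsilon>') (l * l') a c"
proof -
  obtain m n where 1: "(gauss ^^ m) a = (gauss ^^ n) b" "\<epsilon> = (-1) ^ (m + n)" "l * quotients_prod n b = quotients_prod m a"
    using assms by (auto simp: merging_def)
  obtain n' k where 2: "(gauss ^^ n') b = (gauss ^^ k) c" "\<epsilon>' = (-1) ^ (n' + k)" "l' * quotients_prod k c = quotients_prod n' b"
    using assms by (auto simp: merging_def)
  show ?thesis
  proof (cases "n \<le> n'")
    case True
    then show ?thesis using merging_trans_le[OF 1(1,3) 2(1,3)] 1(2) 2(2) by simp
  next
    case False
    have "merging ((-1) ^ (k + n') * (-1) ^ (n + m)) (1 / l' * (1 / l)) c a"
      using merging_trans_le[of k c n' b "1 / l'" n m a "1 / l"] 1 2 l False by (simp add: field_simps)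
    from merging_sym[OF this] show ?thesis using l 1(2) 2(2) by (simp add: add.commute mult.commute)
  qed
qed

lemma merging_add_1: "merging 1 1 (b + 1) b"
proof -
  have "frac (b + 1) = frac b" by (simp add: frac_def)
  then show ?thesis
    unfolding merging_def by (intro exI[of _ 1]) (simp add: gauss_def quotients_prod_def)
qed

text \<open>Whichever of \<open>b\<close> and \<open>1 / b\<close> is below 1 is taken to the other
  by a single Gauss step. Together with \<open>merging_add_1\<close> this treats the elementary
  moves into which matrices are decomposed below.\<close>

lemma merging_inverse:
  assumes "b > 0" "b \<noteq> 1"
  shows "merging (-1) b (1 / b) b"
proof (cases "b < 1")
  case True
  then have "frac b = b" using assms by (simp add: frac_eq)
  then show ?thesis
    unfolding merging_def using assms
    by (intro exI[of _ 0] exI[of _ 1]) (simp add: gauss_def quotients_prod_def)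
next
  case False
  then have "frac (1 / b) = 1 / b" using assms by (simp add: frac_eq)
  then show ?thesis
    unfolding merging_def using assms
    by (intro exI[of _ 1] exI[of _ 0]) (simp add: gauss_def quotients_prod_def)
qed


section \<open>Serret's theorem: unimodular equivalence implies merging expansions\<close>

text \<open>A termination measure for making a row nonnegative; it is zero exactly on rows that need
  no further work.\<close>

definition mixed :: "int \<Rightarrow> int \<Rightarrow> nat" where
  "mixed p q = (if p \<ge> 0 \<and> q \<ge> 0 then 0 else nat (\<bar>p\<bar> + \<bar>q\<bar>))"

text \<open>
  Moving from \<^term>\<open>b\<close> to \<^term>\<open>b - 1\<close> turns a row into a less mixed one; the rows cannot be
  negative since they take positive values.
\<close>

lemma mixed_add:
  assumes "of_int p * b + of_int q > 0" "b > (1 :: real)"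
  shows "mixed p (p + q) \<le> mixed p q" "mixed p q > 0 \<Longrightarrow> mixed p (p + q) < mixed p q"
proof -
  have "q > - p" if "p < 0"
  proof -
    have "of_int p * b \<le> of_int p * 1" using that assms(2) by (intro mult_left_mono_neg) auto
    then have "real_of_int q > of_int (- p)" using assms(1) by simp
    then show ?thesis by linarith
  qed
  moreover have "p > 0" if "q < 0" "p \<ge> 0"
  proof (rule ccontr)
    assume "\<not> p > 0"
    then have "p = 0" using that by simp
    then show False using assms(1) that by simp
  qed
  ultimately show "mixed p (p + q) \<le> mixed p q" "mixed p q > 0 \<Longrightarrow> mixed p (p + q) < mixed p q"
    unfolding mixed_def by (cases "p < 0"; cases "q < 0"; cases "p + q < 0"; simp)+
qed

lemma mixed_commute: "mixed p q = mixed q p"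
  by (auto simp: mixed_def)

text \<open>Induction on the sum of the entries. If one row dominates the other, a row subtraction
  replaces \<open>a\<close> by \<open>a - 1\<close>, after an inversion of \<open>a\<close> if the
  rows are in the wrong order. Rows of which neither dominates occur, up to determinant 1 or -1,
  only in the identity and in the exchange matrix.\<close>

lemma merging_nonneg:
  assumes "p \<ge> 0" "q \<ge> 0" "r \<ge> 0" "t \<ge> 0" "p * t - q * r = \<epsilon>" "\<epsilon> = 1 \<or> \<epsilon> = -1"
    and "b > 0" "b \<notin> \<rat>" "of_int p * b + of_int q = l * a" "of_int r * b + of_int t = l" "l > 0" "a > 0"
  shows "merging \<epsilon> l a b"
  using assms
proof (induction "nat (p + q + r + t)" arbitrary: p q r t \<epsilon> l a rule: less_induct)
  case less
  have irr: "a \<notin> \<rat>"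
  proof
    assume "a \<in> \<rat>"
    have *: "b * (of_int p - a * of_int r) = a * of_int t - of_int q"
      using less.prems(9) unfolding less.prems(10)[symmetric] by (simp add: algebra_simps)
    show False
    proof (cases "of_int p - a * of_int r = 0")
      case False
      then have "b = (a * of_int t - of_int q) / (of_int p - a * of_int r)"
        using * by (simp add: field_simps)
      also have "\<dots> \<in> \<rat>" using \<open>a \<in> \<rat>\<close> by (intro Rats_divide Rats_diff Rats_mult Rats_of_int)
      finally show False using less.prems(8) by simp
    next
      case True
      then have "of_int p = a * of_int r" "of_int q = a * of_int t" using * by simp_all
      then have "real_of_int (p * t - q * r) = 0" by simp
      then show False using less.prems(5,6) by linarith
    qed
  qed
  define N where "N = p + q + r + t"
  have IH: "merging \<epsilon>' l' a' b"
    if "p' \<ge> 0" "q' \<ge> 0" "r' \<ge> 0" "t' \<ge> 0" "p' * t' - q' * r' = \<epsilon>'" "\<epsilon>' = 1 \<or> \<epsilon>' = -1"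
      "of_int p' * b + of_int q' = l' * a'" "of_int r' * b + of_int t' = l'" "l' > 0" "a' > 0"
      "p' + q' + r' + t' < N" for p' q' r' t' \<epsilon>' l' a'
    using less.hyps[of p' q' r' t'] that less.prems(7,8) by (simp add: N_def)
  \<comment> \<open>Subtracting the lower row from the upper one keeps determinant and multiplier.
    The difference is a nonzero nonnegative row because the determinant is not 0, so
    \<open>a' - 1\<close> is again positive.\<close>
  have dominate: "merging \<epsilon>' l' a' b"
    if le: "p' \<ge> r'" "q' \<ge> t'" and H: "r' \<ge> 0" "t' \<ge> 0" "p' * t' - q' * r' = \<epsilon>'" "\<epsilon>' = 1 \<or> \<epsilon>' = -1"
      "of_int p' * b + of_int q' = l' * a'" "of_int r' * b + of_int t' = l'" "l' > 0"
      "p' + q' + r' + t' = N" for p' q' r' t' \<epsilon>' l' a'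
  proof -
    have eq: "of_int (p' - r') * b + of_int (q' - t') = l' * (a' - 1)"
      using H(5,6) by (simp add: algebra_simps)
    have nz: "p' - r' \<noteq> 0 \<or> q' - t' \<noteq> 0" using H(3,4) by auto
    have "of_int (p' - r') * b + of_int (q' - t') > 0"
      using nz le less.prems(7) by (cases "p' = r'") (auto intro: add_pos_nonneg)
    then have pos: "a' - 1 > 0" using H(7) unfolding eq by (simp add: zero_less_mult_iff)
    have "r' \<noteq> 0 \<or> t' \<noteq> 0" using H(6,7) by auto
    then have "r' + t' > 0" using H(1,2) by linarith
    then have "merging \<epsilon>' l' (a' - 1) b"
      using IH[OF _ _ H(1,2) _ H(4) eq H(6,7) pos] le H(1-3,8) by (simp add: algebra_simps)
    then show ?thesis
      using merging_trans[OF merging_add_1[of "a' - 1"], of \<epsilon>' l' b] H(7) by simp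
  qed
  \<comment> \<open>If neither row dominates, one diagonal strictly exceeds the other and the
    determinant is at least their smaller sum plus 1 in absolute value, which forces the smaller
    entries to be 0.\<close>
  have prod: "(x + 1) * (y + 1) \<le> x' * y'" if "x' \<ge> x + 1" "y' \<ge> y + 1" "x \<ge> 0" "y \<ge> 0" for x y x' y' :: int
    using that by (intro mult_mono) auto
  consider "p \<ge> r" "q \<ge> t" | "r \<ge> p" "t \<ge> q" | "p \<ge> r + 1" "t \<ge> q + 1" | "r \<ge> p + 1" "q \<ge> t + 1"
    by linarith
  then show ?case
  proof cases
    case 1
    then show ?thesis using dominate[of r p t q \<epsilon> l a] less.prems by (simp add: N_def)
  next
    case 2
    have "l * a > 0" using less.prems(11,12) by simp
    then have "merging (- \<epsilon>) (l * a) (1 / a) b"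
      using dominate[of p r q t "- \<epsilon>" "l * a" "1 / a"] 2 less.prems by (auto simp: N_def algebra_simps)
    moreover have "merging (-1) (1 / a) a (1 / a)"
    proof -
      have "a \<noteq> 1" using irr Rats_1 by metis
      then show ?thesis using merging_sym[OF merging_inverse[of a]] less.prems(12) by simp
    qed
    ultimately show ?thesis
      using merging_trans[of "-1" "1 / a" a "1 / a" "- \<epsilon>" "l * a" b] less.prems(11,12) by simp
  next
    case 3
    then have "p * t \<ge> (r + 1) * (q + 1)" using prod[of r p q t] less.prems(2,3) by simp
    then have "r + q + 1 \<le> \<epsilon>" using less.prems(5) by (simp add: algebra_simps)
    then have rq: "r = 0" "q = 0" "\<epsilon> = 1" using less.prems(2,3,6) by auto
    then have "p = 1" "t = 1" using less.prems(1,4,5) zmult_eq_1_iff[of p t] by auto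
    then show ?thesis using rq less.prems(9,10) merging_refl by simp
  next
    case 4
    then have "r * q \<ge> (p + 1) * (t + 1)" using prod[of p r t q] less.prems(1,4) by simp
    then have "p + t + 1 \<le> - \<epsilon>" using less.prems(5) by (simp add: algebra_simps)
    then have pt: "p = 0" "t = 0" "\<epsilon> = -1" using less.prems(1,4,6) by auto
    then have "r = 1" "q = 1" using less.prems(2,3,5) zmult_eq_1_iff[of q r] by auto
    then have "l = b" "a = 1 / b" using pt less.prems(7,9,10) by (auto simp: field_simps)
    moreover have "b \<noteq> 1" using less.prems(8) by auto
    ultimately show ?thesis using pt merging_inverse[of b] less.prems(7) by simp
  qed
qed

text \<open>Here \<open>a\<close> is fixed and \<open>b\<close> moves: passing to
  \<open>b - 1\<close> is a column addition, since p b + q = p (b - 1) + (p + q). Such moves shrink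
  the measure \<open>mixed\<close> until both rows are nonnegative and \<open>merging_nonneg\<close>
  applies.\<close>

lemma unimodular_imp_merging:
  assumes "unimodular \<epsilon> l a b" "\<epsilon> = 1 \<or> \<epsilon> = -1" "a > 0" "b > 0" "l > 0" "b \<notin> \<rat>"
  shows "merging \<epsilon> l a b"
proof -
  have "merging \<epsilon> l a b"
    if "p * t - q * r = \<epsilon>" "\<epsilon> = 1 \<or> \<epsilon> = -1" "of_int p * b + of_int q = l * a" "of_int r * b + of_int t = l"
      "b > 0" "b \<notin> \<rat>" "l > 0" for p q r t \<epsilon> l b
    using that
  proof (induction "mixed p q + mixed r t" arbitrary: p q r t \<epsilon> l b rule: less_induct)
    case less
    have la: "l * a > 0" using less.prems(7) assms(3) by simp
    have shrink: "mixed p' (p' + q') + mixed r' (r' + t') < mixed p' q' + mixed r' t'"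
      if "mixed p' q' + mixed r' t' > 0" "c > 1" "of_int p' * c + of_int q' > 0" "of_int r' * c + of_int t' > 0"
      for p' q' r' t' and c :: real
      using mixed_add[OF that(3,2)] mixed_add[OF that(4,2)] that(1) by fastforce
    show ?case
    proof (cases "mixed p q + mixed r t = 0")
      case True
      have nonneg: "x \<ge> 0 \<and> y \<ge> 0" if "mixed x y = 0" for x y
        using that by (auto simp: mixed_def split: if_splits)
      show ?thesis
        using merging_nonneg[of p q r t \<epsilon> b l a] nonneg[of p q] nonneg[of r t] True less.prems assms(3)
        by simp
    next
      case False
      have "b \<noteq> 1" using less.prems(6) by auto
      show ?thesis
      proof (cases "b > 1")
        case True
        have "mixed p (p + q) + mixed r (r + t) < mixed p q + mixed r t"
          using shrink[of p q r t b] False True less.prems(3,4,7) la by simp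
        moreover have "b - 1 \<notin> \<rat>" using less.prems(6) Rats_add[of "b - 1" 1] by auto
        ultimately have "merging \<epsilon> l a (b - 1)"
          using less.hyps[of p "p + q" r "r + t" \<epsilon> "b - 1" l] less.prems True by (simp add: algebra_simps)
        moreover have "merging 1 1 (b - 1) b" using merging_sym[OF merging_add_1[of "b - 1"]] by simp
        ultimately show ?thesis using merging_trans[of \<epsilon> l a "b - 1" 1 1 b] less.prems(7) by simp
      next
        case False': False
        \<comment> \<open>Below 1 the columns are exchanged first, which negates the determinant and
          divides the multiplier by \<open>b\<close>; then 1 is subtracted from
          \<open>1 / b\<close>.\<close>
        then have b1: "1 / b > 1" using \<open>b \<noteq> 1\<close> less.prems(5) by simp
        have e1: "of_int q * (1 / b) + of_int p = l * (1 / b) * a" "of_int t * (1 / b) + of_int r = l * (1 / b)"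
          using less.prems(3,4,5) by (simp_all add: field_simps)
        have lb: "l * (1 / b) > 0" using less.prems(5,7) by simp
        have "mixed q (q + p) + mixed t (t + r) < mixed q p + mixed t r"
        proof (rule shrink[OF _ b1])
          show "mixed q p + mixed t r > 0" using False by (simp add: mixed_commute)
          show "of_int q * (1 / b) + of_int p > 0" unfolding e1 by (rule mult_pos_pos[OF lb assms(3)])
          show "of_int t * (1 / b) + of_int r > 0" unfolding e1 by (rule lb)
        qed
        then have "mixed q (q + p) + mixed t (t + r) < mixed p q + mixed r t" by (simp add: mixed_commute)
        moreover have "1 / b - 1 \<notin> \<rat>"
          using less.prems(6) Rats_add[of "1 / b - 1" 1] Rats_divide[of 1 "1 / b"] by auto
        ultimately have "merging (- \<epsilon>) (l * (1 / b)) a (1 / b - 1)"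
          using less.hyps[of q "q + p" t "t + r" "- \<epsilon>" "1 / b - 1" "l * (1 / b)"] less.prems(1,2) e1 lb b1
          by (auto simp: algebra_simps)
        moreover have "merging 1 1 (1 / b - 1) (1 / b)" using merging_sym[OF merging_add_1[of "1 / b - 1"]] by simp
        ultimately have "merging (- \<epsilon>) (l * (1 / b)) a (1 / b)"
          using merging_trans[of "- \<epsilon>" "l * (1 / b)" a "1 / b - 1" 1 1 "1 / b"] less.prems(5,7) by simp
        from merging_trans[OF this merging_inverse[of b]] show ?thesis
          using lb less.prems(5,7) \<open>b \<noteq> 1\<close> by simp
      qed
    qed
  qed
  then show ?thesis using assms unfolding unimodular_def by blast
qed

section \<open>The packings of the theorem\<close>

definition packing_vectors :: "real \<Rightarrow> lvec set" where
  "packing_vectors \<alpha> = \<Union>{S. orbit (base_quad \<alpha> 0 1 (2 / \<alpha>)) S}"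

lemma quad_base_quad_alpha: "\<alpha> > 0 \<Longrightarrow> quad (base_quad \<alpha> 0 1 (2 / \<alpha>))"
  by (intro quad_base_quad) simp

lemma base_quad_packing_vectors: "base_quad \<alpha> 0 1 (2 / \<alpha>) \<subseteq> packing_vectors \<alpha>"
  unfolding packing_vectors_def by (intro Union_upper CollectI orbit_refl)

lemma packing_vectors_mem:
  "base_line \<in> packing_vectors \<alpha>" "nu \<alpha> 0 \<in> packing_vectors \<alpha>" "nu 1 (2 / \<alpha>) \<in> packing_vectors \<alpha>"
  using base_quad_packing_vectors[of \<alpha>] by (simp_all add: base_quad_def)

lemma apollonian_packing_vectors: "\<alpha> > 0 \<Longrightarrow> apollonian_vectors (packing_vectors \<alpha>)"
  unfolding packing_vectors_def by (intro orbit_apollonian_vectors quad_base_quad_alpha)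

lemma based_packing_vectors: "\<alpha> > 0 \<Longrightarrow> based_apollonian (packing_vectors \<alpha>) \<alpha> 0 1 (2 / \<alpha>)"
  using apollonian_packing_vectors packing_vectors_mem by unfold_locales simp_all

lemma lor_base: "\<alpha> > 0 \<Longrightarrow> lor (nu \<alpha> 0) (nu 1 (2 / \<alpha>)) = -1"
  by (simp add: lor_nu)

lemma apollonian_locale_packing_vectors: 
  assumes "\<alpha> > 0"
  shows "apollonian (packing_vectors \<alpha>)"
proof
  show "apollonian_vectors (packing_vectors \<alpha>)" using assms by (rule apollonian_packing_vectors)
  have "(nu \<alpha> 0 + base_line) $ 1 = \<alpha>\<^sup>2" "(nu \<alpha> 0 + base_line) $ 4 = 0"
    by (simp_all add: nu_def base_line_def)
  moreover from this have "nu \<alpha> 0 + base_line \<noteq> 0" using assms by (metis less_irrefl zero_index zero_less_power)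
  ultimately have "touching (nu \<alpha> 0) base_line" by (simp add: touching_def future_def)
  then show "\<exists>e\<in>packing_vectors \<alpha>. \<exists>f\<in>packing_vectors \<alpha>. touching e f"
    using packing_vectors_mem by blast
qed

lemma packing_eq:
  assumes "\<alpha> > 0"
  shows "packing \<alpha> = circ_of ` packing_vectors \<alpha>"
proof -
  interpret apollonian "packing_vectors \<alpha>" using assms by (rule apollonian_locale_packing_vectors)
  define I where "I = {nu \<alpha> 0, nu 1 (2 / \<alpha>), base_line}"
  have "nu \<alpha> 0 \<noteq> nu 1 (2 / \<alpha>)" using lor_base[OF assms] by force
  then have card: "card I = 3" using nu_neq_base_line by (simp add: I_def)
  have sub: "I \<subseteq> packing_vectors \<alpha>" using packing_vectors_mem by (simp add: I_def)
  have "lor u v = -1" if "u \<in> I" "v \<in> I" "u \<noteq> v" for u v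
    using that lor_base[OF assms] by (auto simp: I_def lor_commute)
  from generated_eq[OF card sub this] show ?thesis
    using assms by (simp add: packing_def I_def circ_X_eq circ_Y_eq circ_L_eq)
qed

lemma irrational_coeffs:
  assumes "\<alpha> \<notin> \<rat>" "of_int p * \<alpha> + of_int q = (0 :: real)"
  shows "p = 0" "q = 0"
proof -
  show "p = 0"
  proof (rule ccontr)
    assume "p \<noteq> 0"
    then have "\<alpha> = of_int (- q) / of_int p" using assms(2) by (simp add: field_simps)
    also have "\<dots> \<in> \<rat>" by (intro Rats_divide Rats_of_int)
    finally show False using assms(1) by simp
  qed
  then show "q = 0" using assms(2) by simp
qed

text \<open>For another line, the separation from the axis and the unit length of the normal force
  tangency to the axis. So it is a lattice vector with first coordinate 0, an integer relation
  between \<open>\<alpha>\<close> and 1.\<close>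

lemma irrational_only_line:
  assumes \<alpha>: "\<alpha> > 0" "\<alpha> \<notin> \<rat>" and u: "u \<in> packing_vectors \<alpha>" "u $ 1 = 0"
  shows "u = base_line"
proof (rule ccontr)
  assume ne: "u \<noteq> base_line"
  interpret based_apollonian "packing_vectors \<alpha>" \<alpha> 0 1 "2 / \<alpha>" using \<alpha>(1) by (rule based_packing_vectors)
  have "lor u base_line \<le> -1" using apollonian_vectorsD(2)[OF vectors u(1) base(1) ne] .
  then have "u $ 3 \<ge> 1" by (simp add: lor_def base_line_def)
  moreover have "(u $ 2)\<^sup>2 + (u $ 3)\<^sup>2 = 1"
    using sum_sq_unit[OF apollonian_vectorsD(1)[OF vectors u(1)]] u(2) by simp
  then have "(u $ 3)\<^sup>2 \<le> 1" by (smt (verit) zero_le_power2)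
  then have "u $ 3 \<le> 1" using power2_le_imp_le[of "u $ 3" 1] by simp
  ultimately have "lor u base_line = -1" by (simp add: lor_def base_line_def)
  then obtain p q p' q' where pq: "\<bar>p * q' - q * p'\<bar> = 1" "u = lat p q"
    using single_tangent_base_line_lat[OF u(1)] by metis
  have "of_int p * \<alpha> + of_int q = 0" using u(2) unfolding pq(2) lat_def by (simp add: nu_def)
  then have "p = 0" "q = 0" using irrational_coeffs[OF \<alpha>(2)] by blast+
  then show False using pq(1) by simp
qed

text \<open>For \<open>\<alpha>\<close> = m / n in lowest terms the lattice vector with coefficients
  (n, -m) has first coordinate 0, and Bezout's identity completes it to a unimodular pair.\<close>

lemma rational_second_line:
  assumes "\<alpha> > 0" "\<alpha> \<in> \<rat>"
  obtains t where "nu 0 t \<in> packing_vectors \<alpha>"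
proof -
  interpret based_apollonian "packing_vectors \<alpha>" \<alpha> 0 1 "2 / \<alpha>" using assms(1) by (rule based_packing_vectors)
  obtain m n :: int where mn: "\<alpha> = of_int m / of_int n" "n > 0" "coprime m n"
    using assms(2) by (rule Rats_cases')
  obtain a b where "a * n + b * m = gcd n m" using bezout_int by blast
  then have "a * n + b * m = 1" using mn(3) by (simp add: coprime_iff_gcd_eq_1 gcd.commute)
  then have "\<bar>n * a - (- m) * b\<bar> = 1" by (simp add: algebra_simps)
  then have "lat n (- m) \<in> packing_vectors \<alpha>" using lat_mem by blast
  moreover have "of_int n * \<alpha> + of_int (- m) = 0" using mn(1,2) by simp
  ultimately show thesis using that unfolding lat_def by simp
qed

lemma sim_vec_base_line:
  assumes "A $ 1 $ 2 = 0" "A $ 2 $ 2 = 1" "b $ 2 = 0"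
  shows "sim_vec \<mu> A b base_line = base_line"
  using assms by (simp add: sim_vec_def base_line_def vec_eq_iff forall_4)

text \<open>A similarity that preserves the axis and its lower side acts linearly on the parameters
  (s, t), with determinant \<open>e\<close>, which is 1 or -1.\<close>

lemma sim_vec_nu:
  assumes "A $ 1 $ 1 = e" "A $ 1 $ 2 = 0" "A $ 2 $ 1 = 0" "A $ 2 $ 2 = 1" "b $ 2 = 0" "\<mu> > 0" "e\<^sup>2 = 1"
  shows "sim_vec \<mu> A b (nu s t) = nu (s / sqrt \<mu>) (e * t * sqrt \<mu> + s * b $ 1 / sqrt \<mu>)"
proof -
  define m where "m = sqrt \<mu>"
  have m: "m > 0" "\<mu> = m * m" using assms(6) by (simp_all add: m_def)
  have ee: "e * e = 1" using assms(7) by (simp add: power2_eq_square)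
  have "(e * t * m + s * b $ 1 / m)\<^sup>2 = (e * e) * t\<^sup>2 * (m * m) + 2 * e * s * t * b $ 1 + s\<^sup>2 * (b $ 1)\<^sup>2 / (m * m)"
    using m(1) by (simp add: power2_eq_square field_simps)
  moreover have "s / m * (e * t * m + s * b $ 1 / m) = e * s * t + s\<^sup>2 * b $ 1 / (m * m)"
    using m(1) by (simp add: power2_eq_square field_simps)
  moreover have "(s / m)\<^sup>2 = s\<^sup>2 / (m * m)" by (simp add: power2_eq_square)
  ultimately show ?thesis
    using assms(1-5) ee m(1) unfolding m_def[symmetric] m(2)
    by (simp add: sim_vec_def Let_def nu_def vec_eq_iff forall_4)
qed

text \<open>The ratio \<open>1 / s'\<^sup>2\<close> turns curvature 1 into that of the second
  circle, the translation by \<open>t / s\<close> moves the first point of contact from the origin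
  into place, and the sign of the determinant decides whether to reflect in a vertical line.\<close>

lemma standard_map:
  assumes s: "s > 0" "s' > 0" and e: "e = 1 \<or> e = -1" and det: "s * t' - s' * t = 2 * e"
  obtains A b where "orthogonal_matrix A" "det A = e"
    "sim_vec (1 / s'\<^sup>2) A b base_line = base_line" "sim_vec (1 / s'\<^sup>2) A b (nu (s / s') 0) = nu s t"
    "sim_vec (1 / s'\<^sup>2) A b (nu 1 (2 / (s / s'))) = nu s' t'"
proof -
  define A :: "real^2^2" where "A = vector [vector [e, 0], vector [0, 1]]"
  define b :: "real^2" where "b = vector [t / s, 0]"
  have A: "A $ 1 $ 1 = e" "A $ 1 $ 2 = 0" "A $ 2 $ 1 = 0" "A $ 2 $ 2 = 1" by (simp_all add: A_def)
  have b: "b $ 1 = t / s" "b $ 2 = 0" by (simp_all add: b_def)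
  have ee: "e\<^sup>2 = 1" using e by auto
  have \<mu>: "1 / s'\<^sup>2 > 0" "sqrt (1 / s'\<^sup>2) = 1 / s'" using s by (simp_all add: real_sqrt_divide)
  have t': "t' = (2 * e + s' * t) / s" using det s by (simp add: field_simps)
  show thesis
  proof
    show "orthogonal_matrix A" using A ee by (intro orthogonal_matrix_2I) simp_all
    show "det A = e" using A by (simp add: det_2)
    show "sim_vec (1 / s'\<^sup>2) A b base_line = base_line" using A b by (intro sim_vec_base_line)
    show "sim_vec (1 / s'\<^sup>2) A b (nu (s / s') 0) = nu s t"
      unfolding sim_vec_nu[OF A b(2) \<mu>(1) ee] \<mu>(2) b(1) using s by simp
    show "sim_vec (1 / s'\<^sup>2) A b (nu 1 (2 / (s / s'))) = nu s' t'"
      unfolding sim_vec_nu[OF A b(2) \<mu>(1) ee] \<mu>(2) b(1) t' using s by (simp add: field_simps)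
  qed
qed

section \<open>Similar packings and unimodular equivalence of the parameters\<close>

text \<open>The rows of the matrix are coefficients of two tangent circles of the second packing
  resting on the axis, whose parameters \<open>s\<close> have ratio \<open>\<alpha>\<close>. The
  initial triple of the first packing is similar to these two with the axis, and three tangent
  circles determine the packing.\<close>

lemma unimodular_imp_similar:
  assumes u: "unimodular \<epsilon> l \<alpha> \<beta>" "\<epsilon> = 1 \<or> \<epsilon> = -1" and pos: "\<alpha> > 0" "\<beta> > 0" "l > 0"
  obtains A b where "orthogonal_matrix A" "det A = of_int \<epsilon>"
    "act (similarity_map (1 / l\<^sup>2) A b) (packing \<alpha>) = packing \<beta>"
proof -
  interpret based_apollonian "packing_vectors \<beta>" \<beta> 0 1 "2 / \<beta>" using pos(2) by (rule based_packing_vectors)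
  obtain p q r t :: int where m: "p * t - q * r = \<epsilon>" "of_int p * \<beta> + of_int q = l * \<alpha>" "of_int r * \<beta> + of_int t = l"
    using u by (auto simp: unimodular_def)
  have "\<bar>p * t - q * r\<bar> = 1" using m(1) u(2) by auto
  from lat_mem[OF this] have mem: "nu (l * \<alpha>) (of_int q * (2 / \<beta>)) \<in> packing_vectors \<beta>"
    "nu l (of_int t * (2 / \<beta>)) \<in> packing_vectors \<beta>"
    using m(2,3) by (simp_all add: lat_def)
  have "l * \<alpha> * (of_int t * (2 / \<beta>)) - l * (of_int q * (2 / \<beta>)) = 2 * of_int \<epsilon>"
    unfolding m(1)[symmetric] m(2)[symmetric] unfolding m(3)[symmetric] using pos(2) by (simp add: field_simps)
  moreover have "l * \<alpha> > 0" "real_of_int \<epsilon> = 1 \<or> real_of_int \<epsilon> = -1" using pos u(2) by auto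
  ultimately obtain A b where A: "orthogonal_matrix A" "det A = of_int \<epsilon>"
    and g: "sim_vec (1 / l\<^sup>2) A b base_line = base_line"
      "sim_vec (1 / l\<^sup>2) A b (nu (l * \<alpha> / l) 0) = nu (l * \<alpha>) (of_int q * (2 / \<beta>))"
      "sim_vec (1 / l\<^sup>2) A b (nu 1 (2 / (l * \<alpha> / l))) = nu l (of_int t * (2 / \<beta>))"
    using standard_map[of "l * \<alpha>" l "of_int \<epsilon>" "of_int t * (2 / \<beta>)" "of_int q * (2 / \<beta>)"] pos(3) by metis
  define g where "g = sim_vec (1 / l\<^sup>2) A b"
  have \<mu>: "1 / l\<^sup>2 > 0" using pos(3) by simp
  have la: "l * \<alpha> / l = \<alpha>" using pos(3) by simp
  have iso: "lor (g u) (g v) = lor u v" for u v unfolding g_def by (rule lor_sim_vec[OF A(1) \<mu>])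
  have W: "apollonian_vectors (g ` packing_vectors \<alpha>)"
    using isometry_apollonian_vectors[OF linear_sim_vec lor_sim_vec[OF A(1) \<mu>] apollonian_packing_vectors[OF pos(1)]]
    unfolding g_def .
  have im: "base_line \<in> g ` packing_vectors \<alpha>" "g (nu \<alpha> 0) \<in> g ` packing_vectors \<alpha>"
    "g (nu 1 (2 / \<alpha>)) \<in> g ` packing_vectors \<alpha>"
    using packing_vectors_mem[of \<alpha>] g(1) unfolding g_def by (metis imageI)+
  have im': "g (nu \<alpha> 0) \<in> packing_vectors \<beta>" "g (nu 1 (2 / \<alpha>)) \<in> packing_vectors \<beta>"
    using g(2,3) mem unfolding g_def la by simp_all
  have "lor base_line (g (nu \<alpha> 0)) = -1" "lor base_line (g (nu 1 (2 / \<alpha>))) = -1"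
    using iso[of base_line] g(1) by (simp_all add: g_def)
  moreover have "lor (g (nu \<alpha> 0)) (g (nu 1 (2 / \<alpha>))) = -1" using iso lor_base[OF pos(1)] by simp
  ultimately have "g ` packing_vectors \<alpha> = packing_vectors \<beta>"
    using apollonian_vectors_unique_triple[OF W vectors im base(1) im'] by blast
  then have "act (similarity_map (1 / l\<^sup>2) A b) (packing \<alpha>) = packing \<beta>"
    unfolding packing_eq[OF pos(1)] packing_eq[OF pos(2)] act_circ_of[OF A(1) \<mu>] g_def by simp
  then show thesis using that A by blast
qed

lemma act_packing_vectors:
  assumes "orthogonal_matrix A" "\<mu> > 0" "\<alpha> > 0" "\<beta> > 0"
    and act: "act (similarity_map \<mu> A b) (packing \<alpha>) = packing \<beta>"
  shows "sim_vec \<mu> A b ` packing_vectors \<alpha> = packing_vectors \<beta>"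
proof -
  have "circ_of ` (sim_vec \<mu> A b ` packing_vectors \<alpha>) = circ_of ` packing_vectors \<beta>"
    using act unfolding packing_eq[OF assms(3)] packing_eq[OF assms(4)] act_circ_of[OF assms(1,2)] .
  moreover have "inj_on circ_of {u. lor u u = 1}" using circ_of_inj by (auto simp: inj_on_def)
  moreover have "sim_vec \<mu> A b ` packing_vectors \<alpha> \<subseteq> {u. lor u u = 1}"
    using apollonian_vectorsD(1)[OF apollonian_packing_vectors[OF assms(3)]] lor_sim_vec[OF assms(1,2)] by auto
  moreover have "packing_vectors \<beta> \<subseteq> {u. lor u u = 1}"
    using apollonian_vectorsD(1)[OF apollonian_packing_vectors[OF assms(4)]] by auto
  ultimately show ?thesis by (simp add: inj_on_image_eq_iff)
qed

text \<open>The axis is mapped to the only line of the target, that is to itself, so the two initial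
  circles go to tangent lattice circles; their coefficients form the matrix.\<close>

lemma similar_imp_unimodular:
  assumes pos: "\<alpha> > 0" "\<beta> > 0" and irr: "\<beta> \<notin> \<rat>" and A: "orthogonal_matrix A" and \<mu>: "\<mu> > 0"
    and act: "act (similarity_map \<mu> A b) (packing \<alpha>) = packing \<beta>"
  obtains \<epsilon> where "det A = of_int \<epsilon>" "unimodular \<epsilon> (1 / sqrt \<mu>) \<alpha> \<beta>"
    "\<alpha> = \<beta> \<Longrightarrow> \<mu> = 1 \<Longrightarrow> similarity_map \<mu> A b = id"
proof -
  interpret based_apollonian "packing_vectors \<beta>" \<beta> 0 1 "2 / \<beta>" using pos(2) by (rule based_packing_vectors)
  define g where "g = sim_vec \<mu> A b"
  have gV: "g ` packing_vectors \<alpha> = packing_vectors \<beta>"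
    unfolding g_def by (rule act_packing_vectors[OF A \<mu> pos act])
  have iso: "lor (g u) (g v) = lor u v" for u v unfolding g_def by (rule lor_sim_vec[OF A \<mu>])
  have mem: "g base_line \<in> packing_vectors \<beta>" "g (nu \<alpha> 0) \<in> packing_vectors \<beta>" "g (nu 1 (2 / \<alpha>)) \<in> packing_vectors \<beta>"
    using packing_vectors_mem[of \<alpha>] gV by blast+
  have "(g base_line) $ 1 = 0" by (simp add: g_def sim_vec_def base_line_def)
  then have gL: "g base_line = base_line" using irrational_only_line[OF pos(2) irr mem(1)] by simp
  have A2: "A $ 1 $ 2 = 0" "A $ 2 $ 2 = 1" and b2: "b $ 2 = 0"
    using arg_cong[OF gL, of "\<lambda>u. u $ 2"] arg_cong[OF gL, of "\<lambda>u. u $ 3"] arg_cong[OF gL, of "\<lambda>u. u $ 4"]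
    by (simp_all add: g_def sim_vec_def base_line_def)
  define e where "e = A $ 1 $ 1"
  note o = orthogonal_matrix_2[OF A]
  have A1: "A $ 2 $ 1 = 0" using o(3) A2 by simp
  then have ee: "e\<^sup>2 = 1" using o(1) by (simp add: e_def)
  have A11: "A $ 1 $ 1 = e" by (simp add: e_def)
  have detA: "det A = e" using A2 A1 by (simp add: det_2 e_def)
  define m where "m = sqrt \<mu>"
  have m: "m > 0" using \<mu> by (simp add: m_def)
  have gnu: "g (nu s t) = nu (s / m) (e * t * m + s * b $ 1 / m)" for s t
    unfolding g_def m_def by (rule sim_vec_nu[OF A11 A2(1) A1 A2(2) b2 \<mu> ee])
  have tL: "lor (g (nu s t)) base_line = -1" for s t unfolding gnu by simp
  have tt: "lor (g (nu \<alpha> 0)) (g (nu 1 (2 / \<alpha>))) = -1" using iso lor_base[OF pos(1)] by simp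
  obtain p0 q0 r0 t0 where d: "g (nu \<alpha> 0) = lat p0 q0" "g (nu 1 (2 / \<alpha>)) = lat r0 t0"
    using tangent_base_line_lat[OF mem(2) tL mem(3) tL tt] by metis
  \<comment> \<open>A vector determines its parameters only up to a common sign, so the lattice
    coefficients may have to be negated to match the parameters given by \<open>gnu\<close>.\<close>
  have lift: "\<exists>p q. x = of_int p * \<beta> + of_int q \<and> y = of_int q * (2 / \<beta>)"
    if "nu x y = lat i j" for x y i j
  proof -
    have "(x = of_int i * \<beta> + of_int j \<and> y = of_int j * (2 / \<beta>)) \<or>
      (x = of_int (- i) * \<beta> + of_int (- j) \<and> y = of_int (- j) * (2 / \<beta>))"
      using that unfolding lat_def nu_eq_iff by auto
    then show ?thesis by blast
  qed
  obtain p q where pq: "\<alpha> / m = of_int p * \<beta> + of_int q" "\<alpha> * b $ 1 / m = of_int q * (2 / \<beta>)"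
    using lift[of "\<alpha> / m" "\<alpha> * b $ 1 / m" p0 q0] d(1) gnu[of \<alpha> 0] by auto
  obtain r t where rt: "1 / m = of_int r * \<beta> + of_int t" "e * (2 / \<alpha>) * m + b $ 1 / m = of_int t * (2 / \<beta>)"
    using lift[of "1 / m" "e * (2 / \<alpha>) * m + b $ 1 / m" r0 t0] d(2) gnu[of 1 "2 / \<alpha>"] by auto
  \<comment> \<open>The determinant of the image parameters, evaluated once through the map and once
    through the lattice, identifies \<open>det A\<close> with that of the integer matrix.\<close>
  have "2 * e = \<alpha> / m * (e * (2 / \<alpha>) * m + b $ 1 / m) - 1 / m * (\<alpha> * b $ 1 / m)"
    using pos(1) m by (simp add: field_simps)
  also have "\<dots> = 2 * of_int (p * t - q * r)"
    unfolding pq rt using pos(2) by (simp add: field_simps)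
  finally have det: "e = of_int (p * t - q * r)" by simp
  have "of_int p * \<beta> + of_int q = 1 / m * \<alpha>" "of_int r * \<beta> + of_int t = 1 / m"
    by (simp add: pq(1)[symmetric], simp add: rt(1)[symmetric])
  then have uni: "unimodular (p * t - q * r) (1 / m) \<alpha> \<beta>" unfolding unimodular_def by blast
  \<comment> \<open>With ratio 1 both rows become integer relations between 1 and the irrational
    \<open>\<beta>\<close>, so the matrix is the identity, and then so is the map.\<close>
  have "similarity_map \<mu> A b = id" if "\<alpha> = \<beta>" "\<mu> = 1"
  proof -
    have m1: "m = 1" using that by (simp add: m_def)
    have "of_int r * \<beta> + of_int (t - 1) = 0" "of_int (p - 1) * \<beta> + of_int q = 0"
      using rt(1) pq(1) that(1) m1 by (simp_all add: algebra_simps)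
    then have i: "r = 0" "t = 1" "p = 1" "q = 0"
      using irrational_coeffs[OF irr] by (metis eq_iff_diff_eq_0)+
    then have "e = 1" "b $ 1 = 0" using det pq(2) pos(1) m1 by simp_all
    then have "A = mat 1" "b = 0" using A11 A1 A2 b2 by (simp_all add: vec_eq_iff forall_2 mat_def)
    then show ?thesis using that(2) by (simp add: similarity_map_def fun_eq_iff)
  qed
  then show thesis using that[of "p * t - q * r"] det detA uni unfolding m_def by simp
qed

text \<open>The line is completed to a tangent quadruple. A rigid motion brings the axis to the
  line, two further members pull back to circles resting on the axis, and
  \<open>standard_map\<close> normalises them; uniqueness from a triple then identifies the whole
  packings.\<close>

lemma half_plane_packing_normal_form:
  assumes P: "half_plane_packing P" "\<not> strip_packing P"
  obtains \<alpha> \<Phi> where "\<alpha> > 0" "\<alpha> \<notin> \<rat>" "is_similarity \<Phi>" "P = act \<Phi> (packing \<alpha>)"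
proof -
  define V where "V = vectors_of P"
  have V: "apollonian_vectors V" unfolding V_def by (rule half_plane_packing_vectors(1)[OF P])
  obtain l where l: "l \<in> V" "l $ 1 = 0" "\<And>u. u \<in> V \<Longrightarrow> u \<noteq> l \<Longrightarrow> u $ 1 > 0"
    unfolding V_def by (rule half_plane_packing_line[OF P]) blast
  have ll: "lor l l = 1" using apollonian_vectorsD(1)[OF V l(1)] .
  then have l23: "(l $ 2)\<^sup>2 + (l $ 3)\<^sup>2 = 1" using sum_sq_unit l(2) by simp
  have "\<exists>S. quad S \<and> S \<subseteq> V \<and> {l} \<subseteq> S"
    by (rule apollonian_vectors_extend[OF V]) (use l(1) in auto)
  then obtain S where S: "quad S" "S \<subseteq> V" "l \<in> S" by auto
  have "card (S - {l}) = 3" using S quad_finite[OF S(1)] by (simp add: quad_def)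
  then obtain x y z where xyz: "S - {l} = {x, y, z}" "x \<noteq> y" "y \<noteq> z" "x \<noteq> z" using card_3_iff by metis
  then have xy: "x \<in> S" "y \<in> S" "x \<noteq> l" "y \<noteq> l" by blast+
  have lors: "lor x y = -1" "lor x l = -1" "lor y l = -1" "lor x x = 1" "lor y y = 1"
    using quad_lor[OF S(1)] xy S(3) xyz(2) by auto
  have xyV: "x \<in> V" "y \<in> V" using xy S(2) by auto
  have x1: "x $ 1 > 0" "y $ 1 > 0" using l(3) xyV xy by auto
  \<comment> \<open>The rotation that takes the normal (0, -1) of the axis to that of
    \<open>l\<close>; \<open>c\<close> is the foot of the perpendicular from the origin to
    \<open>l\<close>.\<close>
  define B :: "real^2^2" where "B = vector [vector [- l $ 3, - l $ 2], vector [l $ 2, - l $ 3]]"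
  define c :: "real^2" where "c = vector [l $ 4 / 2 * l $ 2, l $ 4 / 2 * l $ 3]"
  have Bc: "B $ 1 $ 1 = - l $ 3" "B $ 1 $ 2 = - l $ 2" "B $ 2 $ 1 = l $ 2" "B $ 2 $ 2 = - l $ 3"
    by (simp_all add: B_def)
  have B: "orthogonal_matrix B" using l23 by (intro orthogonal_matrix_2I) (simp_all add: Bc add.commute)
  define h where "h = sim_vec 1 B c"
  have isoh: "lor (h u) (h v) = lor u v" for u v unfolding h_def by (rule lor_sim_vec[OF B]) simp
  have hL: "h base_line = l"
  proof -
    have "2 * (l $ 2 * c $ 1 + l $ 3 * c $ 2) = l $ 4 * ((l $ 2)\<^sup>2 + (l $ 3)\<^sup>2)"
      by (simp add: c_def power2_eq_square algebra_simps)
    then have "2 * (l $ 2 * c $ 1 + l $ 3 * c $ 2) = l $ 4" using l23 by simp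
    then show ?thesis
      using l(2) by (simp add: h_def sim_vec_def Let_def Bc base_line_def vec_eq_iff forall_4)
  qed
  define B' where "B' = transpose B"
  define c' where "c' = - (1 / 1) *\<^sub>R (transpose B *v c)"
  have B': "orthogonal_matrix B'" using B by (simp add: B'_def orthogonal_matrix_transpose)
  define h' where "h' = sim_vec 1 B' c'"
  have inv: "similarity_map 1 B c \<circ> similarity_map 1 B' c' = id"
    using similarity_map_inverse(2)[OF B, of 1 c] by (simp add: B'_def c'_def)
  \<comment> \<open>Obtained through the circles and the injectivity of \<open>circ_of\<close>,
    which avoids composing the coordinate formulas of \<open>sim_vec\<close>.\<close>
  have hh': "h (h' u) = u" if "lor u u = 1" for u
  proof -
    have 1: "lor (h' u) (h' u) = 1" unfolding h'_def using that lor_sim_vec[OF B'] by simp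
    then have 2: "lor (h (h' u)) (h (h' u)) = 1" by (simp add: isoh)
    have "circ_of (h (h' u)) = (similarity_map 1 B c ` fst (circ_of (h' u)), similarity_map 1 B c ` snd (circ_of (h' u)))"
      unfolding h_def using circ_of_sim_vec[OF B zero_less_one] by metis
    also have "circ_of (h' u) = (similarity_map 1 B' c' ` fst (circ_of u), similarity_map 1 B' c' ` snd (circ_of u))"
      unfolding h'_def using circ_of_sim_vec[OF B' zero_less_one] by metis
    finally have "circ_of (h (h' u)) = circ_of u" using inv by (simp add: image_comp)
    then show ?thesis using circ_of_inj[OF 2 that] by simp
  qed
  have pull: "\<exists>s t. s > 0 \<and> h (nu s t) = u" if u: "lor u u = 1" "lor u l = -1" "u $ 1 > 0" for u
  proof -
    have "lor (h' u) (h' u) = 1" using u(1) isoh[of "h' u" "h' u"] hh'[OF u(1)] by simp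
    moreover have "lor (h' u) base_line = -1" using u(2) isoh[of "h' u" base_line] hh'[OF u(1)] hL by simp
    moreover have "h' u $ 1 > 0" using u(3) by (simp add: h'_def sim_vec_def Let_def)
    ultimately obtain s t where "s > 0" "h' u = nu s t" using tangent_base_line_nu by metis
    then show ?thesis using hh'[OF u(1)] by metis
  qed
  obtain s t where s: "s > 0" "h (nu s t) = x" using pull lors x1 by metis
  obtain s' t' where s': "s' > 0" "h (nu s' t') = y" using pull lors x1 by metis
  have "lor (nu s t) (nu s' t') = -1" using isoh[of "nu s t" "nu s' t'"] s s' lors by simp
  then have "(s * t' - s' * t)\<^sup>2 = 2\<^sup>2" unfolding lor_nu by simp
  then obtain e :: real where e: "e = 1 \<or> e = -1" "s * t' - s' * t = 2 * e"
    by (metis mult_minus_right mult_1_right power2_eq_iff)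
  obtain A b where A: "orthogonal_matrix A" "det A = e"
    and g: "sim_vec (1 / s'\<^sup>2) A b base_line = base_line" "sim_vec (1 / s'\<^sup>2) A b (nu (s / s') 0) = nu s t"
      "sim_vec (1 / s'\<^sup>2) A b (nu 1 (2 / (s / s'))) = nu s' t'"
    using standard_map[OF s(1) s'(1) e] by metis
  define \<alpha> where "\<alpha> = s / s'"
  have \<alpha>: "\<alpha> > 0" using s(1) s'(1) by (simp add: \<alpha>_def)
  have \<mu>: "1 / s'\<^sup>2 > 0" using s'(1) by simp
  define G where "G = (\<lambda>u. h (sim_vec (1 / s'\<^sup>2) A b u))"
  have linG: "linear G"
    unfolding G_def h_def using linear_compose[OF linear_sim_vec linear_sim_vec] by (simp add: comp_def)
  have isoG: "lor (G u) (G v) = lor u v" for u v unfolding G_def isoh by (rule lor_sim_vec[OF A(1) \<mu>])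
  have W: "apollonian_vectors (G ` packing_vectors \<alpha>)"
    by (rule isometry_apollonian_vectors[OF linG isoG apollonian_packing_vectors[OF \<alpha>]])
  have G: "G base_line = l" "G (nu \<alpha> 0) = x" "G (nu 1 (2 / \<alpha>)) = y"
    using g hL s(2) s'(2) by (simp_all add: G_def \<alpha>_def)
  have "l \<in> G ` packing_vectors \<alpha>" "x \<in> G ` packing_vectors \<alpha>" "y \<in> G ` packing_vectors \<alpha>"
    using packing_vectors_mem[of \<alpha>] G by (metis imageI)+
  from apollonian_vectors_unique_triple[OF W V this l(1) xyV]
  have GV: "G ` packing_vectors \<alpha> = V" using lors by (simp add: lor_commute)
  define \<Phi> where "\<Phi> = similarity_map 1 B c \<circ> similarity_map (1 / s'\<^sup>2) A b"
  have "sim (det B) (similarity_map 1 B c)" "sim (det A) (similarity_map (1 / s'\<^sup>2) A b)"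
    unfolding sim_def using B A(1) \<mu> zero_less_one by blast+
  then have sim\<Phi>: "is_similarity \<Phi>" unfolding \<Phi>_def is_similarity_iff using sim_comp by blast
  have "act \<Phi> (packing \<alpha>) = circ_of ` (h ` (sim_vec (1 / s'\<^sup>2) A b ` packing_vectors \<alpha>))"
    unfolding \<Phi>_def act_comp packing_eq[OF \<alpha>] act_circ_of[OF A(1) \<mu>] act_circ_of[OF B zero_less_one] h_def ..
  moreover have "h ` (sim_vec (1 / s'\<^sup>2) A b ` packing_vectors \<alpha>) = V"
    using GV by (simp add: G_def image_image)
  ultimately have "act \<Phi> (packing \<alpha>) = circ_of ` V" by (simp only:)
  moreover have "circ_of ` V = P"
    unfolding V_def using P(1) by (intro circ_of_vectors_of) (simp add: half_plane_packing_def apollonian_packing_def)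
  \<comment> \<open>Otherwise the image of the second line of \<open>packing \<alpha>\<close> would
    have to be \<open>l\<close>, although it has product -1 with \<open>l\<close>.\<close>
  moreover have "\<alpha> \<notin> \<rat>"
  proof
    assume "\<alpha> \<in> \<rat>"
    then obtain t where t: "nu 0 t \<in> packing_vectors \<alpha>" using rational_second_line[OF \<alpha>] by metis
    then have "G (nu 0 t) \<in> V" using GV by blast
    moreover have "G (nu 0 t) $ 1 = 0" by (simp add: G_def h_def sim_vec_def Let_def nu_def)
    ultimately have "G (nu 0 t) = l" using l(3) by force
    then have "lor (G (nu 0 t)) (G base_line) = 1" using G(1) ll by simp
    then show False unfolding isoG by simp
  qed
  ultimately show thesis using that \<alpha> sim\<Phi> by metis
qed

lemma packing_half_plane:
  assumes "\<alpha> > 0"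
  shows "half_plane_packing (packing \<alpha>)"
proof -
  interpret apollonian "packing_vectors \<alpha>" using assms by (rule apollonian_locale_packing_vectors)
  have "is_line (fst (circ_of base_line))"
    using is_line_circ_of[of base_line] by (simp add: base_line_def[THEN arg_cong, of "\<lambda>u. u $ 1"])
  then show ?thesis
    using apollonian_packing_image packing_vectors_mem(1)[of \<alpha>] unfolding half_plane_packing_def packing_eq[OF assms] by blast
qed

lemma packing_strip_iff:
  assumes "\<alpha> > 0"
  shows "strip_packing (packing \<alpha>) \<longleftrightarrow> \<alpha> \<in> \<rat>"
proof -
  interpret apollonian "packing_vectors \<alpha>" using assms by (rule apollonian_locale_packing_vectors)
  have L: "is_line (fst (circ_of base_line))"
    using is_line_circ_of[of base_line] by (simp add: base_line_def[THEN arg_cong, of "\<lambda>u. u $ 1"])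
  show ?thesis
  proof
    assume "\<alpha> \<in> \<rat>"
    then obtain t where t: "nu 0 t \<in> packing_vectors \<alpha>" using rational_second_line[OF assms] by metis
    have "nu 0 t $ 1 = 0" by (simp add: nu_def)
    then have "is_line (fst (circ_of (nu 0 t)))" using is_line_circ_of[OF lor_nu_self] by simp
    moreover have "circ_of (nu 0 t) \<noteq> circ_of base_line"
      using circ_of_inj[of "nu 0 t" base_line] nu_neq_base_line by auto
    ultimately show "strip_packing (packing \<alpha>)"
      unfolding strip_packing_def packing_eq[OF assms] using apollonian_packing_image t packing_vectors_mem(1)[of \<alpha>] L by blast
  next
    assume "strip_packing (packing \<alpha>)"
    then obtain C D where CD: "C \<in> packing \<alpha>" "D \<in> packing \<alpha>" "C \<noteq> D" "is_line (fst C)" "is_line (fst D)"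
      by (auto simp: strip_packing_def)
    show "\<alpha> \<in> \<rat>"
    proof (rule ccontr)
      assume irr: "\<alpha> \<notin> \<rat>"
      have "C = circ_of base_line" if "C \<in> packing \<alpha>" "is_line (fst C)" for C
      proof -
        from that(1) obtain u where u: "u \<in> packing_vectors \<alpha>" "C = circ_of u" unfolding packing_eq[OF assms] by blast
        then have "u $ 1 = 0" using is_line_circ_of[OF unit[OF u(1)]] that(2) by simp
        then show ?thesis using irrational_only_line[OF assms irr u(1)] u(2) by simp
      qed
      then show False using CD by blast
    qed
  qed
qed

section \<open>Continued fractions\<close>

definition digits :: "real \<Rightarrow> nat \<Rightarrow> nat" where
  "digits x k = nat \<lfloor>(gauss ^^ k) x\<rfloor>"

text \<open>A truncated fraction with an arbitrary real tail. Convergents and the irrational number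
  itself are both of this form, with the same first digits.\<close>

primrec cf_value :: "nat \<Rightarrow> (nat \<Rightarrow> nat) \<Rightarrow> real \<Rightarrow> real" where
  "cf_value 0 a x = x"
| "cf_value (Suc n) a x = real (a 0) + 1 / cf_value n (\<lambda>k. a (Suc k)) x"

lemma cf_value_ge_1:
  assumes "\<And>k. a k > 0" "x \<ge> 1"
  shows "cf_value n a x \<ge> 1"
  using assms
proof (induction n arbitrary: a)
  case (Suc n)
  have "cf_value n (\<lambda>k. a (Suc k)) x \<ge> 1" using Suc by simp
  moreover have "real (a 0) \<ge> 1" using Suc.prems(1)[of 0] by simp
  ultimately show ?case by (simp add: add_increasing2)
qed simp

text \<open>A single step may fail to contract when the digits are 1, but two steps divide the
  distance by (u u')(v v'), which is at least 4. The constant 2 in the bound lets both start cases,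
  0 and 1, hold.\<close>

lemma cf_value_contraction:
  assumes "\<And>k. k > 0 \<Longrightarrow> a k > 0" "x \<ge> 1" "y \<ge> 1"
  shows "\<bar>cf_value (Suc n) a x - cf_value (Suc n) a y\<bar> \<le> 2 / 2 ^ n"
  using assms(1)
proof (induction n arbitrary: a rule: less_induct)
  case (less n)
  have inv: "\<bar>1 / u - 1 / v\<bar> \<le> 1" if "u \<ge> 1" "v \<ge> 1" for u v :: real
  proof -
    have "0 \<le> 1 / u" "1 / u \<le> 1" "0 \<le> 1 / v" "1 / v \<le> 1" using that by simp_all
    then show ?thesis by linarith
  qed
  define u v where "u = cf_value n (\<lambda>k. a (Suc k)) x" and "v = cf_value n (\<lambda>k. a (Suc k)) y"
  have uv: "u \<ge> 1" "v \<ge> 1" using cf_value_ge_1[of "\<lambda>k. a (Suc k)"] less.prems assms(2,3) by (simp_all add: u_def v_def)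
  have d0: "cf_value (Suc n) a x - cf_value (Suc n) a y = 1 / u - 1 / v" by (simp add: u_def v_def)
  consider "n = 0" | "n = 1" | m where "n = Suc (Suc m)" by (metis One_nat_def not0_implies_Suc)
  then show ?case
  proof cases
    case 1
    then show ?thesis using inv[OF uv] d0 by simp
  next
    case 2
    then show ?thesis using inv[OF uv] d0 by simp
  next
    case 3
    define b where "b = (\<lambda>k. a (Suc (Suc k)))"
    define u' v' where "u' = cf_value (Suc m) b x" and "v' = cf_value (Suc m) b y"
    have u': "u = real (a 1) + 1 / u'" "v = real (a 1) + 1 / v'" by (simp_all add: u_def v_def u'_def v'_def 3 b_def)
    have b: "b k > 0" for k using less.prems by (simp add: b_def)
    have ge: "u' \<ge> 1" "v' \<ge> 1" unfolding u'_def v'_def by (intro cf_value_ge_1 b assms)+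
    have a1: "real (a 1) \<ge> 1" using less.prems[of 1] by simp
    \<comment> \<open>Because u u' = a1 u' + 1, with both the digit and \<open>u'\<close> at least
      1.\<close>
    have uu: "u * u' \<ge> 2" "v * v' \<ge> 2"
    proof -
      have "real (a 1) * u' \<ge> 1 * 1" "real (a 1) * v' \<ge> 1 * 1" using a1 ge by (intro mult_mono; simp)+
      then show "u * u' \<ge> 2" "v * v' \<ge> 2" using ge by (simp_all add: u' distrib_right)
    qed
    have "1 / u - 1 / v = (v - u) / (u * v)" using uv by (simp add: field_simps)
    also have "v - u = (u' - v') / (u' * v')" using ge by (simp add: u' field_simps)
    finally have eq: "1 / u - 1 / v = (u' - v') / ((u * u') * (v * v'))" by (simp add: ac_simps)
    have "\<bar>1 / u - 1 / v\<bar> = \<bar>u' - v'\<bar> / ((u * u') * (v * v'))"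
    proof -
      have "(u * u') * (v * v') > 0" using uv ge by (intro mult_pos_pos) auto
      then show ?thesis unfolding eq abs_divide by simp
    qed
    also have "\<dots> \<le> \<bar>u' - v'\<bar> / (2 * 2)"
      using uu uv ge by (intro divide_left_mono mult_mono mult_pos_pos) auto
    also have "\<dots> \<le> (2 / 2 ^ m) / (2 * 2)"
      unfolding u'_def v'_def using less.IH[of m b] b 3 by (intro divide_right_mono) (simp_all del: cf_value.simps)
    finally show ?thesis using d0 3 by simp
  qed
qed

lemma cf_convergent_cf_value: "cf_convergent n a = cf_value n a (real (a n))"
  by (induction n arbitrary: a) simp_all

lemma cf_convergent_split: "cf_convergent (n + m) a = cf_value n a (cf_convergent m (\<lambda>k. a (n + k)))"
  by (induction n arbitrary: a) simp_all

lemma cf_convergent_ge_1: "(\<And>k. a k > 0) \<Longrightarrow> cf_convergent n a \<ge> 1"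
  unfolding cf_convergent_cf_value by (intro cf_value_ge_1) (auto simp: Suc_le_eq)

lemma cf_convergent_close:
  assumes a: "\<forall>k>0. a k > 0" and x: "x \<ge> 1"
  shows "\<bar>cf_convergent (Suc n) a - cf_value (Suc n) a x\<bar> \<le> 2 / 2 ^ n"
  unfolding cf_convergent_cf_value
  using cf_value_contraction[of a "real (a (Suc n))" x n] a x
  by (simp add: Suc_le_eq del: cf_value.simps)

lemma tendsto_two_power: "(\<lambda>n. 2 / 2 ^ n :: real) \<longlonglongrightarrow> 0"
proof -
  have "(\<lambda>n. (1 / 2 :: real) ^ n) \<longlonglongrightarrow> 0" by (rule LIMSEQ_realpow_zero) simp_all
  then have "(\<lambda>n. 2 * (1 / 2 :: real) ^ n) \<longlonglongrightarrow> 0" by (rule tendsto_mult_right_zero)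
  moreover have "(\<lambda>n. 2 * (1 / 2 :: real) ^ n) = (\<lambda>n. 2 / 2 ^ n)" by (simp add: power_divide)
  ultimately show ?thesis by simp
qed

text \<open>Every later convergent has the first digits in common with an earlier one and a tail of
  at least 1, so the contraction gives a Cauchy sequence.\<close>

lemma cf_convergent_converges:
  assumes a: "\<forall>k>0. a k > 0"
  obtains x where "infinite_cf x a"
proof -
  have "Cauchy (\<lambda>n. cf_convergent n a)"
  proof (rule metric_CauchyI)
    fix e :: real assume "e > 0"
    then have "e / 2 > 0" by simp
    from LIMSEQ_D[OF tendsto_two_power this] obtain N where "\<forall>n\<ge>N. norm (2 / 2 ^ n - 0 :: real) < e / 2" ..
    then have "norm (2 / 2 ^ N - 0 :: real) < e / 2" by (rule allE[of _ N]) simp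
    then have N: "2 / 2 ^ N < e / 2" by simp
    have close: "dist (cf_convergent m a) (cf_convergent (Suc N) a) < e / 2" if "m \<ge> Suc N" for m
    proof -
      define k where "k = m - Suc N"
      have j: "m = Suc N + k" using that by (simp add: k_def)
      have "cf_convergent k (\<lambda>i. a (Suc N + i)) \<ge> 1" using a by (intro cf_convergent_ge_1) simp
      then have "\<bar>cf_convergent (Suc N) a - cf_value (Suc N) a (cf_convergent k (\<lambda>i. a (Suc N + i)))\<bar> \<le> 2 / 2 ^ N"
        using a by (intro cf_convergent_close) simp_all
      then show ?thesis
        using N unfolding j cf_convergent_split dist_real_def abs_minus_commute[of _ "cf_convergent (Suc N) a"]
        by (rule le_less_trans)
    qed
    show "\<exists>M. \<forall>m\<ge>M. \<forall>n\<ge>M. dist (cf_convergent m a) (cf_convergent n a) < e"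
      using dist_triangle_half_l[OF close close] by (intro exI[of _ "Suc N"]) simp
  qed
  then have "convergent (\<lambda>n. cf_convergent n a)" by (rule Cauchy_convergent)
  then obtain x where "(\<lambda>n. cf_convergent n a) \<longlonglongrightarrow> x" unfolding convergent_def ..
  then have "infinite_cf x a" using a by (simp add: infinite_cf_def)
  then show thesis by (rule that)
qed

lemma digits_cf_value: "x \<notin> \<rat> \<Longrightarrow> x > 0 \<Longrightarrow> x = cf_value n (digits x) ((gauss ^^ n) x)"
proof (induction n arbitrary: x)
  case (Suc n)
  have "gauss x = cf_value n (digits (gauss x)) ((gauss ^^ n) (gauss x))"
    using Suc.IH[of "gauss x"] gauss_irrational[OF Suc.prems(1)] by simp
  moreover have "digits (gauss x) = (\<lambda>k. digits x (Suc k))"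
    by (simp add: digits_def fun_eq_iff funpow_Suc_right del: funpow.simps)
  moreover have "(gauss ^^ Suc n) x = (gauss ^^ n) (gauss x)" by (simp add: funpow_Suc_right del: funpow.simps)
  moreover have "real (digits x 0) = of_int \<lfloor>x\<rfloor>" using Suc.prems(2) by (simp add: digits_def)
  ultimately show ?case using gauss_irrational(3)[OF Suc.prems(1)] by simp
qed simp

lemma digits_pos: "x \<notin> \<rat> \<Longrightarrow> k > 0 \<Longrightarrow> digits x k > 0"
  using iterate_gt_1[of x "k - 1"] by (simp add: digits_def)

lemma infinite_cf_digits:
  assumes x: "x \<notin> \<rat>" "x > 0"
  shows "infinite_cf x (digits x)"
proof -
  have "\<bar>cf_convergent (Suc n) (digits x) - x\<bar> \<le> 2 / 2 ^ n" for n
  proof -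
    have "(gauss ^^ Suc n) x \<ge> 1" using iterate_gt_1[OF x(1), of n] by simp
    then have "\<bar>cf_convergent (Suc n) (digits x) - cf_value (Suc n) (digits x) ((gauss ^^ Suc n) x)\<bar> \<le> 2 / 2 ^ n"
      using digits_pos[OF x(1)] by (intro cf_convergent_close) simp_all
    then show ?thesis unfolding digits_cf_value[OF x, of "Suc n", symmetric] .
  qed
  then have "(\<lambda>n. cf_convergent (Suc n) (digits x) - x) \<longlonglongrightarrow> 0"
    by (intro tendsto_rabs_zero_cancel[OF tendsto_sandwich[OF _ _ tendsto_const tendsto_two_power]] always_eventually)
      auto
  then have "(\<lambda>n. cf_convergent (Suc n) (digits x)) \<longlonglongrightarrow> x" by (simp only: LIM_zero_iff)
  then have "(\<lambda>n. cf_convergent n (digits x)) \<longlonglongrightarrow> x" by (rule LIMSEQ_imp_Suc)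
  then show ?thesis using digits_pos[OF x(1)] by (simp add: infinite_cf_def)
qed

lemma infinite_cf_step:
  assumes "infinite_cf x a"
  obtains y where "infinite_cf y (\<lambda>k. a (Suc k))" "y > 1" "x = real (a 0) + 1 / y"
proof -
  have step: "\<exists>y. infinite_cf y (\<lambda>k. a (Suc k)) \<and> y \<ge> real (a 1) \<and> y \<ge> 1 \<and> x = real (a 0) + 1 / y"
    if inf: "infinite_cf x a" for x a
  proof -
    have a: "a k > 0" if "k > 0" for k using inf that unfolding infinite_cf_def by simp
    have "\<forall>k>0. a (Suc k) > 0" using a by simp
    then obtain y where y: "infinite_cf y (\<lambda>k. a (Suc k))" by (rule cf_convergent_converges)
    then have lim: "(\<lambda>n. cf_convergent n (\<lambda>k. a (Suc k))) \<longlonglongrightarrow> y" by (simp add: infinite_cf_def)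
    have pos: "cf_convergent n (\<lambda>k. a (Suc k)) \<ge> 1" for n by (intro cf_convergent_ge_1) (simp add: a)
    have "y \<ge> 1" by (intro LIMSEQ_le_const[OF lim] exI allI impI pos)
    have ge: "cf_convergent n (\<lambda>k. a (Suc k)) \<ge> real (a 1)" for n
    proof (cases n)
      case (Suc m)
      have "cf_convergent m (\<lambda>k. a (Suc (Suc k))) \<ge> 1" by (intro cf_convergent_ge_1) (simp add: a)
      then show ?thesis by (simp add: Suc)
    qed simp
    have "y \<ge> real (a 1)" by (intro LIMSEQ_le_const[OF lim] exI allI impI ge)
    have "(\<lambda>n. real (a 0) + 1 / cf_convergent n (\<lambda>k. a (Suc k))) \<longlonglongrightarrow> real (a 0) + 1 / y"
      using \<open>y \<ge> 1\<close> by (intro tendsto_intros lim) auto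
    then have "(\<lambda>n. cf_convergent (Suc n) a) \<longlonglongrightarrow> real (a 0) + 1 / y" by simp
    then have "(\<lambda>n. cf_convergent n a) \<longlonglongrightarrow> real (a 0) + 1 / y" by (rule LIMSEQ_imp_Suc)
    moreover have "(\<lambda>n. cf_convergent n a) \<longlonglongrightarrow> x" using inf by (simp add: infinite_cf_def)
    ultimately have "x = real (a 0) + 1 / y" by (rule LIMSEQ_unique[rotated])
    then show ?thesis using y \<open>y \<ge> 1\<close> \<open>y \<ge> real (a 1)\<close> by (intro exI[of _ y]) simp
  qed
  from step[OF assms] obtain y where y: "infinite_cf y (\<lambda>k. a (Suc k))" "x = real (a 0) + 1 / y"
    by (elim exE conjE)
  \<comment> \<open>The limit only inherits \<open>y \<ge> 1\<close>. A second step makes this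
    strict, which the recovery of the first digit as a floor requires.\<close>
  from step[OF y(1)] obtain z where z: "z \<ge> 1" "y = real (a 1) + 1 / z" unfolding One_nat_def by (elim exE conjE)
  have "a 1 > 0" using assms by (simp add: infinite_cf_def)
  then have "real (a 1) \<ge> 1" "1 / z > 0" using z(1) by simp_all
  then have "y > 1" unfolding z(2) by linarith
  then show thesis using that[OF y(1) _ y(2)] by simp
qed

lemma infinite_cf_gauss:
  assumes "infinite_cf x a"
  shows "infinite_cf (gauss x) (\<lambda>k. a (Suc k))" "digits x 0 = a 0" "frac x \<noteq> 0" "x > 0"
proof -
  obtain y where y: "infinite_cf y (\<lambda>k. a (Suc k))" "y > 1" "x = real (a 0) + 1 / y"
    by (rule infinite_cf_step[OF assms])
  have "1 / y > 0" "1 / y < 1" using y(2) by simp_all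
  then have f: "\<lfloor>x\<rfloor> = int (a 0)" unfolding y(3) by (intro floor_unique) simp_all
  then have fr: "frac x = 1 / y" using y(3) by (simp add: frac_def)
  then show "infinite_cf (gauss x) (\<lambda>k. a (Suc k))" using y(1) by (simp add: gauss_def)
  show "digits x 0 = a 0" using f by (simp add: digits_def)
  show "frac x \<noteq> 0" using fr y(2) by simp
  show "x > 0" using y(2,3) by (simp add: add_nonneg_pos)
qed

text \<open>Euclid's algorithm: a Gauss step sends m / n to n / (m mod n), with a smaller
  denominator, until the remainder is 0.\<close>

lemma rational_terminates:
  assumes "n > 0"
  shows "\<exists>k. frac ((gauss ^^ k) (of_int m / of_int n)) = 0"
  using assms
proof (induction "nat n" arbitrary: m n rule: less_induct)
  case less
  have f: "frac (real_of_int m / of_int n) = of_int (m mod n) / of_int n"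
  proof -
    have "real_of_int m = of_int (m div n) * of_int n + of_int (m mod n)"
      by (metis div_mult_mod_eq of_int_add of_int_mult)
    then have "real_of_int m / of_int n = of_int (m div n) + of_int (m mod n) / of_int n"
      using less.prems by (simp add: field_simps)
    moreover have "\<lfloor>real_of_int m / of_int n\<rfloor> = m div n" by (rule floor_divide_of_int_eq)
    ultimately show ?thesis by (simp add: frac_def)
  qed
  show ?case
  proof (cases "m mod n = 0")
    case True
    then show ?thesis using f by (intro exI[of _ 0]) simp
  next
    case False
    have b: "0 < m mod n" "m mod n < n" 
      using False pos_mod_sign[OF less.prems, of m] pos_mod_bound[OF less.prems, of m] by linarith+
    then obtain k where "frac ((gauss ^^ k) (of_int n / of_int (m mod n))) = 0"
      using less.hyps[of "m mod n" n] by auto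
    moreover have "gauss (of_int m / of_int n) = of_int n / of_int (m mod n)" using f by (simp add: gauss_def)
    ultimately have "frac ((gauss ^^ Suc k) (of_int m / of_int n)) = 0"
      by (simp add: funpow_Suc_right del: funpow.simps)
    then show ?thesis by blast
  qed
qed

lemma infinite_cf_iterate: "infinite_cf x a \<Longrightarrow> infinite_cf ((gauss ^^ n) x) (\<lambda>k. a (n + k))"
proof (induction n)
  case (Suc n)
  then show ?case using infinite_cf_gauss(1)[of "(gauss ^^ n) x" "\<lambda>k. a (n + k)"] by simp
qed simp

text \<open>An infinite expansion keeps all fractional parts nonzero, so it cannot belong to a
  rational number; the digits are read off one Gauss step at a time.\<close>

lemma infinite_cf_iff: "infinite_cf x a \<longleftrightarrow> x > 0 \<and> x \<notin> \<rat> \<and> a = digits x"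
proof
  assume inf: "infinite_cf x a"
  have "x \<notin> \<rat>"
  proof
    assume "x \<in> \<rat>"
    then obtain m n :: int where "n > 0" "x = of_int m / of_int n" by (rule Rats_cases') blast
    then obtain k where "frac ((gauss ^^ k) x) = 0" using rational_terminates by blast
    then show False using infinite_cf_gauss(3)[OF infinite_cf_iterate[OF inf, of k]] by simp
  qed
  moreover have "a n = digits x n" for n
    using infinite_cf_gauss(2)[OF infinite_cf_iterate[OF inf, of n]] by (simp add: digits_def)
  ultimately show "x > 0 \<and> x \<notin> \<rat> \<and> a = digits x" using infinite_cf_gauss(4)[OF inf] by (simp add: fun_eq_iff)
qed (use infinite_cf_digits in blast)

lemma digits_iterate: "digits ((gauss ^^ m) x) k = digits x (m + k)"
proof -
  have "(gauss ^^ k) ((gauss ^^ m) x) = (gauss ^^ (m + k)) x" by (metis add.commute comp_apply funpow_add)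
  then show ?thesis by (simp add: digits_def)
qed

lemma iterate_pos: "x \<notin> \<rat> \<Longrightarrow> x > 0 \<Longrightarrow> (gauss ^^ n) x > 0"
  using iterate_gt_1[of x "n - 1"] by (cases n) auto

lemma iterate_eq_iff:
  assumes x: "x \<notin> \<rat>" "x > 0" and y: "y \<notin> \<rat>" "y > 0"
  shows "(gauss ^^ m) x = (gauss ^^ n) y \<longleftrightarrow> (\<forall>k. digits x (m + k) = digits y (n + k))"
proof
  assume "(gauss ^^ m) x = (gauss ^^ n) y"
  then show "\<forall>k. digits x (m + k) = digits y (n + k)" by (metis digits_iterate)
next
  assume "\<forall>k. digits x (m + k) = digits y (n + k)"
  then have "digits ((gauss ^^ m) x) = digits ((gauss ^^ n) y)" by (simp add: digits_iterate fun_eq_iff)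
  then have "(\<lambda>k. cf_convergent k (digits ((gauss ^^ m) x))) \<longlonglongrightarrow> (gauss ^^ m) x"
    "(\<lambda>k. cf_convergent k (digits ((gauss ^^ m) x))) \<longlonglongrightarrow> (gauss ^^ n) y"
    using infinite_cf_digits[OF iterate_irrational[OF x(1)] iterate_pos[OF x], of m]
      infinite_cf_digits[OF iterate_irrational[OF y(1)] iterate_pos[OF y], of n]
    by (simp_all add: infinite_cf_def)
  then show "(gauss ^^ m) x = (gauss ^^ n) y" by (rule LIMSEQ_unique)
qed

section \<open>Minimal periods\<close>

definition eventual_period :: "(nat \<Rightarrow> 'a) \<Rightarrow> nat \<Rightarrow> bool" where
  "eventual_period a d \<longleftrightarrow> (\<exists>N. \<forall>k\<ge>N. a (k + d) = a k)"

lemma period_mult: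
  fixes a :: "nat \<Rightarrow> 'a"
  assumes "\<forall>k\<ge>N. a (k + d) = a k" "k \<ge> N"
  shows "a (k + j * d) = a k"
proof (induction j)
  case (Suc j)
  have "a (k + Suc j * d) = a ((k + j * d) + d)" by (simp add: algebra_simps)
  also have "\<dots> = a (k + j * d)" using assms by simp
  finally show ?case using Suc by simp
qed simp

lemma eventual_period_diff:
  assumes "eventual_period a c" "eventual_period a d" "c \<le> d"
  shows "eventual_period a (d - c)"
proof -
  obtain M where M: "\<And>k. k \<ge> M \<Longrightarrow> a (k + c) = a k" using assms(1) by (auto simp: eventual_period_def)
  obtain N where N: "\<And>k. k \<ge> N \<Longrightarrow> a (k + d) = a k" using assms(2) by (auto simp: eventual_period_def)
  have "a (k + (d - c)) = a k" if "k \<ge> M + N" for k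
    using M[of "k + (d - c)"] N[of k] that assms(3) by simp
  then show ?thesis unfolding eventual_period_def by blast
qed

text \<open>Eventual periods are closed under differences, so the subtractive form of Euclid's
  algorithm stays among them.\<close>

lemma eventual_period_gcd:
  "eventual_period a c \<Longrightarrow> eventual_period a d \<Longrightarrow> eventual_period a (gcd c d)"
proof (induction "c + d" arbitrary: c d rule: less_induct)
  case less
  consider "c = 0" | "d = 0" | "c > 0" "c \<le> d" | "d > 0" "d < c" by linarith
  then show ?case
  proof cases
    case 3
    have "eventual_period a (gcd c (d - c))"
      using less.hyps[of c "d - c"] eventual_period_diff[OF less.prems] less.prems(1) 3 by simp
    then show ?thesis using 3 by (simp add: gcd.commute[of c] gcd_diff1_nat)
  next
    case 4
    have "eventual_period a (gcd (c - d) d)"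
      using less.hyps[of "c - d" d] eventual_period_diff[OF less.prems(2,1)] less.prems(2) 4 by simp
    then show ?thesis using 4 by (simp add: gcd_diff1_nat)
  qed (use less.prems in simp_all)
qed

lemma periodic_part_eventual_period: "periodic_part a s \<Longrightarrow> eventual_period a (length s)"
proof -
  assume "periodic_part a s"
  then obtain n where n: "\<And>k. a (n + k) = s ! (k mod length s)" by (auto simp: periodic_part_def)
  have "a (k + length s) = a k" if "k \<ge> n" for k
  proof -
    define j where "j = k - n"
    have k: "k = n + j" using that by (simp add: j_def)
    have "a (n + (j + length s)) = a (n + j)" unfolding n by simp
    then show ?thesis by (simp add: k add.assoc)
  qed
  then show ?thesis unfolding eventual_period_def by blast
qed

lemma eventual_period_periodic_part:
  assumes "eventual_period a d" "d > 0"
  obtains s where "length s = d" "periodic_part a s"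
proof -
  obtain N where N: "\<forall>k\<ge>N. a (k + d) = a k" using assms(1) by (auto simp: eventual_period_def)
  define s where "s = map (\<lambda>i. a (N + i)) [0..<d]"
  have "a (N + k) = s ! (k mod length s)" for k
  proof -
    have "a (N + k mod d + (k div d) * d) = a (N + k mod d)" by (rule period_mult[OF N]) simp_all
    then have "a (N + k) = a (N + k mod d)" by (simp add: add.assoc)
    then show ?thesis using assms(2) by (simp add: s_def)
  qed
  moreover have "s \<noteq> []" using assms(2) by (simp add: s_def)
  ultimately have "periodic_part a s" unfolding periodic_part_def by blast
  then show thesis using that[of s] by (simp add: s_def)
qed

definition minimal_period :: "(nat \<Rightarrow> nat) \<Rightarrow> nat list \<Rightarrow> bool" where
  "minimal_period a s \<longleftrightarrow> periodic_part a s \<and> (\<forall>t. periodic_part a t \<longrightarrow> length s \<le> length t)"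

lemma minimal_period_exists:
  assumes "eventual_period a d" "d > 0"
  obtains s where "minimal_period a s"
proof -
  obtain s0 where "periodic_part a s0" using eventual_period_periodic_part[OF assms] by metis
  then have "periodic_part a (arg_min length (periodic_part a))"
    "\<And>t. periodic_part a t \<Longrightarrow> length (arg_min length (periodic_part a)) \<le> length t"
    using arg_min_nat_lemma[of "periodic_part a" s0 length] by blast+
  then show thesis using that unfolding minimal_period_def by blast
qed

text \<open>The gcd of the two periods is a period not exceeding the minimal length, hence equal to
  it. Minimality in length alone would not control the parity of other periods.\<close>

lemma minimal_period_dvd:
  assumes "minimal_period a s" "eventual_period a d"
  shows "length s dvd d"
proof -
  have s: "periodic_part a s" "s \<noteq> []" using assms(1) by (auto simp: minimal_period_def periodic_part_def)
  define g where "g = gcd (length s) d"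
  have "eventual_period a g"
    unfolding g_def by (rule eventual_period_gcd[OF periodic_part_eventual_period[OF s(1)] assms(2)])
  moreover have "g > 0" using s(2) by (simp add: g_def)
  ultimately obtain t where "length t = g" "periodic_part a t" by (rule eventual_period_periodic_part)
  then have "length s \<le> g" using assms(1) by (auto simp: minimal_period_def)
  moreover have "g \<le> length s" using s(2) by (simp add: g_def gcd_le1_nat)
  ultimately show ?thesis by (metis g_def gcd_dvd2 le_antisym)
qed

lemma periodic_part_tail:
  assumes t: "\<forall>k. a (m + k) = b (n + k)" and s: "periodic_part a s"
  shows "periodic_part b s"
proof -
  obtain N where N: "\<And>k. a (N + k) = s ! (k mod length s)" and ne: "s \<noteq> []"
    using s by (auto simp: periodic_part_def)
  \<comment> \<open>The starting point is chosen so that after adding \<open>m\<close> the total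
    shift is \<open>m * length s\<close>, a whole number of periods; thus the very same list
    \<open>s\<close>, not a rotation of it, describes the tail.\<close>
  have "b (n + N + m * (length s - 1) + k) = s ! (k mod length s)" for k
  proof -
    have l: "m * length s = m + m * (length s - 1)" using ne by (cases "length s") simp_all
    have "b (n + N + m * (length s - 1) + k) = a (m + (N + m * (length s - 1) + k))"
      using t by (simp add: add.assoc)
    also have "m + (N + m * (length s - 1) + k) = N + (m * length s + k)" unfolding l by simp
    also have "a \<dots> = s ! (k mod length s)" unfolding N by simp
    finally show ?thesis .
  qed
  then show ?thesis using ne unfolding periodic_part_def by blast
qed

lemma minimal_period_tail:
  assumes t: "\<forall>k. a (m + k) = b (n + k)" and s: "minimal_period a s"
  shows "minimal_period b s"
proof -
  have "\<forall>k. b (n + k) = a (m + k)" using t by simp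
  from periodic_part_tail[OF t] periodic_part_tail[OF this] s show ?thesis
    unfolding minimal_period_def by blast
qed

lemma minimal_period_rotate:
  assumes "minimal_period a s" "minimal_period a s'"
  shows "\<exists>n. s' = rotate n s"
proof -
  have "length s' \<le> length s" "length s \<le> length s'" using assms unfolding minimal_period_def by blast+
  then have len: "length s' = length s" by simp
  have ne: "s \<noteq> []" using assms(1) by (simp add: minimal_period_def periodic_part_def)
  obtain N where N: "\<And>k. a (N + k) = s ! (k mod length s)" using assms(1) by (auto simp: minimal_period_def periodic_part_def)
  obtain N' where N': "\<And>k. a (N' + k) = s' ! (k mod length s')" using assms(2) by (auto simp: minimal_period_def periodic_part_def)
  \<comment> \<open>Congruent to \<open>N' - N\<close> modulo the length, without subtraction of
    natural numbers.\<close>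
  define M where "M = N' + N * (length s - 1)"
  have l: "N + N * (length s - 1) = N * length s" using ne by (cases "length s") simp_all
  have "s' ! k = rotate M s ! k" if k: "k < length s'" for k
  proof -
    have "s' ! k = s' ! ((N * length s + k) mod length s')" using k len by simp
    also have "\<dots> = a (N' + (N * length s + k))" using N' by simp
    also have "N' + (N * length s + k) = N + (M + k)" unfolding l[symmetric] M_def by simp
    also have "a \<dots> = s ! ((M + k) mod length s)" by (rule N)
    also have "\<dots> = rotate M s ! k" using k len by (simp add: nth_rotate)
    finally show ?thesis .
  qed
  then have "s' = rotate M s" using len by (intro nth_equalityI) simp_all
  then show ?thesis by blast
qed

lemma concat_replicate_nth:
  "i < q * length t \<Longrightarrow> concat (replicate q t) ! i = t ! (i mod length t)"
proof (induction q arbitrary: i)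
  case (Suc q)
  show ?case
  proof (cases "i < length t")
    case False
    then have "i - length t < q * length t" using Suc.prems by simp
    then show ?thesis using False Suc.IH[of "i - length t"] by (simp add: nth_append le_mod_geq)
  qed (simp add: nth_append)
qed simp

lemma length_concat_replicate: "length (concat (replicate q t)) = q * length t"
  by (induction q) simp_all

lemma minimal_period_non_repeating:
  assumes "minimal_period a s"
  shows "non_repeating s"
proof (rule ccontr)
  assume "\<not> non_repeating s"
  then obtain t k where t: "length t < length s" "s = concat (replicate k t)" by (auto simp: non_repeating_def)
  obtain N where N: "\<And>k. a (N + k) = s ! (k mod length s)" and ne: "s \<noteq> []"
    using assms by (auto simp: minimal_period_def periodic_part_def)
  have len: "length s = k * length t" using t(2) length_concat_replicate by metis
  then have nt: "t \<noteq> []" using ne by auto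
  have "a (N + i) = t ! (i mod length t)" for i
  proof -
    have "i mod length s < k * length t" using ne len by (metis length_greater_0_conv mod_less_divisor)
    then have "s ! (i mod length s) = t ! (i mod length s mod length t)"
      using concat_replicate_nth t(2) by metis
    also have "i mod length s mod length t = i mod length t" 
      unfolding len by (intro mod_mod_cancel) simp
    finally show ?thesis using N by simp
  qed
  then have "periodic_part a t" using nt unfolding periodic_part_def by blast
  then show False using assms t(1) unfolding minimal_period_def by (meson not_le)
qed

text \<open>A shorter periodic part yields, by a gcd, a period that properly divides the length of
  \<open>s\<close>; then \<open>s\<close> would be a repetition of its own initial segment.\<close>

lemma non_repeating_minimal_period:
  assumes ne: "s \<noteq> []" and nr: "non_repeating s"
  shows "minimal_period (\<lambda>k. s ! (k mod length s)) s"
proof -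
  define a where "a = (\<lambda>k. s ! (k mod length s))"
  have pp: "periodic_part a s" unfolding periodic_part_def using ne by (auto simp: a_def intro: exI[of _ 0])
  have "length s \<le> length t" if t: "periodic_part a t" for t
  proof (rule ccontr)
    assume lt: "\<not> length s \<le> length t"
    define g where "g = gcd (length t) (length s)"
    have nt: "t \<noteq> []" using t by (simp add: periodic_part_def)
    have g: "g > 0" "g \<le> length t" using nt by (simp_all add: g_def gcd_le1_nat)
    obtain q where q: "length s = g * q" using gcd_dvd2[of "length t" "length s"] unfolding g_def by (auto simp: dvd_def)
    have "eventual_period a g"
      unfolding g_def by (intro eventual_period_gcd periodic_part_eventual_period t pp)
    then obtain N where N: "\<And>k. k \<ge> N \<Longrightarrow> a (k + g) = a k" by (auto simp: eventual_period_def)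
    \<comment> \<open>The sequence is purely periodic, so a relation known from \<open>N\<close>
      onwards is carried back to all indices by whole periods.\<close>
    have shift: "a (k + N * length s) = a k" for k by (simp add: a_def)
    have per: "a (k + g) = a k" for k
    proof -
      have "a (k + g) = a (k + N * length s + g)" using shift[of "k + g"] by (simp add: ac_simps)
      also have "\<dots> = a (k + N * length s)" 
      proof (rule N)
        have "N * 1 \<le> N * length s" using ne by (intro mult_le_mono2) (simp add: Suc_le_eq)
        then show "N \<le> k + N * length s" by linarith
      qed
      finally show ?thesis using shift by simp
    qed
    have "g < length s" using g lt by simp
    then have len: "length (take g s) = g" by simp
    have "q \<ge> 2" using q \<open>g < length s\<close> by (cases q; cases "q - 1") auto
    have "s = concat (replicate q (take g s))"
    proof (rule nth_equalityI)
      show "length s = length (concat (replicate q (take g s)))"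
        unfolding length_concat_replicate len using q by simp
      fix i assume i: "i < length s"
      have "a (i mod g + (i div g) * g) = a (i mod g)" by (rule period_mult[of 0]) (simp_all add: per)
      then have "a i = a (i mod g)" by simp
      moreover have "i mod g < g" using g by simp
      ultimately have "s ! i = take g s ! (i mod g)" using i \<open>g < length s\<close> by (simp add: a_def)
      then show "s ! i = concat (replicate q (take g s)) ! i"
        using concat_replicate_nth[of i q "take g s"] i q len by (simp add: mult.commute)
    qed
    moreover have "length (take g s) < length s" using len \<open>g < length s\<close> by simp
    ultimately show False using nr \<open>q \<ge> 2\<close> unfolding non_repeating_def by blast
  qed
  then show ?thesis using pp unfolding minimal_period_def a_def by blast
qed

section \<open>The correspondence\<close>

text \<open>For equal parameters and \<open>m = n\<close> the multiplier, and with it the ratio, is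
  1, and only the identity remains; so a nontrivial self-similarity yields two different
  indices.\<close>

lemma sim_packing_imp_iterates:
  assumes \<alpha>: "\<alpha> > 0" "\<alpha> \<notin> \<rat>" and \<beta>: "\<beta> > 0" "\<beta> \<notin> \<rat>"
    and A: "orthogonal_matrix A" and \<mu>: "\<mu> > 0"
    and act: "act (similarity_map \<mu> A b) (packing \<alpha>) = packing \<beta>"
  obtains m n where "(gauss ^^ m) \<alpha> = (gauss ^^ n) \<beta>" "det A = (-1) ^ (m + n)"
    "\<alpha> = \<beta> \<Longrightarrow> m = n \<Longrightarrow> similarity_map \<mu> A b = id"
proof -
  obtain \<epsilon> where e: "det A = of_int \<epsilon>" "unimodular \<epsilon> (1 / sqrt \<mu>) \<alpha> \<beta>"
    and id: "\<alpha> = \<beta> \<Longrightarrow> \<mu> = 1 \<Longrightarrow> similarity_map \<mu> A b = id"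
    by (rule similar_imp_unimodular[OF \<alpha>(1) \<beta> A \<mu> act]) blast
  have "real_of_int \<epsilon> = 1 \<or> real_of_int \<epsilon> = -1" using det_orthogonal_matrix[OF A] e(1) by simp
  then have "\<epsilon> = 1 \<or> \<epsilon> = -1" by linarith
  then have "merging \<epsilon> (1 / sqrt \<mu>) \<alpha> \<beta>" using unimodular_imp_merging[OF e(2)] \<alpha>(1) \<beta> \<mu> by simp
  then obtain m n where mn: "(gauss ^^ m) \<alpha> = (gauss ^^ n) \<beta>" "\<epsilon> = (-1) ^ (m + n)"
    "1 / sqrt \<mu> * quotients_prod n \<beta> = quotients_prod m \<alpha>"
    by (auto simp: merging_def)
  have "similarity_map \<mu> A b = id" if "\<alpha> = \<beta>" "m = n"
  proof -
    have "quotients_prod m \<alpha> > 0" using quotients_prod_pos[OF \<alpha>(2)] .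
    then have "sqrt \<mu> = 1" using mn(3) that \<mu> by (simp add: field_simps)
    then show ?thesis using id that(1) by simp
  qed
  moreover have "det A = (-1) ^ (m + n)" using e(1) mn(2) by simp
  ultimately show thesis using that mn(1) by blast
qed

text \<open>All factors exceed 1. Hence coinciding iterates at different indices give a multiplier
  other than 1, that is a self-similarity which really scales.\<close>

lemma quotients_prod_strict_mono: "x \<notin> \<rat> \<Longrightarrow> strict_mono (\<lambda>n. quotients_prod n x)"
  using quotients_prod_pos iterate_gt_1
  by (intro strict_mono_Suc_iff[THEN iffD2]) (simp add: quotients_prod_Suc)

lemma iterates_imp_sim_packing:
  assumes \<alpha>: "\<alpha> > 0" "\<alpha> \<notin> \<rat>" and \<beta>: "\<beta> > 0" "\<beta> \<notin> \<rat>"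
    and eq: "(gauss ^^ m) \<alpha> = (gauss ^^ n) \<beta>"
  obtains \<mu> A b where "\<mu> > 0" "orthogonal_matrix A" "det A = (-1) ^ (m + n)"
    "act (similarity_map \<mu> A b) (packing \<alpha>) = packing \<beta>" "\<alpha> = \<beta> \<longrightarrow> m \<noteq> n \<longrightarrow> \<mu> \<noteq> 1"
proof -
  define l where "l = quotients_prod m \<alpha> / quotients_prod n \<beta>"
  define \<epsilon> :: int where "\<epsilon> = (-1) ^ (m + n)"
  have pos: "quotients_prod m \<alpha> > 0" "quotients_prod n \<beta> > 0"
    using quotients_prod_pos \<alpha>(2) \<beta>(2) by blast+
  then have l: "l > 0" "l * quotients_prod n \<beta> = quotients_prod m \<alpha>" by (simp_all add: l_def)
  then have "merging \<epsilon> l \<alpha> \<beta>" unfolding merging_def \<epsilon>_def using eq by blast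
  then have "unimodular \<epsilon> l \<alpha> \<beta>" using merging_imp_unimodular \<alpha>(2) \<beta>(2) by blast
  moreover have "\<epsilon> = 1 \<or> \<epsilon> = -1" unfolding \<epsilon>_def by (cases "even (m + n)") auto
  ultimately obtain A b where "orthogonal_matrix A" "det A = of_int \<epsilon>"
    "act (similarity_map (1 / l\<^sup>2) A b) (packing \<alpha>) = packing \<beta>"
    by (rule unimodular_imp_similar[OF _ _ \<alpha>(1) \<beta>(1) l(1)])
  moreover have "1 / l\<^sup>2 \<noteq> 1" if "\<alpha> = \<beta>" "m \<noteq> n"
  proof -
    have "quotients_prod m \<alpha> \<noteq> quotients_prod n \<alpha>"
      using strict_mono_eq[OF quotients_prod_strict_mono[OF \<alpha>(2)]] that(2) by simp
    then have "l \<noteq> 1" using pos that(1) by (simp add: l_def)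
    then show ?thesis using l(1) by (simp add: power2_eq_1_iff)
  qed
  moreover have "1 / l\<^sup>2 > 0" using l(1) by simp
  ultimately show thesis using that[of "1 / l\<^sup>2"] unfolding \<epsilon>_def by simp
qed

lemma similarity_packing_iff:
  assumes \<alpha>: "\<alpha> > 0" "\<alpha> \<notin> \<rat>" and \<beta>: "\<beta> > 0" "\<beta> \<notin> \<rat>"
  shows "(packing \<alpha>, packing \<beta>) \<in> similarity \<longleftrightarrow> (\<exists>m n. (gauss ^^ m) \<alpha> = (gauss ^^ n) \<beta>)"
proof
  assume "(packing \<alpha>, packing \<beta>) \<in> similarity"
  then obtain \<mu> A b where "\<mu> > 0" "orthogonal_matrix A" "act (similarity_map \<mu> A b) (packing \<alpha>) = packing \<beta>"
    by (auto simp: similarity_def is_similarity_def)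
  then show "\<exists>m n. (gauss ^^ m) \<alpha> = (gauss ^^ n) \<beta>"
    using sim_packing_imp_iterates[OF \<alpha> \<beta>, of A \<mu> b] by metis
next
  assume "\<exists>m n. (gauss ^^ m) \<alpha> = (gauss ^^ n) \<beta>"
  then obtain m n where mn: "(gauss ^^ m) \<alpha> = (gauss ^^ n) \<beta>" by blast
  obtain \<mu> A b where A: "\<mu> > 0" "orthogonal_matrix A" "act (similarity_map \<mu> A b) (packing \<alpha>) = packing \<beta>"
    by (rule iterates_imp_sim_packing[OF \<alpha> \<beta> mn])
  then have "is_similarity (similarity_map \<mu> A b)" unfolding is_similarity_def by blast
  then show "(packing \<alpha>, packing \<beta>) \<in> similarity" unfolding similarity_def using A(3) by force
qed

lemma similarity_map_id:
  assumes "similarity_map \<mu> A b = id" "orthogonal_matrix A" "\<mu> > 0"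
  shows "\<mu> = 1"
proof -
  have e: "similarity_map \<mu> A b x = x" for x using assms(1) by simp
  have "b = 0" using e[of 0] by (simp add: similarity_map_def)
  then have "\<mu> *\<^sub>R (A *v axis 1 1) = axis 1 1" using e[of "axis 1 1"] by (simp add: similarity_map_def)
  then have "norm (\<mu> *\<^sub>R (A *v axis 1 1)) = norm (axis 1 1 :: real^2)" by simp
  moreover have "norm (A *v axis 1 1) = norm (axis 1 1 :: real^2)"
    using assms(2) orthogonal_transformation_matrix[of "(*v) A"] orthogonal_transformation_norm
    by (metis matrix_of_matrix_vector_mul matrix_vector_mul_linear)
  ultimately show ?thesis using assms(3) by simp
qed

lemma self_similar_packing_iff:
  assumes \<alpha>: "\<alpha> > 0" "\<alpha> \<notin> \<rat>"
  shows "self_similar (packing \<alpha>) \<longleftrightarrow> (\<exists>m n. m \<noteq> n \<and> (gauss ^^ m) \<alpha> = (gauss ^^ n) \<alpha>)"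
proof
  assume "self_similar (packing \<alpha>)"
  then obtain \<mu> A b where s: "\<mu> > 0" "orthogonal_matrix A" "act (similarity_map \<mu> A b) (packing \<alpha>) = packing \<alpha>"
    "similarity_map \<mu> A b \<noteq> id"
    by (auto simp: self_similar_def self_similarity_def is_similarity_def)
  obtain m n where "(gauss ^^ m) \<alpha> = (gauss ^^ n) \<alpha>" "m = n \<Longrightarrow> similarity_map \<mu> A b = id"
    by (rule sim_packing_imp_iterates[OF \<alpha> \<alpha> s(2,1,3)]) blast
  then show "\<exists>m n. m \<noteq> n \<and> (gauss ^^ m) \<alpha> = (gauss ^^ n) \<alpha>" using s(4) by blast
next
  assume "\<exists>m n. m \<noteq> n \<and> (gauss ^^ m) \<alpha> = (gauss ^^ n) \<alpha>"
  then obtain m n where mn: "m \<noteq> n" "(gauss ^^ m) \<alpha> = (gauss ^^ n) \<alpha>" by blast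
  obtain \<mu> A b where A: "\<mu> > 0" "orthogonal_matrix A" "det A = (-1) ^ (m + n)"
    "act (similarity_map \<mu> A b) (packing \<alpha>) = packing \<alpha>" and ne: "\<alpha> = \<alpha> \<longrightarrow> m \<noteq> n \<longrightarrow> \<mu> \<noteq> 1"
    by (rule iterates_imp_sim_packing[OF \<alpha> \<alpha> mn(2)])
  have "similarity_map \<mu> A b \<noteq> id" using similarity_map_id[OF _ A(2,1)] ne mn(1) by auto
  moreover have "is_similarity (similarity_map \<mu> A b)" unfolding is_similarity_def using A(1,2) by blast
  ultimately show "self_similar (packing \<alpha>)" unfolding self_similar_def self_similarity_def using A(4) by blast
qed

definition reversible :: "circ set \<Rightarrow> bool" where
  "reversible P \<longleftrightarrow> (\<exists>\<Phi>. self_similarity \<Phi> P \<and> orientation_reversing \<Phi>)"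

lemma reversible_packing_iff:
  assumes \<alpha>: "\<alpha> > 0" "\<alpha> \<notin> \<rat>"
  shows "reversible (packing \<alpha>) \<longleftrightarrow> (\<exists>m n. odd (m + n) \<and> (gauss ^^ m) \<alpha> = (gauss ^^ n) \<alpha>)"
proof
  assume "reversible (packing \<alpha>)"
  then obtain \<mu> A b where s: "\<mu> > 0" "orthogonal_matrix A" "act (similarity_map \<mu> A b) (packing \<alpha>) = packing \<alpha>"
    "det A = -1"
    by (auto simp: reversible_def self_similarity_def orientation_reversing_def)
  obtain m n where mn: "(gauss ^^ m) \<alpha> = (gauss ^^ n) \<alpha>" "det A = (-1) ^ (m + n)"
    by (rule sim_packing_imp_iterates[OF \<alpha> \<alpha> s(2,1,3)]) blast
  have "odd (m + n)"
  proof
    assume "even (m + n)"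
    then have "(-1 :: real) ^ (m + n) = 1" by simp
    then show False using mn(2) s(4) by linarith
  qed
  then show "\<exists>m n. odd (m + n) \<and> (gauss ^^ m) \<alpha> = (gauss ^^ n) \<alpha>" using mn(1) by blast
next
  assume "\<exists>m n. odd (m + n) \<and> (gauss ^^ m) \<alpha> = (gauss ^^ n) \<alpha>"
  then obtain m n where mn: "odd (m + n)" "(gauss ^^ m) \<alpha> = (gauss ^^ n) \<alpha>" by blast
  obtain \<mu> A b where A: "\<mu> > 0" "orthogonal_matrix A" "det A = (-1) ^ (m + n)"
    "act (similarity_map \<mu> A b) (packing \<alpha>) = packing \<alpha>"
    by (rule iterates_imp_sim_packing[OF \<alpha> \<alpha> mn(2)])
  have "det A = -1" using A(3) mn(1) by simp
  then have "is_similarity (similarity_map \<mu> A b)" "orientation_reversing (similarity_map \<mu> A b)"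
    unfolding is_similarity_def orientation_reversing_def using A(1,2) by blast+
  then show "reversible (packing \<alpha>)" unfolding reversible_def self_similarity_def using A(4) by blast
qed

lemma equiv_similarity: "equiv UNIV similarity"
proof (rule equivI)
  show "similarity \<subseteq> UNIV \<times> UNIV" by simp
  show "refl similarity"
  proof (rule reflI)
    fix P show "(P, P) \<in> similarity"
      unfolding similarity_def is_similarity_iff using sim_id act_id[of P] by force
  qed
  show "sym similarity"
  proof (rule symI)
    fix P Q assume "(P, Q) \<in> similarity"
    then obtain \<epsilon> \<Phi> where s: "sim \<epsilon> \<Phi>" "Q = act \<Phi> P" by (auto simp: similarity_def is_similarity_iff)
    obtain \<Psi> where i: "sim \<epsilon> \<Psi>" "\<Psi> \<circ> \<Phi> = id" using sim_inverse[OF s(1)] by metis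
    have "P = act \<Psi> Q" unfolding s(2) act_comp[symmetric] i(2) act_id ..
    then show "(Q, P) \<in> similarity" unfolding similarity_def is_similarity_iff using i(1) by blast
  qed
  show "trans similarity"
  proof (rule transI)
    fix P Q R assume "(P, Q) \<in> similarity" "(Q, R) \<in> similarity"
    then obtain \<epsilon> \<Phi> \<epsilon>' \<Psi> where "sim \<epsilon> \<Phi>" "Q = act \<Phi> P" "sim \<epsilon>' \<Psi>" "R = act \<Psi> Q"
      by (auto simp: similarity_def is_similarity_iff)
    then have "sim (\<epsilon>' * \<epsilon>) (\<Psi> \<circ> \<Phi>)" "R = act (\<Psi> \<circ> \<Phi>) P" using sim_comp by (auto simp: act_comp)
    then show "(P, R) \<in> similarity" unfolding similarity_def is_similarity_iff by blast
  qed
qed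

text \<open>The sign of the connecting similarity enters the conjugate twice, so the orientation is
  preserved even if that similarity reverses it.\<close>

lemma self_similarity_conjugate:
  assumes "(P, Q) \<in> similarity" "sim \<epsilon> \<Phi>" "act \<Phi> P = P"
  obtains \<Psi> where "sim \<epsilon> \<Psi>" "act \<Psi> Q = Q" "\<Psi> = id \<Longrightarrow> \<Phi> = id"
proof -
  obtain \<delta> \<Theta> where t: "sim \<delta> \<Theta>" "Q = act \<Theta> P" using assms(1) by (auto simp: similarity_def is_similarity_iff)
  obtain \<Theta>' where i: "sim \<delta> \<Theta>'" "\<Theta>' \<circ> \<Theta> = id" "\<Theta> \<circ> \<Theta>' = id" using sim_inverse[OF t(1)] .
  define \<Psi> where "\<Psi> = \<Theta> \<circ> (\<Phi> \<circ> \<Theta>')"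
  have "sim (\<delta> * (\<epsilon> * \<delta>)) \<Psi>" unfolding \<Psi>_def by (intro sim_comp t(1) i(1) assms(2))
  moreover have "\<delta> * (\<epsilon> * \<delta>) = \<epsilon>" using sim_values[OF t(1)] by auto
  moreover have "act \<Theta>' Q = P" unfolding t(2) act_comp[symmetric] i(2) act_id ..
  then have "act \<Psi> Q = Q" unfolding \<Psi>_def act_comp using assms(3) t(2) by simp
  moreover have "\<Phi> = id" if "\<Psi> = id"
  proof -
    have "\<Theta>' \<circ> \<Psi> \<circ> \<Theta> = (\<Theta>' \<circ> \<Theta>) \<circ> \<Phi> \<circ> (\<Theta>' \<circ> \<Theta>)" by (simp add: \<Psi>_def comp_assoc)
    then show ?thesis using i(2) that by simp
  qed
  ultimately show thesis using that by simp
qed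

lemma self_similar_similarity:
  assumes "(P, Q) \<in> similarity" "self_similar P"
  shows "self_similar Q"
proof -
  obtain \<epsilon> \<Phi> where "sim \<epsilon> \<Phi>" "act \<Phi> P = P" "\<Phi> \<noteq> id"
    using assms(2) by (auto simp: self_similar_def self_similarity_def is_similarity_iff)
  then obtain \<Psi> where "sim \<epsilon> \<Psi>" "act \<Psi> Q = Q" "\<Psi> \<noteq> id"
    using self_similarity_conjugate[OF assms(1)] by metis
  then show ?thesis by (auto simp: self_similar_def self_similarity_def is_similarity_iff)
qed

lemma reversible_similarity:
  assumes "(P, Q) \<in> similarity" "reversible P"
  shows "reversible Q"
proof -
  obtain \<Phi> where "sim (-1) \<Phi>" "act \<Phi> P = P"
    using assms(2) by (auto simp: reversible_def self_similarity_def orientation_reversing_iff)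
  then obtain \<Psi> where "sim (-1) \<Psi>" "act \<Psi> Q = Q"
    using self_similarity_conjugate[OF assms(1)] by metis
  then show ?thesis by (auto simp: reversible_def self_similarity_def orientation_reversing_iff is_similarity_iff)
qed

lemma equiv_cyclic_perm: "equiv UNIV cyclic_perm"
proof (rule equivI)
  show "cyclic_perm \<subseteq> UNIV \<times> UNIV" by simp
  show "refl cyclic_perm" by (rule reflI) (auto simp: cyclic_perm_def intro: exI[of _ 0])
  show "sym cyclic_perm"
  proof (rule symI)
    fix s t assume "(s, t) \<in> cyclic_perm"
    then obtain n where n: "t = rotate n s" by (auto simp: cyclic_perm_def)
    have "rotate (length s * n - n) t = rotate (length s * n) s"
    proof (cases "s = []")
      case False
      then have "length s * n - n + n = length s * n" by (cases "length s") simp_all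
      then show ?thesis unfolding n rotate_rotate by simp
    qed (simp add: n)
    then have "s = rotate (length s * n - n) t" by simp
    then show "(t, s) \<in> cyclic_perm" by (auto simp: cyclic_perm_def)
  qed
  show "trans cyclic_perm" by (rule transI) (auto simp: cyclic_perm_def rotate_rotate)
qed

lemma rotate_minimal_period:
  assumes "minimal_period a s"
  shows "minimal_period a (rotate n s)"
proof -
  obtain N where N: "\<And>k. a (N + k) = s ! (k mod length s)" and ne: "s \<noteq> []"
    using assms by (auto simp: minimal_period_def periodic_part_def)
  have "a (N + n + k) = rotate n s ! (k mod length (rotate n s))" for k
  proof -
    have "k mod length s < length s" using ne by simp
    then show ?thesis using N[of "n + k"] by (simp add: nth_rotate add.assoc mod_add_right_eq)
  qed
  then have "periodic_part a (rotate n s)" using ne by (auto simp: periodic_part_def)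
  then show ?thesis using assms by (simp add: minimal_period_def)
qed

lemma iterate_eq_period:
  assumes \<alpha>: "\<alpha> > 0" "\<alpha> \<notin> \<rat>" and eq: "(gauss ^^ m) \<alpha> = (gauss ^^ n) \<alpha>" and le: "m \<le> n"
  shows "eventual_period (digits \<alpha>) (n - m)"
proof -
  have t: "digits \<alpha> (m + k) = digits \<alpha> (n + k)" for k using eq iterate_eq_iff[OF \<alpha>(2,1) \<alpha>(2,1)] by blast
  have "digits \<alpha> (k + (n - m)) = digits \<alpha> k" if "k \<ge> m" for k using t[of "k - m"] that le by (simp add: add.commute)
  then show ?thesis unfolding eventual_period_def by blast
qed

lemma minimal_period_iterate:
  assumes \<alpha>: "\<alpha> > 0" "\<alpha> \<notin> \<rat>" and s: "minimal_period (digits \<alpha>) s"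
  obtains N where "(gauss ^^ (N + length s)) \<alpha> = (gauss ^^ N) \<alpha>" "length s > 0"
proof -
  have p: "periodic_part (digits \<alpha>) s" using s by (simp add: minimal_period_def)
  then have "eventual_period (digits \<alpha>) (length s)" by (rule periodic_part_eventual_period)
  then obtain N where N: "\<And>k. k \<ge> N \<Longrightarrow> digits \<alpha> (k + length s) = digits \<alpha> k" by (auto simp: eventual_period_def)
  have "digits \<alpha> (N + length s + k) = digits \<alpha> (N + k)" for k using N[of "N + k"] by (simp add: ac_simps)
  then have "(gauss ^^ (N + length s)) \<alpha> = (gauss ^^ N) \<alpha>" using iterate_eq_iff[OF \<alpha>(2,1) \<alpha>(2,1)] by blast
  moreover have "length s > 0" using p by (simp add: periodic_part_def)
  ultimately show thesis by (rule that)
qed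

lemma minimal_period_exists_iff:
  assumes \<alpha>: "\<alpha> > 0" "\<alpha> \<notin> \<rat>"
  shows "(\<exists>m n. m \<noteq> n \<and> (gauss ^^ m) \<alpha> = (gauss ^^ n) \<alpha>) \<longleftrightarrow> (\<exists>s. minimal_period (digits \<alpha>) s)"
proof
  assume "\<exists>m n. m \<noteq> n \<and> (gauss ^^ m) \<alpha> = (gauss ^^ n) \<alpha>"
  then obtain m n where "m < n" "(gauss ^^ m) \<alpha> = (gauss ^^ n) \<alpha>" by (metis linorder_neqE_nat)
  then have "eventual_period (digits \<alpha>) (n - m)" "n - m > 0" using iterate_eq_period[OF \<alpha>] by simp_all
  then show "\<exists>s. minimal_period (digits \<alpha>) s" using minimal_period_exists by metis
next
  assume "\<exists>s. minimal_period (digits \<alpha>) s"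
  then obtain s where "minimal_period (digits \<alpha>) s" by blast
  then obtain N where "(gauss ^^ (N + length s)) \<alpha> = (gauss ^^ N) \<alpha>" "length s > 0"
    by (rule minimal_period_iterate[OF \<alpha>])
  then show "\<exists>m n. m \<noteq> n \<and> (gauss ^^ m) \<alpha> = (gauss ^^ n) \<alpha>"
    by (intro exI[of _ "N + length s"] exI[of _ N]) simp
qed

text \<open>\<open>m + n\<close> has the parity of the difference of the indices, an eventual period
  and thus a multiple of the minimal length; conversely one minimal period is such a
  difference.\<close>

lemma odd_iterates_iff:
  assumes \<alpha>: "\<alpha> > 0" "\<alpha> \<notin> \<rat>" and s: "minimal_period (digits \<alpha>) s"
  shows "(\<exists>m n. odd (m + n) \<and> (gauss ^^ m) \<alpha> = (gauss ^^ n) \<alpha>) \<longleftrightarrow> odd (length s)"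
proof
  assume "\<exists>m n. odd (m + n) \<and> (gauss ^^ m) \<alpha> = (gauss ^^ n) \<alpha>"
  then obtain m n where "odd (m + n)" "(gauss ^^ m) \<alpha> = (gauss ^^ n) \<alpha>" "m \<le> n"
    by (metis add.commute nat_le_linear)
  then have "length s dvd n - m" "odd (n - m)"
    using minimal_period_dvd[OF s iterate_eq_period[OF \<alpha>]] by simp_all
  then show "odd (length s)" by (meson dvd_trans)
next
  assume odd: "odd (length s)"
  obtain N where "(gauss ^^ (N + length s)) \<alpha> = (gauss ^^ N) \<alpha>" by (rule minimal_period_iterate[OF \<alpha> s])
  moreover have "odd (N + length s + N)" using odd by simp
  ultimately show "\<exists>m n. odd (m + n) \<and> (gauss ^^ m) \<alpha> = (gauss ^^ n) \<alpha>" by blast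
qed

lemma packing_self_similar_half_plane_iff:
  assumes "\<alpha> > 0"
  shows "packing \<alpha> \<in> self_similar_half_plane_packings \<longleftrightarrow> \<alpha> \<notin> \<rat> \<and> (\<exists>s. minimal_period (digits \<alpha>) s)"
  using packing_half_plane[OF assms] packing_strip_iff[OF assms] self_similar_packing_iff[OF assms]
    minimal_period_exists_iff[OF assms]
  unfolding self_similar_half_plane_packings_def by auto

lemma minimal_periodic_part_digits:
  assumes "\<alpha> > 0" "\<alpha> \<notin> \<rat>" "minimal_period (digits \<alpha>) s"
  shows "minimal_periodic_part \<alpha> s"
  unfolding minimal_periodic_part_def using infinite_cf_digits[OF assms(2,1)] assms(3)
  by (intro exI[of _ "digits \<alpha>"]) (simp add: minimal_period_def)

lemma minimal_period_digits_non_repeating: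
  assumes "\<alpha> \<notin> \<rat>" "minimal_period (digits \<alpha>) s"
  shows "s \<in> non_repeating_seqs"
proof -
  obtain N where N: "\<And>k. digits \<alpha> (N + k) = s ! (k mod length s)" and ne: "s \<noteq> []"
    using assms(2) by (auto simp: minimal_period_def periodic_part_def)
  have "c > 0" if "c \<in> set s" for c
  proof -
    from \<open>c \<in> set s\<close> obtain i where i: "i < length s" "s ! i = c" unfolding in_set_conv_nth by blast
    \<comment> \<open>The index is advanced by a full period to be positive, because the digit at
      index 0 may be 0.\<close>
    have "digits \<alpha> (N + (length s + i)) = c" unfolding N using i by simp
    moreover have "N + (length s + i) > 0" using ne by simp
    ultimately show ?thesis using digits_pos[OF assms(1), of "N + (length s + i)"] by simp
  qed
  then show ?thesis
    using ne minimal_period_non_repeating[OF assms(2)] by (simp add: non_repeating_seqs_def)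
qed

lemma non_repeating_seq_digits:
  assumes "s \<in> non_repeating_seqs"
  obtains \<alpha> where "\<alpha> > 0" "\<alpha> \<notin> \<rat>" "minimal_period (digits \<alpha>) s"
proof -
  have s: "s \<noteq> []" "\<forall>c\<in>set s. c > 0" "non_repeating s" using assms by (auto simp: non_repeating_seqs_def)
  define a where "a = (\<lambda>k. s ! (k mod length s))"
  have "\<forall>k>0. a k > 0" using s(1,2) by (simp add: a_def)
  then obtain \<alpha> where "infinite_cf \<alpha> a" by (rule cf_convergent_converges)
  then have "\<alpha> > 0" "\<alpha> \<notin> \<rat>" "a = digits \<alpha>" by (simp_all add: infinite_cf_iff)
  then show thesis using that non_repeating_minimal_period[OF s(1,3)] unfolding a_def by simp
qed

lemma same_period_similar:
  assumes \<alpha>: "\<alpha> > 0" "\<alpha> \<notin> \<rat>" "minimal_period (digits \<alpha>) s"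
    and \<beta>: "\<beta> > 0" "\<beta> \<notin> \<rat>" "minimal_period (digits \<beta>) s"
  shows "(packing \<alpha>, packing \<beta>) \<in> similarity"
proof -
  obtain M where M: "\<And>k. digits \<alpha> (M + k) = s ! (k mod length s)"
    using \<alpha>(3) by (auto simp: minimal_period_def periodic_part_def)
  obtain N where N: "\<And>k. digits \<beta> (N + k) = s ! (k mod length s)"
    using \<beta>(3) by (auto simp: minimal_period_def periodic_part_def)
  have "(gauss ^^ M) \<alpha> = (gauss ^^ N) \<beta>" using iterate_eq_iff[OF \<alpha>(2,1) \<beta>(2,1)] M N by simp
  then show ?thesis using similarity_packing_iff[OF \<alpha>(1,2) \<beta>(1,2)] by blast
qed

lemma similar_same_period:
  assumes \<alpha>: "\<alpha> > 0" "\<alpha> \<notin> \<rat>" "minimal_period (digits \<alpha>) s"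
    and \<beta>: "\<beta> > 0" "\<beta> \<notin> \<rat>" "minimal_period (digits \<beta>) t"
    and sim: "(packing \<alpha>, packing \<beta>) \<in> similarity"
  shows "(s, t) \<in> cyclic_perm"
proof -
  obtain m n where "(gauss ^^ m) \<alpha> = (gauss ^^ n) \<beta>"
    using sim similarity_packing_iff[OF \<alpha>(1,2) \<beta>(1,2)] by blast
  then have "\<forall>k. digits \<alpha> (m + k) = digits \<beta> (n + k)"
    using iterate_eq_iff[OF \<alpha>(2,1) \<beta>(2,1)] by blast
  then have "minimal_period (digits \<beta>) s" using \<alpha>(3) by (rule minimal_period_tail)
  from minimal_period_rotate[OF this \<beta>(3)] show ?thesis by (simp add: cyclic_perm_def)
qed

text \<open>The required bijection, defined on a class without choosing a representative: it
  collects the periods of all irrational parameters whose packing lies in the class.\<close>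

definition periods :: "circ set set \<Rightarrow> nat list set" where
  "periods X = {s. \<exists>\<alpha>>0. \<alpha> \<notin> \<rat> \<and> packing \<alpha> \<in> X \<and> minimal_period (digits \<alpha>) s}"

lemma periods_similarity_class:
  assumes \<alpha>: "\<alpha> > 0" "\<alpha> \<notin> \<rat>" "minimal_period (digits \<alpha>) s"
  shows "periods (similarity `` {packing \<alpha>}) = cyclic_perm `` {s}"
proof
  show "periods (similarity `` {packing \<alpha>}) \<subseteq> cyclic_perm `` {s}"
    using similar_same_period[OF \<alpha>] by (auto simp: periods_def)
  show "cyclic_perm `` {s} \<subseteq> periods (similarity `` {packing \<alpha>})"
  proof
    fix t assume "t \<in> cyclic_perm `` {s}"
    then obtain n where "t = rotate n s" by (auto simp: cyclic_perm_def)
    then have "minimal_period (digits \<alpha>) t" using rotate_minimal_period[OF \<alpha>(3)] by simp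
    moreover have "packing \<alpha> \<in> similarity `` {packing \<alpha>}"
      using equiv_class_self[OF equiv_similarity] by blast
    ultimately show "t \<in> periods (similarity `` {packing \<alpha>})" using \<alpha>(1,2) unfolding periods_def by blast
  qed
qed

lemma self_similar_normal_form:
  assumes "P \<in> self_similar_half_plane_packings"
  obtains \<alpha> s where "\<alpha> > 0" "\<alpha> \<notin> \<rat>" "minimal_period (digits \<alpha>) s" "(P, packing \<alpha>) \<in> similarity"
    "similarity `` {P} = similarity `` {packing \<alpha>}"
proof -
  have P: "half_plane_packing P" "\<not> strip_packing P" "self_similar P"
    using assms by (auto simp: self_similar_half_plane_packings_def)
  obtain \<alpha> \<Phi> where \<alpha>: "\<alpha> > 0" "\<alpha> \<notin> \<rat>" "is_similarity \<Phi>" "P = act \<Phi> (packing \<alpha>)"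
    by (rule half_plane_packing_normal_form[OF P(1,2)])
  then have "(packing \<alpha>, P) \<in> similarity" unfolding similarity_def by blast
  then have sim: "(P, packing \<alpha>) \<in> similarity" using equiv_similarity by (meson equivE symD)
  then have "self_similar (packing \<alpha>)" using self_similar_similarity P(3) by blast
  then obtain s where "minimal_period (digits \<alpha>) s"
    using self_similar_packing_iff[OF \<alpha>(1,2)] minimal_period_exists_iff[OF \<alpha>(1,2)] by blast
  then show thesis using that \<alpha>(1,2) sim equiv_class_eq[OF equiv_similarity sim] by blast
qed

theorem theorem1p4:
  shows "\<exists>F. bij_betw F (self_similar_half_plane_packings // similarity)
                         (non_repeating_seqs // cyclic_perm) \<and>
             (\<forall>\<alpha>>0. packing \<alpha> \<in> self_similar_half_plane_packings \<longrightarrow>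
                (\<exists>s. minimal_periodic_part \<alpha> s \<and>
                     F (similarity `` {packing \<alpha>}) = cyclic_perm `` {s})) \<and>
             (\<forall>P\<in>self_similar_half_plane_packings. \<forall>s\<in>F (similarity `` {P}).
                (\<exists>\<Phi>. self_similarity \<Phi> P \<and> orientation_reversing \<Phi>) \<longleftrightarrow> odd (length s))"
proof (intro exI[of _ periods] conjI)
  let ?A = "self_similar_half_plane_packings // similarity" and ?B = "non_repeating_seqs // cyclic_perm"
  show "bij_betw periods ?A ?B"
  proof (rule bij_betw_imageI)
    show "inj_on periods ?A"
    proof (rule inj_onI)
      fix X Y assume X: "X \<in> ?A" and Y: "Y \<in> ?A" and eq: "periods X = periods Y"
      obtain P where "P \<in> self_similar_half_plane_packings" "X = similarity `` {P}" using X by (auto elim: quotientE)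
      then obtain \<alpha> s where \<alpha>: "\<alpha> > 0" "\<alpha> \<notin> \<rat>" "minimal_period (digits \<alpha>) s" "X = similarity `` {packing \<alpha>}"
        using self_similar_normal_form by metis
      obtain Q where "Q \<in> self_similar_half_plane_packings" "Y = similarity `` {Q}" using Y by (auto elim: quotientE)
      then obtain \<gamma> where \<gamma>: "Y = similarity `` {packing \<gamma>}" using self_similar_normal_form by metis
      \<comment> \<open>The period of a parameter for \<open>X\<close> is thereby realised by some
        parameter \<open>\<beta>\<close> for \<open>Y\<close>. The two parameters share the list
        \<open>s\<close> itself, so their packings are similar and the classes coincide.\<close>
      have "s \<in> periods Y"
        unfolding eq[symmetric] \<alpha>(4) periods_similarity_class[OF \<alpha>(1-3)]
        using equiv_class_self[OF equiv_cyclic_perm] by blast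
      then obtain \<beta> where \<beta>: "\<beta> > 0" "\<beta> \<notin> \<rat>" "packing \<beta> \<in> Y" "minimal_period (digits \<beta>) s"
        by (auto simp: periods_def)
      have "(packing \<gamma>, packing \<beta>) \<in> similarity" using \<beta>(3) \<gamma> by simp
      then have "Y = similarity `` {packing \<beta>}" unfolding \<gamma> by (rule equiv_class_eq[OF equiv_similarity])
      moreover have "similarity `` {packing \<alpha>} = similarity `` {packing \<beta>}"
        by (rule equiv_class_eq[OF equiv_similarity same_period_similar[OF \<alpha>(1-3) \<beta>(1,2,4)]])
      ultimately show "X = Y" using \<alpha>(4) by simp
    qed
    show "periods ` ?A = ?B"
    proof (intro subset_antisym subsetI)
      fix Y assume "Y \<in> periods ` ?A"
      then obtain X where X: "X \<in> ?A" "Y = periods X" by blast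
      obtain P where "P \<in> self_similar_half_plane_packings" "X = similarity `` {P}" using X(1) by (auto elim: quotientE)
      then obtain \<alpha> s where \<alpha>: "\<alpha> > 0" "\<alpha> \<notin> \<rat>" "minimal_period (digits \<alpha>) s" "X = similarity `` {packing \<alpha>}"
        using self_similar_normal_form by metis
      show "Y \<in> ?B"
        unfolding X(2) \<alpha>(4) periods_similarity_class[OF \<alpha>(1-3)]
        by (intro quotientI minimal_period_digits_non_repeating[OF \<alpha>(2,3)])
    next
      fix Y assume "Y \<in> ?B"
      then obtain s where s: "s \<in> non_repeating_seqs" "Y = cyclic_perm `` {s}" by (auto elim: quotientE)
      obtain \<alpha> where \<alpha>: "\<alpha> > 0" "\<alpha> \<notin> \<rat>" "minimal_period (digits \<alpha>) s"
        by (rule non_repeating_seq_digits[OF s(1)])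
      have "packing \<alpha> \<in> self_similar_half_plane_packings"
        using packing_self_similar_half_plane_iff[OF \<alpha>(1)] \<alpha>(2,3) by blast
      then have "similarity `` {packing \<alpha>} \<in> ?A" by (rule quotientI)
      then show "Y \<in> periods ` ?A" using periods_similarity_class[OF \<alpha>] s(2) by (metis imageI)
    qed
  qed
  show "\<forall>\<alpha>>0. packing \<alpha> \<in> self_similar_half_plane_packings \<longrightarrow>
      (\<exists>s. minimal_periodic_part \<alpha> s \<and> periods (similarity `` {packing \<alpha>}) = cyclic_perm `` {s})"
  proof (intro allI impI)
    fix \<alpha> :: real assume "\<alpha> > 0" "packing \<alpha> \<in> self_similar_half_plane_packings"
    then obtain s where "\<alpha> \<notin> \<rat>" "minimal_period (digits \<alpha>) s"
      using packing_self_similar_half_plane_iff by blast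
    with \<open>\<alpha> > 0\<close> show "\<exists>s. minimal_periodic_part \<alpha> s \<and> periods (similarity `` {packing \<alpha>}) = cyclic_perm `` {s}"
      using minimal_periodic_part_digits periods_similarity_class by blast
  qed
  show "\<forall>P\<in>self_similar_half_plane_packings. \<forall>s\<in>periods (similarity `` {P}).
      (\<exists>\<Phi>. self_similarity \<Phi> P \<and> orientation_reversing \<Phi>) \<longleftrightarrow> odd (length s)"
  proof (intro ballI)
    fix P s assume "s \<in> periods (similarity `` {P})"
    then obtain \<alpha> where \<alpha>: "\<alpha> > 0" "\<alpha> \<notin> \<rat>" "(P, packing \<alpha>) \<in> similarity" "minimal_period (digits \<alpha>) s"
      by (auto simp: periods_def)
    have "(packing \<alpha>, P) \<in> similarity" using \<alpha>(3) equiv_similarity by (meson equivE symD)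
    then have "reversible P \<longleftrightarrow> reversible (packing \<alpha>)" using reversible_similarity \<alpha>(3) by blast
    then show "(\<exists>\<Phi>. self_similarity \<Phi> P \<and> orientation_reversing \<Phi>) \<longleftrightarrow> odd (length s)"
      using reversible_packing_iff[OF \<alpha>(1,2)] odd_iterates_iff[OF \<alpha>(1,2,4)] by (simp add: reversible_def)
  qed
qed

end
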